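(* Let $S=\{S_t\}_{t\in\mathbb{R}_+}$ be the aggregate process induced by a $P$-risk process $(N,X)$ on a probability space $(\Omega,\Sigma,P)$, let $W$ be the interarrival process of $N$, and let $\Theta$ be a real-valued random variable on $\Omega$ with $P_\Theta((0,\infty))=1$, where $\Sigma=\mathcal{F}_\infty$. Suppose there exists a regular conditional probability $\{P_\theta\}_{\theta\in(0,\infty)}$ of $P$ over $P_\Theta$ consistent with $\Theta$. Assume that: (a1) the processes $W$ and $X$ are $P$-conditionally mutually independent given $\Theta$; (a2) the random variable $\Theta$ and the sequence $X$ are $P$-independent; and that the random variables $X_1$ and $\Theta$ are $P$-integrable. Then the following are equivalent: (i) the aggregate process $S$ is a $P$-compound mixed Poisson process with parameters $\Theta$ and $P_{X_1}$ (i.e. $N$ is a $P$-mixed Poisson process with parameter $\Theta$); (ii) the process $\{S_t-t\,\Theta\,\mathbb{E}_P[X_1]\}_{t\in\mathbb{R}_+}$ is an $\mathcal{F}$-martingale in $\mathcal{L}^1(P)$.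
   Context: Counting process: $N=\{N_t\}_{t\in\mathbb{R}_+}$ is a family of random variables such that, for every $\omega\in\Omega$ (the exceptional null set is assumed empty): $N_0(\omega)=0$; $N_t(\omega)\in\mathbb{N}_0$ for all $t$ (explosion $\{\sup_n T_n<\infty\}$ is assumed empty); $N_t(\omega)=\inf_{s>t}N_s(\omega)$ for all $t\ge 0$; $\sup_{s<t}N_s(\omega)\le N_t(\omega)\le \sup_{s<t}N_s(\omega)+1$ for all $t>0$; and $\sup_{t}N_t(\omega)=\infty$. The arrival process is $T_n:=\inf\{t\in\mathbb{R}_+:N_t=n\}$, $n\in\mathbb{N}_0$, and the interarrival process is $W=\{W_n\}_{n\in\mathbb{N}}$, $W_n:=T_n-T_{n-1}$. Size process: $X=\{X_n\}_{n\in\mathbb{N}}$ is a sequence of positive random variables. The aggregate process induced by $N$ and $X$ is $S_t:=\sum_{k=1}^{N_t}X_k$. The pair $(N,X)$ is a $P$-risk process if $N$ is a counting process, $X$ is $P$-i.i.d., and $N$ and $X$ are $P$-independent. Image measures: $P_\Theta$, $P_{X_1}$ denote the laws of $\Theta$, $X_1$ under $P$. Mixed Poisson process: $N$ is a $P$-mixed Poisson process with parameter $\Theta$ if it has $P$-conditionally independent increments given $\Theta$ (for all $0=t_0<t_1<\dots<t_m$ the increments $N_{t_j}-N_{t_{j-1}}$, $1\le j\le m$, are conditionally independent given $\sigma(\Theta)$), $P$-conditionally stationary increments given $\Theta$ (for all $0=t_0<\dots<t_m$ and $h\ge0$ the conditional joint law given $\Theta$ of $(N_{t_j+h}-N_{t_{j-1}+h})_{1\le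 j\le m}$ equals that of $(N_{t_j}-N_{t_{j-1}})_{1\le j\le m}$ almost surely), and for each $t>0$ the conditional law of $N_t$ given $\Theta$ is, $P\restriction\sigma(\Theta)$-a.s., the Poisson law with parameter $t\Theta$. The aggregate process $S$ is a $P$-compound mixed Poisson process with parameters $\Theta$ and $P_{X_1}$ if it is induced by a $P$-risk process $(N,X)$ with $N$ a $P$-mixed Poisson process with parameter $\Theta$. Regular conditional probability: a family $\{P_\theta\}_{\theta\in(0,\infty)}$ of probability measures on $\Sigma$ such that for each $D\in\Sigma$ the function $\theta\mapsto P_\theta(D)$ is Borel measurable and $\int P_\theta(D)\,P_\Theta(d\theta)=P(D)$. It is consistent with $\Theta$ if for each Borel $B\subseteq(0,\infty)$, $P_\theta(\Theta^{-1}(B))=1$ for $P_\Theta$-almost all $\theta\in B$. Filtration: $\mathcal{F}^S_t:=\sigma(S_s:s\le t)$, $\mathcal{F}_t:=\sigma(\mathcal{F}^S_t\cup\sigma(\Theta))$, $\mathcal{F}:=\{\mathcal{F}_t\}_{t\in\mathbb{R}_+}$, $\mathcal{F}_\infty:=\sigma\bigl(\bigcup_t\mathcal{F}^S_t\cup\sigma(\Theta)\bigr)$. Martingale: a process $\{Z_t\}$ is an $\mathcal{F}$-martingale in $\mathcal{L}^1(P)$ if each $Z_t$ is $\mathcal{F}_t$-measurable and $P$-integrable and $\int_E Z_s\,dP=\int_E Z_t\,dP$ for all $s\le t$ and $E\in\mathcal{F}_s$. *)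

theory Defs
  imports "HOL-Probability.Probability"
begin

text \<open>
  Conventions. The probability space \<open>(\<Omega>, \<Sigma>, P)\<close> is a measure \<open>M\<close> satisfying
  \<^const>\<open>prob_space\<close>. Continuous-time processes are functions of a real time
  of which only the values at times \<open>t \<ge> 0\<close> matter. Sequences indexed by the positive
  integers are functions on \<^typ>\<open>nat\<close> of which only the values at \<open>n \<ge> 1\<close> matter.
\<close>

definition sigma_process ::
  "'a set \<Rightarrow> 'i set \<Rightarrow> ('i \<Rightarrow> 'a \<Rightarrow> 'b) \<Rightarrow> 'b measure \<Rightarrow> 'a measure" where
  "sigma_process \<Omega> I Z K = sigma \<Omega> (\<Union>i\<in>I. {Z i -` B \<inter> \<Omega> | B. B \<in> sets K})"

definition sigma_rv :: "'a measure \<Rightarrow> ('a \<Rightarrow> real) \<Rightarrow> 'a measure" where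
  "sigma_rv M \<Theta> = vimage_algebra (space M) \<Theta> borel"


subsection \<open>Conditional probability and conditional independence\<close>

definition cprob :: "'a measure \<Rightarrow> 'a measure \<Rightarrow> 'a set \<Rightarrow> 'a \<Rightarrow> real" where
  "cprob M F A = real_cond_exp M F (indicator A)"

text \<open>The conditional analogues of \<^const>\<open>prob_space.indep_sets\<close>,
  \<^const>\<open>prob_space.indep_set\<close> and \<^const>\<open>prob_space.indep_vars\<close>.\<close>

definition cond_indep_sets ::
  "'a measure \<Rightarrow> 'a measure \<Rightarrow> ('i \<Rightarrow> 'a set set) \<Rightarrow> 'i set \<Rightarrow> bool" where
  "cond_indep_sets M F A I \<longleftrightarrow>
     (\<forall>i\<in>I. A i \<subseteq> sets M) \<and>
     (\<forall>J\<subseteq>I. J \<noteq> {} \<longrightarrow> finite J \<longrightarrow>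
        (\<forall>E. (\<forall>j\<in>J. E j \<in> A j) \<longrightarrow>
          (AE \<omega> in M. cprob M F (\<Inter>j\<in>J. E j) \<omega> = (\<Prod>j\<in>J. cprob M F (E j) \<omega>))))"

definition cond_indep_set ::
  "'a measure \<Rightarrow> 'a measure \<Rightarrow> 'a set set \<Rightarrow> 'a set set \<Rightarrow> bool" where
  "cond_indep_set M F A B \<longleftrightarrow> cond_indep_sets M F (case_bool A B) UNIV"

definition cond_indep_vars ::
  "'a measure \<Rightarrow> 'a measure \<Rightarrow> 'b measure \<Rightarrow> ('i \<Rightarrow> 'a \<Rightarrow> 'b) \<Rightarrow> 'i set \<Rightarrow> bool" where
  "cond_indep_vars M F K Z I \<longleftrightarrow>
     (\<forall>i\<in>I. Z i \<in> measurable M K) \<and>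
     cond_indep_sets M F (\<lambda>i. {Z i -` B \<inter> space M | B. B \<in> sets K}) I"


subsection \<open>Counting, arrival, interarrival, size and aggregate processes\<close>

text \<open>Infima and suprema are taken in \<^typ>\<open>enat\<close>, because the supremum of an unbounded set
  is unspecified on \<^typ>\<open>nat\<close>.\<close>

definition counting_process :: "'a measure \<Rightarrow> (real \<Rightarrow> 'a \<Rightarrow> nat) \<Rightarrow> bool" where
  "counting_process M N \<longleftrightarrow>
     (\<forall>t\<ge>0. N t \<in> measurable M (count_space UNIV)) \<and>
     (\<forall>\<omega>\<in>space M.
        N 0 \<omega> = 0 \<and>
        (\<forall>t\<ge>0. enat (N t \<omega>) = (INF s\<in>{t<..}. enat (N s \<omega>))) \<and>
        (\<forall>t>0. (SUP s\<in>{0..<t}. enat (N s \<omega>)) \<le> enat (N t \<omega>) \<and>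
                enat (N t \<omega>) \<le> (SUP s\<in>{0..<t}. enat (N s \<omega>)) + 1) \<and>
        (SUP t\<in>{0..}. enat (N t \<omega>)) = \<infinity>)"

definition arrival :: "(real \<Rightarrow> 'a \<Rightarrow> nat) \<Rightarrow> nat \<Rightarrow> 'a \<Rightarrow> real" where
  "arrival N n \<omega> = Inf {t. 0 \<le> t \<and> N t \<omega> = n}"

definition interarrival :: "(real \<Rightarrow> 'a \<Rightarrow> nat) \<Rightarrow> nat \<Rightarrow> 'a \<Rightarrow> real" where
  "interarrival N n \<omega> = arrival N n \<omega> - arrival N (n - 1) \<omega>"

definition size_process :: "'a measure \<Rightarrow> (nat \<Rightarrow> 'a \<Rightarrow> real) \<Rightarrow> bool" where
  "size_process M X \<longleftrightarrow>
     (\<forall>n\<ge>1. X n \<in> borel_measurable M \<and> (\<forall>\<omega>\<in>space M. 0 < X n \<omega>))"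

definition aggregate :: "(real \<Rightarrow> 'a \<Rightarrow> nat) \<Rightarrow> (nat \<Rightarrow> 'a \<Rightarrow> real) \<Rightarrow> real \<Rightarrow> 'a \<Rightarrow> real" where
  "aggregate N X t \<omega> = (\<Sum>k=1..N t \<omega>. X k \<omega>)"

definition sigma_counting :: "'a measure \<Rightarrow> (real \<Rightarrow> 'a \<Rightarrow> nat) \<Rightarrow> 'a measure" where
  "sigma_counting M N = sigma_process (space M) {0..} N (count_space UNIV)"

definition sigma_seq :: "'a measure \<Rightarrow> (nat \<Rightarrow> 'a \<Rightarrow> real) \<Rightarrow> 'a measure" where
  "sigma_seq M X = sigma_process (space M) {1..} X borel"

definition iid :: "'a measure \<Rightarrow> (nat \<Rightarrow> 'a \<Rightarrow> real) \<Rightarrow> bool" where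
  "iid M X \<longleftrightarrow>
     prob_space.indep_vars M (\<lambda>_. borel) X {1..} \<and>
     (\<forall>n\<ge>1. distr M borel (X n) = distr M borel (X 1))"

definition risk_process ::
  "'a measure \<Rightarrow> (real \<Rightarrow> 'a \<Rightarrow> nat) \<Rightarrow> (nat \<Rightarrow> 'a \<Rightarrow> real) \<Rightarrow> bool" where
  "risk_process M N X \<longleftrightarrow>
     counting_process M N \<and> size_process M X \<and> iid M X \<and>
     prob_space.indep_set M (sets (sigma_counting M N)) (sets (sigma_seq M X))"


subsection \<open>Mixed Poisson and compound mixed Poisson processes\<close>

definition time_grid :: "nat \<Rightarrow> (nat \<Rightarrow> real) \<Rightarrow> bool" where
  "time_grid m \<tau> \<longleftrightarrow> \<tau> 0 = 0 \<and> (\<forall>i<m. \<tau> i < \<tau> (Suc i))"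

text \<open>The \<open>j\<close>-th increment over the grid \<open>\<tau>\<close> shifted by \<open>h\<close>. It is integer valued to avoid
  truncated subtraction.\<close>

definition increment ::
  "(real \<Rightarrow> 'a \<Rightarrow> nat) \<Rightarrow> (nat \<Rightarrow> real) \<Rightarrow> real \<Rightarrow> nat \<Rightarrow> 'a \<Rightarrow> int" where
  "increment N \<tau> h j \<omega> = int (N (\<tau> j + h) \<omega>) - int (N (\<tau> (j - 1) + h) \<omega>)"

definition cond_indep_increments ::
  "'a measure \<Rightarrow> (real \<Rightarrow> 'a \<Rightarrow> nat) \<Rightarrow> ('a \<Rightarrow> real) \<Rightarrow> bool" where
  "cond_indep_increments M N \<Theta> \<longleftrightarrow>
     (\<forall>m \<tau>. time_grid m \<tau> \<longrightarrow>
        cond_indep_vars M (sigma_rv M \<Theta>) (count_space UNIV) (increment N \<tau> 0) {1..m})"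

definition cond_stationary_increments ::
  "'a measure \<Rightarrow> (real \<Rightarrow> 'a \<Rightarrow> nat) \<Rightarrow> ('a \<Rightarrow> real) \<Rightarrow> bool" where
  "cond_stationary_increments M N \<Theta> \<longleftrightarrow>
     (\<forall>m \<tau> h. time_grid m \<tau> \<longrightarrow> 0 \<le> h \<longrightarrow>
        (\<forall>B\<in>sets (\<Pi>\<^sub>M j\<in>{1..m}. count_space UNIV).
           AE \<omega> in M.
             cprob M (sigma_rv M \<Theta>)
               {\<omega>\<in>space M. (\<lambda>j\<in>{1..m}. increment N \<tau> h j \<omega>) \<in> B} \<omega> =
             cprob M (sigma_rv M \<Theta>)
               {\<omega>\<in>space M. (\<lambda>j\<in>{1..m}. increment N \<tau> 0 j \<omega>) \<in> B} \<omega>))"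

text \<open>\<^const>\<open>poisson_pmf\<close> is only meaningful for positive rates. This suffices, as
  \<open>\<Theta>\<close> is positive almost surely wherever the following definition is used.\<close>

definition mixed_poisson ::
  "'a measure \<Rightarrow> (real \<Rightarrow> 'a \<Rightarrow> nat) \<Rightarrow> ('a \<Rightarrow> real) \<Rightarrow> bool" where
  "mixed_poisson M N \<Theta> \<longleftrightarrow>
     counting_process M N \<and>
     cond_indep_increments M N \<Theta> \<and>
     cond_stationary_increments M N \<Theta> \<and>
     (\<forall>t>0. \<forall>B. AE \<omega> in M.
        cprob M (sigma_rv M \<Theta>) {\<omega>\<in>space M. N t \<omega> \<in> B} \<omega> =
        measure_pmf.prob (poisson_pmf (t * \<Theta> \<omega>)) B)"

text \<open>The predicate refers to the process \<open>S\<close> together with the pair \<open>(N, X)\<close> inducing it;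
  \<open>Q\<close> is the law of the sizes.\<close>

definition compound_mixed_poisson ::
  "'a measure \<Rightarrow> (real \<Rightarrow> 'a \<Rightarrow> nat) \<Rightarrow> (nat \<Rightarrow> 'a \<Rightarrow> real) \<Rightarrow> (real \<Rightarrow> 'a \<Rightarrow> real) \<Rightarrow>
     ('a \<Rightarrow> real) \<Rightarrow> real measure \<Rightarrow> bool" where
  "compound_mixed_poisson M N X S \<Theta> Q \<longleftrightarrow>
     risk_process M N X \<and>
     (\<forall>t\<ge>0. \<forall>\<omega>\<in>space M. S t \<omega> = aggregate N X t \<omega>) \<and>
     mixed_poisson M N \<Theta> \<and>
     distr M borel (X 1) = Q"


subsection \<open>Regular conditional probabilities\<close>

text \<open>Only the values \<open>R \<theta>\<close> for \<open>\<theta> > 0\<close> matter.\<close>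

definition regular_cond_prob :: "'a measure \<Rightarrow> ('a \<Rightarrow> real) \<Rightarrow> (real \<Rightarrow> 'a measure) \<Rightarrow> bool" where
  "regular_cond_prob M \<Theta> R \<longleftrightarrow>
     (\<forall>\<theta>>0. prob_space (R \<theta>) \<and> space (R \<theta>) = space M \<and> sets (R \<theta>) = sets M) \<and>
     (\<forall>D\<in>sets M.
        (\<lambda>\<theta>. measure (R \<theta>) D) \<in> borel_measurable (restrict_space borel {0<..}) \<and>
        (LINT \<theta>:{0<..}|distr M borel \<Theta>. measure (R \<theta>) D) = measure M D)"

definition consistent_with :: "'a measure \<Rightarrow> ('a \<Rightarrow> real) \<Rightarrow> (real \<Rightarrow> 'a measure) \<Rightarrow> bool" where
  "consistent_with M \<Theta> R \<longleftrightarrow>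
     (\<forall>B\<in>sets borel. B \<subseteq> {0<..} \<longrightarrow>
        (AE \<theta> in distr M borel \<Theta>. \<theta> \<in> B \<longrightarrow> measure (R \<theta>) (\<Theta> -` B \<inter> space M) = 1))"


subsection \<open>Filtration and martingales\<close>

definition natural_filtration ::
  "'a measure \<Rightarrow> (real \<Rightarrow> 'a \<Rightarrow> real) \<Rightarrow> real \<Rightarrow> 'a measure" where
  "natural_filtration M S t = sigma_process (space M) {0..t} S borel"

definition enlarged_filtration ::
  "'a measure \<Rightarrow> (real \<Rightarrow> 'a \<Rightarrow> real) \<Rightarrow> ('a \<Rightarrow> real) \<Rightarrow> real \<Rightarrow> 'a measure" where
  "enlarged_filtration M S \<Theta> t =
     sigma (space M) (sets (natural_filtration M S t) \<union> sets (sigma_rv M \<Theta>))"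

definition enlarged_filtration_inf ::
  "'a measure \<Rightarrow> (real \<Rightarrow> 'a \<Rightarrow> real) \<Rightarrow> ('a \<Rightarrow> real) \<Rightarrow> 'a measure" where
  "enlarged_filtration_inf M S \<Theta> =
     sigma (space M) ((\<Union>t\<in>{0..}. sets (natural_filtration M S t)) \<union> sets (sigma_rv M \<Theta>))"

definition martingale ::
  "'a measure \<Rightarrow> (real \<Rightarrow> 'a measure) \<Rightarrow> (real \<Rightarrow> 'a \<Rightarrow> real) \<Rightarrow> bool" where
  "martingale M F Z \<longleftrightarrow>
     (\<forall>t\<ge>0. Z t \<in> borel_measurable (F t) \<and> integrable M (Z t)) \<and>
     (\<forall>s\<ge>0. \<forall>t\<ge>s. \<forall>E\<in>sets (F s). (LINT \<omega>:E|M. Z s \<omega>) = (LINT \<omega>:E|M. Z t \<omega>))"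

end

theory Submission
  imports Defs
begin

text \<open>
  Conditional independence of \<open>W\<close> and \<open>X\<close> given \<open>\<Theta>\<close>, together with independence of \<open>\<Theta>\<close> and
  \<open>X\<close>, makes \<open>X\<close> independent of the pair \<open>(N, \<Theta>)\<close>. A Wald identity on events of the filtration,
  \<open>E[(S\<^sub>t - S\<^sub>s) 1\<^sub>E] = E[X\<^sub>1] E[(N\<^sub>t - N\<^sub>s) 1\<^sub>E]\<close>, then reduces the martingale property of
  \<open>S\<^sub>t - t \<Theta> E[X\<^sub>1]\<close> to that of \<open>N\<^sub>t - t \<Theta>\<close>. From the latter the conditional Poisson law follows
  as in Watanabe's theorem, without stochastic integrals: \<open>z\<close> raised to the increment of \<open>N\<close> is
  telescoped along finer and finer partitions, which yields its conditional generating function, and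
  a power series determines its coefficients. The conditioning on \<open>\<Theta>\<close> is carried along by
  integrating over events of the filtration, which contains \<open>\<sigma>(\<Theta>)\<close> from time \<open>0\<close> on.
\<close>

subsection \<open>Paths of counting processes\<close>

text \<open>Two obstacles shape the argument. Only first moments are available: \<open>N t\<close>
  is merely integrable, and even this must be extracted from the martingale. A second-order Taylor
  estimate of the generating function would call for second moments of the increments, so the
  remainders are bounded linearly instead: they are dominated by \<open>N t\<close> plus a multiple
  of \<Theta>, and they vanish pathwise because the jumps before a given time are finitely many and
  separated. Also, the filtration is generated by \<open>S\<close>. Strict positivity of the sizes
  makes \<open>N\<close> adapted to it and makes \<open>E[X 1]\<close> positive, hence cancellable.
  In the converse direction the Poisson property concerns \<open>N\<close> given \<Theta>, whereas
  events of the filtration involve sizes as well; they are generated by products of an event of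
  \<open>N\<close> up to time \<open>s\<close>, an event of \<Theta> and an event of the whole
  sequence \<open>X\<close>, whose last factor splits off by independence. Increments of
  \<open>N\<close> and \<open>S\<close> are nonnegative, so most identities are proved for extended
  nonnegative integrals, where integrability may come out as a result.\<close>

lemma counting_process_mono:
  assumes "counting_process M N" "\<omega> \<in> space M" "0 \<le> s" "s \<le> t"
  shows "N s \<omega> \<le> N t \<omega>"
proof (cases "s = t")
  case False
  \<comment> \<open>Monotonicity is contained in the right-continuity clause: \<open>N s\<close> is
    an infimum over all later times.\<close>
  have "enat (N s \<omega>) = (INF s\<in>{s<..}. enat (N s \<omega>))"
    using assms unfolding counting_process_def by auto
  also have "\<dots> \<le> enat (N t \<omega>)"
    using assms False by (intro INF_lower) auto
  finally show ?thesis by simp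
qed simp

text \<open>The infimum \<open>T\<close> of the times with \<open>n \<le> N t\<close> is attained by
  right continuity, and jumps of height at most one prevent \<open>N\<close> from skipping
  \<open>n\<close> there. Hence no level set is empty.\<close>

lemma counting_process_first_passage:
  assumes N: "counting_process M N" and \<omega>: "\<omega> \<in> space M"
  obtains T where "0 \<le> T" "N T \<omega> = n" "\<And>t. 0 \<le> t \<Longrightarrow> n \<le> N t \<omega> \<longleftrightarrow> T \<le> t"
proof -
  note mono = counting_process_mono[OF N \<omega>]
  have N0: "N 0 \<omega> = 0"
    and rc: "\<And>t. 0 \<le> t \<Longrightarrow> enat (N t \<omega>) = (INF s\<in>{t<..}. enat (N s \<omega>))"
    and jump: "\<And>t. 0 < t \<Longrightarrow> enat (N t \<omega>) \<le> (SUP s\<in>{0..<t}. enat (N s \<omega>)) + 1"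
    and sup: "(SUP t\<in>{0..}. enat (N t \<omega>)) = \<infinity>"
    using N \<omega> unfolding counting_process_def by auto
  define A where "A = {t. 0 \<le> t \<and> n \<le> N t \<omega>}"
  have "enat n < (SUP t\<in>{0..}. enat (N t \<omega>))"
    unfolding sup by simp
  then obtain a where "a \<in> A"
    by (auto simp: less_SUP_iff A_def intro: less_imp_le)
  define T where "T = Inf A"
  have bdd: "bdd_below A"
    unfolding A_def by (rule bdd_belowI[of _ 0]) auto
  have T0: "0 \<le> T"
    unfolding T_def using \<open>a \<in> A\<close> by (intro cInf_greatest) (auto simp: A_def)
  have "enat n \<le> enat (N T \<omega>)"
    unfolding rc[OF T0]
  proof (intro INF_greatest)
    fix s assume "s \<in> {T<..}"
    then obtain b where "b \<in> A" "b < s"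
      using \<open>a \<in> A\<close> bdd cInf_less_iff[of A s] by (auto simp: T_def)
    then show "enat n \<le> enat (N s \<omega>)"
      using mono[of b s] by (auto simp: A_def)
  qed
  then have ge: "n \<le> N T \<omega>" by simp
  have le: "N T \<omega> \<le> n"
  proof (cases "T = 0")
    case False
    then have "0 < T" using T0 by simp
    have lt: "N s \<omega> < n" if "s \<in> {0..<T}" for s
      using that cInf_lower[OF _ bdd, of s] by (force simp: A_def T_def)
    \<comment> \<open>Makes \<open>n - 1 + 1\<close> equal to \<open>n\<close> despite truncated
      subtraction.\<close>
    then have "0 < n" using \<open>0 < T\<close> by force
    have "(SUP s\<in>{0..<T}. enat (N s \<omega>)) \<le> enat (n - 1)"
      using lt by (intro SUP_least) fastforce
    then have "(SUP s\<in>{0..<T}. enat (N s \<omega>)) + 1 \<le> enat (n - 1) + 1"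
      by (rule add_right_mono)
    with jump[OF \<open>0 < T\<close>] have "enat (N T \<omega>) \<le> enat (n - 1) + 1"
      by (rule order_trans)
    then show ?thesis
      using \<open>0 < n\<close> by (simp add: one_enat_def)
  qed (simp add: N0)
  show thesis
  proof
    show "0 \<le> T" "N T \<omega> = n" using T0 ge le by auto
    fix t :: real assume "0 \<le> t"
    show "n \<le> N t \<omega> \<longleftrightarrow> T \<le> t"
    proof
      assume "n \<le> N t \<omega>"
      then show "T \<le> t"
        unfolding T_def using \<open>0 \<le> t\<close> by (intro cInf_lower bdd) (auto simp: A_def)
    next
      assume "T \<le> t"
      then show "n \<le> N t \<omega>" using ge mono[OF T0] order_trans by blast
    qed
  qed
qed

text \<open>\<open>arrival\<close> is an infimum over the level set \<open>N t = n\<close>, and the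
  first passage time is its minimum. The last equivalence inverts \<open>N\<close> and carries all
  later arguments on paths.\<close>

lemma
  assumes N: "counting_process M N" and \<omega>: "\<omega> \<in> space M"
  shows arrival_nonneg: "0 \<le> arrival N n \<omega>"
    and counting_process_arrival: "N (arrival N n \<omega>) \<omega> = n"
    and arrival_le_iff: "0 \<le> t \<Longrightarrow> arrival N n \<omega> \<le> t \<longleftrightarrow> n \<le> N t \<omega>"
proof -
  obtain T where T: "0 \<le> T" "N T \<omega> = n" "\<And>t. 0 \<le> t \<Longrightarrow> n \<le> N t \<omega> \<longleftrightarrow> T \<le> t"
    using counting_process_first_passage[OF N \<omega>] by blast
  have "arrival N n \<omega> = T"
    unfolding arrival_def by (rule cInf_eq_minimum) (use T in force)+
  with T show "0 \<le> arrival N n \<omega>" "N (arrival N n \<omega>) \<omega> = n"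
    "0 \<le> t \<Longrightarrow> arrival N n \<omega> \<le> t \<longleftrightarrow> n \<le> N t \<omega>" by auto
qed

lemma arrival_0:
  assumes "counting_process M N" "\<omega> \<in> space M"
  shows "arrival N 0 \<omega> = 0"
  using arrival_nonneg[OF assms, of 0] arrival_le_iff[OF assms, of 0 0] by simp

lemma arrival_less_Suc:
  assumes "counting_process M N" "\<omega> \<in> space M"
  shows "arrival N n \<omega> < arrival N (Suc n) \<omega>"
  using arrival_le_iff[OF assms arrival_nonneg[OF assms, of n], of "Suc n"]
    counting_process_arrival[OF assms, of n] by simp

text \<open>The sum telescopes from \<open>arrival N 0 = 0\<close>; this turns events of
  \<open>N\<close> into events of the interarrival times.\<close>

lemma arrival_eq_sum_interarrival:
  assumes "counting_process M N" "\<omega> \<in> space M"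
  shows "arrival N n \<omega> = (\<Sum>k=1..n. interarrival N k \<omega>)"
  by (induction n) (simp_all add: arrival_0[OF assms] interarrival_def)

text \<open>On a fixed path two consecutive jumps are a positive distance apart, so a fine enough
  partition separates all jumps.\<close>

lemma eventually_increments_le_1:
  assumes N: "counting_process M N" and \<omega>: "\<omega> \<in> space M" and s: "0 \<le> s" "s \<le> t"
  shows "\<forall>\<^sub>F n in sequentially. \<forall>i<n.
    N (s + real (Suc i) * ((t - s) / real n)) \<omega> - N (s + real i * ((t - s) / real n)) \<omega> \<le> 1"
proof -
  define gap where "gap k = arrival N (Suc k) \<omega> - arrival N k \<omega>" for k
  define e where "e = Min (gap ` {..N t \<omega>})"
  have e: "0 < e" "\<And>k. k \<le> N t \<omega> \<Longrightarrow> e \<le> gap k"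
    using arrival_less_Suc[OF N \<omega>] by (auto simp: e_def gap_def)
  have "(\<lambda>n. (t - s) / real n) \<longlonglongrightarrow> 0"
    by (rule lim_const_over_n)
  then have "\<forall>\<^sub>F n in sequentially. (t - s) / real n < e"
    using e(1) by (rule order_tendstoD)
  then show ?thesis
  proof eventually_elim
    case (elim n)
    show ?case
    proof (intro allI impI, rule ccontr)
      fix i assume i: "i < n"
      define u where "u = s + real i * ((t - s) / real n)"
      define v where "v = s + real (Suc i) * ((t - s) / real n)"
      assume "\<not> N (s + real (Suc i) * ((t - s) / real n)) \<omega> - N (s + real i * ((t - s) / real n)) \<omega> \<le> 1"
      then have ge: "N u \<omega> + 2 \<le> N v \<omega>" by (simp add: u_def v_def)
      have u0: "0 \<le> u" using s by (simp add: u_def)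
      have vu: "v - u = (t - s) / real n" by (simp add: u_def v_def distrib_right add_divide_distrib)
      have v0: "u \<le> v" using vu s by (metis diff_ge_0_iff_ge divide_nonneg_nonneg of_nat_0_le_iff)
      have "real (Suc i) * ((t - s) / real n) \<le> real n * ((t - s) / real n)"
        using i s by (intro mult_right_mono) auto
      then have "v \<le> t" using i by (simp add: v_def)
      then have "N v \<omega> \<le> N t \<omega>"
        using counting_process_mono[OF N \<omega>] u0 v0 by auto
      \<comment> \<open>Two jumps in the cell are the arrivals with indices \<open>N u + 1\<close>
        and \<open>N u + 2\<close>, so gap number \<open>N u + 1\<close> is shorter than the mesh;
        its index is at most \<open>N t\<close> and thus counted in \<open>e\<close>.\<close>
      then have "e \<le> gap (Suc (N u \<omega>))" using ge by (intro e) auto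
      moreover have "arrival N (Suc (Suc (N u \<omega>))) \<omega> \<le> v" "\<not> arrival N (Suc (N u \<omega>)) \<omega> \<le> u"
        using ge u0 v0 by (auto simp: arrival_le_iff[OF N \<omega>])
      ultimately show False using vu elim by (simp add: gap_def)
    qed
  qed
qed

subsection \<open>The generating function of the increments\<close>

text \<open>The bound \<open>k - 1\<close> is zero for \<open>k \<le> 1\<close>, so cells with at
  most one jump contribute no error, and it is linear in \<open>k\<close>, so integrability of
  \<open>N\<close> suffices for domination.\<close>

lemma power_remainder_bounds:
  fixes z :: real
  assumes "0 \<le> z" "z \<le> 1"
  shows "0 \<le> z ^ k - 1 + (1 - z) * real k" and "z ^ k - 1 + (1 - z) * real k \<le> real (k - 1)"
proof -
  have "1 + real k * (z - 1) \<le> (1 + (z - 1)) ^ k"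
    using assms by (intro Bernoulli_inequality) auto
  then show "0 \<le> z ^ k - 1 + (1 - z) * real k" by (simp add: algebra_simps)
  show "z ^ k - 1 + (1 - z) * real k \<le> real (k - 1)"
  proof (cases k)
    case (Suc j)
    have "z * z ^ j \<le> z * 1" using assms by (intro mult_left_mono power_le_one) auto
    moreover have "(1 - z) * real j \<le> 1 * real j" using assms by (intro mult_right_mono) auto
    ultimately show ?thesis using Suc by (simp add: algebra_simps)
  qed simp
qed

lemma exp_minus_remainder_bounds:
  fixes x :: real
  assumes "0 \<le> x"
  shows "0 \<le> exp (- x) - 1 + x" and "exp (- x) - 1 + x \<le> x"
  using exp_ge_add_one_self[of "- x"] assms by (auto simp: algebra_simps)

lemma exp_minus_remainder_tendsto:
  "(\<lambda>n. real n * (exp (- (x / real n)) - 1 + x / real n)) \<longlonglongrightarrow> 0"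
  by real_asymp

text \<open>The generating function is known only for \<open>z\<close> in \<open>(0, 1)\<close>, not
  around \<open>0\<close>. Strong induction divides the series by \<open>z ^ k\<close> and reads off
  the leading coefficient as a limit from the right at \<open>0\<close>.\<close>

lemma powser_eq_0_imp_coeff_0:
  fixes d :: "nat \<Rightarrow> real"
  assumes "\<And>z. 0 < z \<Longrightarrow> z < 1 \<Longrightarrow> (\<lambda>k. d k * z ^ k) sums 0"
  shows "d k = 0"
proof (induction k rule: less_induct)
  case (less k)
  define e where "e j = d (j + k)" for j
  have e: "(\<lambda>j. e j * z ^ j) sums 0" if "0 < z" "z < 1" for z
  proof -
    have "(\<lambda>j. d (j + k) * z ^ (j + k)) sums (0 - (\<Sum>i<k. d i * z ^ i))"
      using sums_split_initial_segment[OF assms[OF that], of k] by simp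
    then have "(\<lambda>j. d (j + k) * z ^ (j + k) / z ^ k) sums (0 / z ^ k)"
      using less by (intro sums_divide) simp
    then show ?thesis using that by (simp add: e_def power_add)
  qed
  have "summable (\<lambda>j. e j * (1/2) ^ j)" using e[of "1/2"] by (auto simp: sums_iff)
  then have "(\<lambda>j. e j * z ^ j) sums (\<Sum>j. e j * z ^ j)" if "norm z < 1/2" for z
    using that by (intro summable_sums powser_inside[of e "1/2" z]) auto
  then have "((\<lambda>z. \<Sum>j. e j * z ^ j) \<longlongrightarrow> e 0) (at 0)"
    by (intro powser_limit_0[of "1/2" e]) auto
  then have "((\<lambda>z. \<Sum>j. e j * z ^ j) \<longlongrightarrow> e 0) (at_right 0)"
    by (rule filterlim_mono) (auto intro: at_le)
  moreover have "((\<lambda>z. \<Sum>j. e j * z ^ j) \<longlongrightarrow> 0) (at_right 0)"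
  proof (rule tendsto_eventually)
    have "\<forall>\<^sub>F z in at_right 0. z \<in> {0<..<1::real}"
      by (rule eventually_at_right_real) simp
    then show "\<forall>\<^sub>F z in at_right 0. (\<Sum>j. e j * z ^ j) = 0"
      by eventually_elim (use e in \<open>auto simp: sums_iff\<close>)
  qed
  ultimately have "e 0 = 0" by (rule tendsto_unique[rotated]) simp
  then show ?case by (simp add: e_def)
qed

text \<open>The partial sums of nonnegative terms stay in \<open>[0, B]\<close>, so a constant
  dominates them. This expands an expected generating function into a power series in
  \<open>z\<close>.\<close>

lemma (in finite_measure) sums_integral_bounded:
  fixes f :: "nat \<Rightarrow> 'a \<Rightarrow> real"
  assumes [measurable]: "\<And>k. f k \<in> borel_measurable M" and nonneg: "\<And>k x. x \<in> space M \<Longrightarrow> 0 \<le> f k x"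
    and sums: "\<And>x. x \<in> space M \<Longrightarrow> (\<lambda>k. f k x) sums g x" and bound: "\<And>x. x \<in> space M \<Longrightarrow> g x \<le> B"
  shows "(\<lambda>k. \<integral>x. f k x \<partial>M) sums (\<integral>x. g x \<partial>M)"
proof -
  have part: "(\<Sum>k<n. f k x) \<le> B" if "x \<in> space M" for x n
    using sum_le_suminf[of "\<lambda>k. f k x" "{..<n}"] nonneg[OF that] sums[OF that] bound[OF that]
    by (auto simp: sums_iff)
  have int: "integrable M (f k)" for k
  proof (rule integrable_const_bound[of _ B])
    show "AE x in M. norm (f k x) \<le> B"
    proof (rule AE_I2)
      fix x assume x: "x \<in> space M"
      have "f k x \<le> (\<Sum>i<Suc k. f i x)" using nonneg[OF x] by (simp add: sum_nonneg)
      then show "norm (f k x) \<le> B" using part[OF x, of "Suc k"] nonneg[OF x] by simp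
    qed
  qed simp
  have g[measurable]: "g \<in> borel_measurable M"
  proof -
    have "(\<lambda>x. \<Sum>k. f k x) \<in> borel_measurable M" by simp
    then show ?thesis
      by (rule measurable_cong[THEN iffD1, rotated]) (use sums in \<open>auto simp: sums_iff\<close>)
  qed
  have "(\<lambda>n. \<integral>x. (\<Sum>k<n. f k x) \<partial>M) \<longlonglongrightarrow> (\<integral>x. g x \<partial>M)"
  proof (rule integral_dominated_convergence[where w="\<lambda>_. B"])
    show "AE x in M. (\<lambda>n. \<Sum>k<n. f k x) \<longlonglongrightarrow> g x"
      using sums by (auto simp: sums_def)
    show "AE x in M. norm (\<Sum>k<n. f k x) \<le> B" for n
      using part nonneg by (auto simp: sum_nonneg)
  qed auto
  then show ?thesis using int by (simp add: sums_def)
qed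

lemma integrable_mult_01:
  fixes f g :: "'a \<Rightarrow> real"
  assumes "integrable M f" and [measurable]: "g \<in> borel_measurable M" and "\<And>x. 0 \<le> g x" "\<And>x. g x \<le> 1"
  shows "integrable M (\<lambda>x. g x * f x)"
proof (rule Bochner_Integration.integrable_bound[OF assms(1)])
  show "AE x in M. norm (g x * f x) \<le> norm (f x)"
    using assms(3,4) by (auto simp: abs_mult intro!: mult_left_le_one_le)
qed (use assms(1) in measurable)

text \<open>The part of the setting in which sizes no longer occur. Since the rate \<open>L\<close>
  is measurable at time \<open>0\<close>, it acts like a constant at every later time, and
  \<open>exp (- c * L)\<close> may enter weights from the start.\<close>

locale poisson_martingale = prob_space M for M :: "'a measure" +
  fixes N :: "real \<Rightarrow> 'a \<Rightarrow> nat" and G :: "real \<Rightarrow> 'a measure" and L :: "'a \<Rightarrow> real"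
  assumes counting: "counting_process M N"
    and subalgebra: "0 \<le> t \<Longrightarrow> subalgebra M (G t)"
    and filtration: "0 \<le> s \<Longrightarrow> s \<le> t \<Longrightarrow> sets (G s) \<subseteq> sets (G t)"
    and adapted: "0 \<le> t \<Longrightarrow> N t \<in> measurable (G t) (count_space UNIV)"
    and L_measurable: "L \<in> borel_measurable (G 0)"
    and L_nonneg: "0 \<le> L \<omega>"
    and L_integrable: "integrable M L"
    and N_integrable: "0 \<le> t \<Longrightarrow> integrable M (\<lambda>\<omega>. real (N t \<omega>))"
    and compensated: "0 \<le> s \<Longrightarrow> s \<le> t \<Longrightarrow> A \<in> sets (G s) \<Longrightarrow>
      (\<integral>\<omega>\<in>A. (real (N t \<omega>) - real (N s \<omega>)) \<partial>M) = (\<integral>\<omega>\<in>A. ((t - s) * L \<omega>) \<partial>M)"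
begin

lemma space_G: "0 \<le> t \<Longrightarrow> space (G t) = space M"
  using subalgebra by (simp add: subalgebra_def)

lemma measurable_G_mono:
  assumes "0 \<le> s" "s \<le> t" "f \<in> measurable (G s) K"
  shows "f \<in> measurable (G t) K"
  using assms(3) filtration[OF assms(1,2)] space_G[of s] space_G[of t] assms(1,2)
  by (auto simp: measurable_def)

lemma N_measurable [measurable]: "0 \<le> t \<Longrightarrow> N t \<in> measurable M (count_space UNIV)"
  using counting by (simp add: counting_process_def)

lemma L_measurable_M [measurable]: "L \<in> borel_measurable M"
  using L_integrable by simp

text \<open>The locale assumption on events identifies \<open>(t - s) * L\<close> as the conditional
  expectation of the increment given \<open>G s\<close>; a bounded \<open>G s\<close>-measurable
  weight can then be pulled out.\<close>

lemma integral_compensated: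
  assumes st: "0 \<le> s" "s \<le> t" and Y: "Y \<in> borel_measurable (G s)" and bound: "\<And>\<omega>. \<omega> \<in> space M \<Longrightarrow> \<bar>Y \<omega>\<bar> \<le> B"
  shows "(\<integral>\<omega>. Y \<omega> * (real (N t \<omega>) - real (N s \<omega>)) \<partial>M) = (\<integral>\<omega>. Y \<omega> * ((t - s) * L \<omega>) \<partial>M)"
proof -
  interpret finite_measure_subalgebra M "G s"
    by unfold_locales (rule subalgebra[OF st(1)])
  have [measurable]: "Y \<in> borel_measurable M"
    by (rule measurable_from_subalg[OF subalg Y])
  have [measurable]: "N s \<in> measurable M (count_space UNIV)" "N t \<in> measurable M (count_space UNIV)"
    using st by (auto intro: N_measurable)
  have int: "integrable M (\<lambda>\<omega>. real (N t \<omega>) - real (N s \<omega>))"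
    using st by (intro Bochner_Integration.integrable_diff N_integrable) auto
  have AE: "AE \<omega> in M. real_cond_exp M (G s) (\<lambda>\<omega>. real (N t \<omega>) - real (N s \<omega>)) \<omega> = (t - s) * L \<omega>"
    using measurable_G_mono[OF _ st(1) L_measurable]
    by (intro real_cond_exp_charact compensated st int) (auto intro: L_integrable)
  have "integrable M (\<lambda>\<omega>. Y \<omega> * (real (N t \<omega>) - real (N s \<omega>)))"
  proof (rule Bochner_Integration.integrable_bound)
    show "integrable M (\<lambda>\<omega>. B * (real (N t \<omega>) - real (N s \<omega>)))"
      using int by simp
    show "AE \<omega> in M. norm (Y \<omega> * (real (N t \<omega>) - real (N s \<omega>))) \<le> norm (B * (real (N t \<omega>) - real (N s \<omega>)))"
    proof (rule AE_I2)
      fix \<omega> assume "\<omega> \<in> space M"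
      then have "\<bar>Y \<omega>\<bar> \<le> \<bar>B\<bar>" using bound by force
      then show "norm (Y \<omega> * (real (N t \<omega>) - real (N s \<omega>))) \<le> norm (B * (real (N t \<omega>) - real (N s \<omega>)))"
        by (simp add: abs_mult mult_right_mono)
    qed
  qed simp
  from real_cond_exp_intg(2)[OF this Y]
  have "(\<integral>\<omega>. Y \<omega> * (real (N t \<omega>) - real (N s \<omega>)) \<partial>M) =
    (\<integral>\<omega>. Y \<omega> * real_cond_exp M (G s) (\<lambda>\<omega>. real (N t \<omega>) - real (N s \<omega>)) \<omega> \<partial>M)" by simp
  also have "\<dots> = (\<integral>\<omega>. Y \<omega> * ((t - s) * L \<omega>) \<partial>M)"
    using AE by (intro integral_cong_AE) auto
  finally show ?thesis .
qed

text \<open>The difference \<open>z^(N t - N s) - exp (- (1 - z) (t - s) L)\<close> telescopes along a partition of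
  \<open>[s, t]\<close> into \<open>n\<close> pieces. In each summand the martingale property removes the part that is
  linear in the increment, and the remainders vanish in the limit by dominated convergence.\<close>

lemma generating_function_increment:
  assumes st: "0 \<le> s" "s \<le> t" and A: "A \<in> sets (G s)" and z: "0 \<le> z" "z \<le> 1"
  shows "(\<integral>\<omega>. indicator A \<omega> * z ^ (N t \<omega> - N s \<omega>) \<partial>M) =
    (\<integral>\<omega>. indicator A \<omega> * exp (- ((1 - z) * (t - s) * L \<omega>)) \<partial>M)"
proof -
  define x where "x \<omega> = (1 - z) * (t - s) * L \<omega>" for \<omega>
  have x0: "0 \<le> x \<omega>" for \<omega> using z st L_nonneg by (simp add: x_def)
  have [measurable]: "x \<in> borel_measurable M" "A \<in> sets M"
    using A subalgebra[OF st(1)] by (auto simp: x_def[abs_def] subalgebra_def)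
  have [measurable]: "N s \<in> measurable M (count_space UNIV)" "N t \<in> measurable M (count_space UNIV)"
    using st by (auto intro: N_measurable)
  have x_int: "integrable M x" unfolding x_def[abs_def] using L_integrable by simp
  define u where "u n i = s + real i * ((t - s) / real n)" for n i :: nat
  have u0: "0 \<le> u n i" "s \<le> u n i" for n i using st by (auto simp: u_def)
  have u_mono: "u n i \<le> u n j" if "i \<le> j" for n i j
    using st that by (auto simp: u_def intro!: mult_right_mono divide_right_mono)
  have u_step: "u n (Suc i) - u n i = (t - s) / real n" for n i by (simp add: u_def distrib_right add_divide_distrib)
  define \<Delta> where "\<Delta> n i \<omega> = N (u n (Suc i)) \<omega> - N (u n i) \<omega>" for n i \<omega>
  have [measurable]: "N (u n i) \<in> measurable M (count_space UNIV)" for n i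
    using u0 by (auto intro: N_measurable)
  have [measurable]: "\<Delta> n i \<in> measurable M (count_space UNIV)" for n i
    unfolding \<Delta>_def[abs_def] by measurable
  define \<phi> where "\<phi> y = exp (- y) - 1 + y" for y :: real
  \<comment> \<open>The sum is zero once no cell contains two jumps; the other term is
    \<open>n\<close> times a quantity of order \<open>(x / n)^2\<close>.\<close>
  define err where "err n \<omega> = (\<Sum>i<n. real (\<Delta> n i \<omega> - 1)) + real n * \<phi> (x \<omega> / real n)" for n \<omega>
  have mono: "N a \<omega> \<le> N b \<omega>" if "\<omega> \<in> space M" "0 \<le> a" "a \<le> b" for a b \<omega>
    using counting_process_mono[OF counting] that by auto
  have sum_\<Delta>: "(\<Sum>i<n. real (\<Delta> n i \<omega>)) = real (N t \<omega>) - real (N s \<omega>)" if "0 < n" "\<omega> \<in> space M" for n \<omega>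
  proof -
    have "(\<Sum>i<n. real (\<Delta> n i \<omega>)) = (\<Sum>i<n. real (N (u n (Suc i)) \<omega>) - real (N (u n i) \<omega>))"
      using mono[OF that(2) u0(1) u_mono] by (intro sum.cong) (auto simp: \<Delta>_def of_nat_diff)
    also have "\<dots> = real (N (u n n) \<omega>) - real (N (u n 0) \<omega>)" by (rule sum_lessThan_telescope)
    finally show ?thesis using that(1) by (simp add: u_def)
  qed
  have err_nonneg: "0 \<le> err n \<omega>" for n \<omega>
    using exp_minus_remainder_bounds(1)[of "x \<omega> / real n"] x0
    by (auto simp: err_def \<phi>_def intro!: add_nonneg_nonneg sum_nonneg)
  have err_le: "err n \<omega> \<le> real (N t \<omega>) + x \<omega>" if "\<omega> \<in> space M" for n \<omega>
  proof (cases "n = 0")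
    case False
    have "(\<Sum>i<n. real (\<Delta> n i \<omega> - 1)) \<le> (\<Sum>i<n. real (\<Delta> n i \<omega>))" by (intro sum_mono) simp
    also have "\<dots> \<le> real (N t \<omega>)" using sum_\<Delta> False that by simp
    moreover have "real n * \<phi> (x \<omega> / real n) \<le> real n * (x \<omega> / real n)"
      unfolding \<phi>_def using x0 by (intro mult_left_mono exp_minus_remainder_bounds(2)) auto
    ultimately show ?thesis using False by (simp add: err_def)
  qed (use x0 in \<open>simp add: err_def\<close>)
  have [measurable]: "err n \<in> borel_measurable M" for n
    unfolding err_def[abs_def] \<phi>_def by measurable
  have dom: "integrable M (\<lambda>\<omega>. real (N t \<omega>) + x \<omega>)"
    using N_integrable[of t] st x_int by simp
  have err_int: "integrable M (err n)" for n
    by (rule Bochner_Integration.integrable_bound[OF dom]) (use err_nonneg err_le in \<open>auto simp: abs_of_nonneg intro!: order_trans[OF err_le]\<close>)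
  have "(\<lambda>n. \<integral>\<omega>. err n \<omega> \<partial>M) \<longlonglongrightarrow> (\<integral>\<omega>. 0 \<partial>M)"
  proof (rule integral_dominated_convergence[OF _ _ dom])
    show "AE \<omega> in M. (\<lambda>n. err n \<omega>) \<longlonglongrightarrow> 0"
    proof (rule AE_I2)
      fix \<omega> assume \<omega>: "\<omega> \<in> space M"
      have "(\<lambda>n. \<Sum>i<n. real (\<Delta> n i \<omega> - 1)) \<longlonglongrightarrow> 0"
      proof (rule tendsto_eventually, rule eventually_mono[OF eventually_increments_le_1[OF counting \<omega> st]])
        fix n
        assume "\<forall>i<n. N (s + real (Suc i) * ((t - s) / real n)) \<omega> - N (s + real i * ((t - s) / real n)) \<omega> \<le> 1"
        then have "\<forall>i<n. \<Delta> n i \<omega> \<le> 1" unfolding \<Delta>_def u_def .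
        then show "(\<Sum>i<n. real (\<Delta> n i \<omega> - 1)) = 0" by simp
      qed
      from tendsto_add[OF this exp_minus_remainder_tendsto[of "x \<omega>"]]
      show "(\<lambda>n. err n \<omega>) \<longlonglongrightarrow> 0" by (simp add: err_def \<phi>_def)
    qed
    show "AE \<omega> in M. norm (err n \<omega>) \<le> real (N t \<omega>) + x \<omega>" for n
      using err_nonneg err_le by (auto simp: abs_of_nonneg)
  qed auto
  then have err_lim: "(\<lambda>n. \<integral>\<omega>. err n \<omega> \<partial>M) \<longlonglongrightarrow> 0" by simp
  define d where "d \<omega> = indicator A \<omega> * z ^ (N t \<omega> - N s \<omega>) - indicator A \<omega> * exp (- x \<omega>)" for \<omega>
  have d_int: "integrable M (\<lambda>\<omega>. indicator A \<omega> * z ^ (N t \<omega> - N s \<omega>))"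
      "integrable M (\<lambda>\<omega>. indicator A \<omega> * exp (- x \<omega>))"
    using z x0 by (auto intro!: integrable_const_bound[of _ 1] power_le_one split: split_indicator)
  have bound: "\<bar>\<integral>\<omega>. d \<omega> \<partial>M\<bar> \<le> (\<integral>\<omega>. err n \<omega> \<partial>M)" if n: "0 < n" for n
  proof -
    \<comment> \<open>The factor common to two consecutive terms of the telescope: powers of
      \<open>z\<close> for the cells before cell \<open>i\<close>, exponentials for those after it.
      Cell \<open>i\<close> itself is left out, hence \<open>n - Suc i\<close>. The exponentials of
      later cells are already known at time \<open>u n i\<close>, because \<open>L\<close>
      is.\<close>
    define Y where "Y i \<omega> = indicator A \<omega> * z ^ (N (u n i) \<omega> - N s \<omega>) * exp (- (x \<omega> / real n * real (n - Suc i)))" for i \<omega>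
    have Y01: "0 \<le> Y i \<omega>" "Y i \<omega> \<le> 1" for i \<omega>
      using z x0 by (auto simp: Y_def intro!: mult_le_one power_le_one split: split_indicator)
    have Y_G: "Y i \<in> borel_measurable (G (u n i))" for i
    proof -
      have [measurable]: "N (u n i) \<in> measurable (G (u n i)) (count_space UNIV)"
          "N s \<in> measurable (G (u n i)) (count_space UNIV)" "L \<in> borel_measurable (G (u n i))"
          "A \<in> sets (G (u n i))"
        using adapted u0 st A filtration[of s "u n i"] measurable_G_mono[OF _ _ adapted[OF st(1)]]
          measurable_G_mono[OF _ _ L_measurable] by auto
      show ?thesis unfolding Y_def x_def by measurable
    qed
    then have [measurable]: "Y i \<in> borel_measurable M" for i
      using measurable_from_subalg[OF subalgebra] u0 by blast
    \<comment> \<open>Has mean zero, so any multiple may be added to \<open>d\<close>; the factor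
      \<open>1 - z\<close> cancels the linear terms of the power and of the exponential.\<close>
    define mid where "mid i \<omega> = Y i \<omega> * (real (N (u n (Suc i)) \<omega>) - real (N (u n i) \<omega>)) - Y i \<omega> * ((u n (Suc i) - u n i) * L \<omega>)" for i \<omega>
    have mid1: "integrable M (\<lambda>\<omega>. Y i \<omega> * (real (N (u n (Suc i)) \<omega>) - real (N (u n i) \<omega>)))" for i
      by (intro integrable_mult_01 Bochner_Integration.integrable_diff N_integrable u0) (simp_all add: Y01)
    have mid2: "integrable M (\<lambda>\<omega>. Y i \<omega> * ((u n (Suc i) - u n i) * L \<omega>))" for i
      by (intro integrable_mult_01 integrable_mult_right L_integrable) (simp_all add: Y01)
    have mid_int: "integrable M (mid i)" for i
      unfolding mid_def using mid1 mid2 by (rule Bochner_Integration.integrable_diff)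
    have mid_0: "(\<integral>\<omega>. mid i \<omega> \<partial>M) = 0" for i
    proof -
      have "(\<integral>\<omega>. Y i \<omega> * (real (N (u n (Suc i)) \<omega>) - real (N (u n i) \<omega>)) \<partial>M) =
          (\<integral>\<omega>. Y i \<omega> * ((u n (Suc i) - u n i) * L \<omega>) \<partial>M)"
        using Y01 by (intro integral_compensated[where B=1] u0 u_mono Y_G) auto
      then show ?thesis unfolding mid_def by (simp add: Bochner_Integration.integral_diff[OF mid1 mid2])
    qed
    have pointwise: "\<bar>d \<omega> + (1 - z) * (\<Sum>i<n. mid i \<omega>)\<bar> \<le> err n \<omega>" if \<omega>: "\<omega> \<in> space M" for \<omega>
    proof -
      \<comment> \<open>Interpolates between the two terms of \<open>d\<close>: \<open>a n\<close>
        is the power of \<open>z\<close>, and \<open>a 0\<close> is the exponential.\<close>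
      define a where "a i = indicator A \<omega> * z ^ (N (u n i) \<omega> - N s \<omega>) * exp (- (x \<omega> / real n * real (n - i)))" for i
      have "d \<omega> = a n - a 0"
        using n by (simp add: d_def a_def u_def)
      also have "\<dots> = (\<Sum>i<n. a (Suc i) - a i)" by (rule sum_lessThan_telescope[symmetric])
      also have "\<dots> = (\<Sum>i<n. Y i \<omega> * (z ^ \<Delta> n i \<omega> - exp (- (x \<omega> / real n))))"
      proof (rule sum.cong)
        fix i assume "i \<in> {..<n}"
        then have i: "real (n - i) = real (n - Suc i) + 1" by auto
        have "N (u n (Suc i)) \<omega> - N s \<omega> = (N (u n i) \<omega> - N s \<omega>) + \<Delta> n i \<omega>"
          using mono[OF \<omega> st(1) u0(2)[of n i]] mono[OF \<omega> u0(1) u_mono[of i "Suc i" n]]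
          by (simp add: \<Delta>_def)
        then show "a (Suc i) - a i = Y i \<omega> * (z ^ \<Delta> n i \<omega> - exp (- (x \<omega> / real n)))"
          unfolding a_def Y_def i
          by (simp add: power_add right_diff_distrib distrib_left exp_add[symmetric] algebra_simps)
      qed simp
      also have "\<dots> + (1 - z) * (\<Sum>i<n. mid i \<omega>) =
        (\<Sum>i<n. Y i \<omega> * ((z ^ \<Delta> n i \<omega> - 1 + (1 - z) * real (\<Delta> n i \<omega>)) - \<phi> (x \<omega> / real n)))"
      proof -
        have "mid i \<omega> * (1 - z) = Y i \<omega> * ((1 - z) * real (\<Delta> n i \<omega>) - x \<omega> / real n)" for i
          using mono[OF \<omega> u0(1) u_mono[of i "Suc i" n]]
          unfolding mid_def u_step by (simp add: \<Delta>_def x_def of_nat_diff algebra_simps)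
        then show ?thesis
          unfolding \<phi>_def by (simp add: sum_distrib_left sum.distrib[symmetric] mult.commute[of "1 - z"])
            (intro sum.cong, auto simp: algebra_simps)
      qed
      also have "\<bar>\<dots>\<bar> \<le> (\<Sum>i<n. real (\<Delta> n i \<omega> - 1) + \<phi> (x \<omega> / real n))"
      proof (rule order_trans[OF sum_abs sum_mono])
        fix i
        have "\<bar>(z ^ \<Delta> n i \<omega> - 1 + (1 - z) * real (\<Delta> n i \<omega>)) - \<phi> (x \<omega> / real n)\<bar> \<le> real (\<Delta> n i \<omega> - 1) + \<phi> (x \<omega> / real n)"
          using power_remainder_bounds[OF z, of "\<Delta> n i \<omega>"] exp_minus_remainder_bounds(1)[of "x \<omega> / real n"] x0[of \<omega>]
          by (auto simp: \<phi>_def)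
        moreover have "\<bar>Y i \<omega> * c\<bar> \<le> \<bar>c\<bar>" for c
          using Y01 by (auto simp: abs_mult intro!: mult_left_le_one_le)
        ultimately show "\<bar>Y i \<omega> * ((z ^ \<Delta> n i \<omega> - 1 + (1 - z) * real (\<Delta> n i \<omega>)) - \<phi> (x \<omega> / real n))\<bar>
            \<le> real (\<Delta> n i \<omega> - 1) + \<phi> (x \<omega> / real n)"
          by (rule order_trans[rotated])
      qed
      also have "\<dots> = err n \<omega>" by (simp add: err_def sum.distrib)
      finally show ?thesis .
    qed
    have "integrable M d"
      unfolding d_def[abs_def] using d_int by (rule Bochner_Integration.integrable_diff)
    then have "(\<integral>\<omega>. d \<omega> \<partial>M) = (\<integral>\<omega>. d \<omega> + (1 - z) * (\<Sum>i<n. mid i \<omega>) \<partial>M)"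
      using mid_int mid_0 by simp
    also have "\<bar>\<dots>\<bar> \<le> (\<integral>\<omega>. err n \<omega> \<partial>M)"
      using pointwise err_nonneg by (intro order_trans[OF integral_abs_bound] integral_mono' err_int) auto
    finally show ?thesis .
  qed
  \<comment> \<open>The left side of \<open>bound\<close> does not depend on the partition.\<close>
  have "\<bar>\<integral>\<omega>. d \<omega> \<partial>M\<bar> \<le> 0"
    by (rule LIMSEQ_le_const[OF err_lim]) (use bound in \<open>auto intro!: exI[of _ 1]\<close>)
  moreover have "(\<integral>\<omega>. d \<omega> \<partial>M) = (\<integral>\<omega>. indicator A \<omega> * z ^ (N t \<omega> - N s \<omega>) \<partial>M) - (\<integral>\<omega>. indicator A \<omega> * exp (- x \<omega>) \<partial>M)"
    unfolding d_def using d_int by (rule Bochner_Integration.integral_diff)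
  ultimately show ?thesis by (simp add: x_def)
qed

end

subsection \<open>Conditional Poisson laws\<close>

text \<open>Equal integrals over all events of \<open>F\<close> mean equal nonnegative conditional
  expectations, and these admit arbitrary nonnegative \<open>F\<close>-measurable weights, bounded
  or not.\<close>

lemma (in finite_measure) nn_integral_mult_subalgebra_eq:
  assumes F: "subalgebra M F" and [measurable]: "f \<in> borel_measurable M" "g \<in> borel_measurable M"
    and eq: "\<And>A. A \<in> sets F \<Longrightarrow> (\<integral>\<^sup>+\<omega>\<in>A. f \<omega> \<partial>M) = (\<integral>\<^sup>+\<omega>\<in>A. g \<omega> \<partial>M)"
    and Y[measurable]: "Y \<in> borel_measurable F"
  shows "(\<integral>\<^sup>+\<omega>. Y \<omega> * f \<omega> \<partial>M) = (\<integral>\<^sup>+\<omega>. Y \<omega> * g \<omega> \<partial>M)"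
proof -
  interpret finite_measure_subalgebra M F by unfold_locales (rule F)
  have [measurable]: "Y \<in> borel_measurable M" by (rule measurable_from_subalg[OF F Y])
  have "AE \<omega> in M. nn_cond_exp M F g \<omega> = nn_cond_exp M F f \<omega>"
  proof (rule nn_cond_exp_charact)
    fix A assume [measurable]: "A \<in> sets F"
    then have "(\<integral>\<^sup>+\<omega>. indicator A \<omega> * nn_cond_exp M F g \<omega> \<partial>M) = (\<integral>\<^sup>+\<omega>. indicator A \<omega> * g \<omega> \<partial>M)"
      by (intro nn_cond_exp_intg) auto
    with eq[of A] show "(\<integral>\<^sup>+\<omega>\<in>A. f \<omega> \<partial>M) = (\<integral>\<^sup>+\<omega>\<in>A. nn_cond_exp M F g \<omega> \<partial>M)"
      by (simp add: mult.commute)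
  qed auto
  then have "(\<integral>\<^sup>+\<omega>. Y \<omega> * nn_cond_exp M F g \<omega> \<partial>M) = (\<integral>\<^sup>+\<omega>. Y \<omega> * nn_cond_exp M F f \<omega> \<partial>M)"
    by (intro nn_integral_cong_AE) auto
  then show ?thesis by (simp add: nn_cond_exp_intg)
qed

lemma emeasure_poisson_pmf:
  assumes "0 < x"
  shows "emeasure (measure_pmf (poisson_pmf x)) B =
    (\<Sum>k. indicator B k * ennreal (x ^ k / fact k * exp (- x)))"
proof -
  have "emeasure (measure_pmf (poisson_pmf x)) B = (\<integral>\<^sup>+k. indicator B k \<partial>measure_pmf (poisson_pmf x))"
    by simp
  also have "\<dots> = (\<Sum>k. ennreal (pmf (poisson_pmf x) k) * indicator B k)"
    by (subst nn_integral_measure_pmf) (rule nn_integral_count_space_nat)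
  finally show ?thesis using assms by (simp add: mult.commute)
qed

text \<open>A total function of the rate: the default \<open>0\<close> at nonpositive rates replaces
  the unspecified values of \<open>poisson_pmf\<close>, so that Borel measurability can hold on the
  whole line.\<close>

definition poisson_prob :: "nat set \<Rightarrow> real \<Rightarrow> real" where
  "poisson_prob B x = (if 0 < x then measure_pmf.prob (poisson_pmf x) B else 0)"

lemma poisson_prob_nonneg: "0 \<le> poisson_prob B x"
  and poisson_prob_le_1: "poisson_prob B x \<le> 1"
  by (auto simp: poisson_prob_def)

lemma poisson_prob_UNIV: "0 < x \<Longrightarrow> poisson_prob UNIV x = 1"
  by (simp add: poisson_prob_def)

text \<open>The series exhibits the dependence on the rate, from which measurability can be read
  off.\<close>

lemma ennreal_poisson_prob:
  "ennreal (poisson_prob B x) =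
    (if 0 < x then \<Sum>k. indicator B k * ennreal (x ^ k / fact k * exp (- x)) else 0)"
  by (simp add: poisson_prob_def measure_pmf.emeasure_eq_measure[symmetric] emeasure_poisson_pmf)

lemma borel_measurable_poisson_prob [measurable]: "poisson_prob B \<in> borel_measurable borel"
proof -
  have "(\<lambda>x. ennreal (poisson_prob B x)) \<in> borel_measurable borel"
    unfolding ennreal_poisson_prob by measurable
  then have "(\<lambda>x. enn2real (ennreal (poisson_prob B x))) \<in> borel_measurable borel"
    by measurable
  then show ?thesis by (simp add: poisson_prob_nonneg)
qed

lemma space_sigma_rv [simp]: "space (sigma_rv M \<Theta>) = space M"
  by (simp add: sigma_rv_def)

lemma measurable_sigma_rv: "\<Theta> \<in> borel_measurable (sigma_rv M \<Theta>)"
  unfolding sigma_rv_def by (rule measurable_vimage_algebra1) simp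

lemma subalgebra_sigma_rv: "\<Theta> \<in> borel_measurable M \<Longrightarrow> subalgebra M (sigma_rv M \<Theta>)"
  unfolding subalgebra_def sigma_rv_def by (auto simp: sets_vimage_algebra2)

section \<open>Identifying conditional probabilities through integrals over conditioning
  events\<close>

context prob_space
begin

lemma cprob_charact:
  assumes F: "subalgebra M F" and [measurable]: "E \<in> sets M" and h[measurable]: "h \<in> borel_measurable F"
    and h01: "\<And>\<omega>. 0 \<le> h \<omega>" "\<And>\<omega>. h \<omega> \<le> 1"
    and eq: "\<And>C. C \<in> sets F \<Longrightarrow> (\<integral>\<^sup>+\<omega>. indicator C \<omega> * indicator E \<omega> \<partial>M) = (\<integral>\<^sup>+\<omega>. indicator C \<omega> * ennreal (h \<omega>) \<partial>M)"
  shows "AE \<omega> in M. cprob M F E \<omega> = h \<omega>"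
proof -
  interpret finite_measure_subalgebra M F by unfold_locales (rule F)
  have [measurable]: "h \<in> borel_measurable M" by (rule measurable_from_subalg[OF F h])
  show ?thesis unfolding cprob_def
  proof (rule real_cond_exp_charact)
    fix C assume C: "C \<in> sets F"
    then have [measurable]: "C \<in> sets M" using F by (auto simp: subalgebra_def)
    have "(\<integral>\<omega>\<in>C. indicat_real E \<omega> \<partial>M) = enn2real (\<integral>\<^sup>+\<omega>. indicator C \<omega> * indicator E \<omega> \<partial>M)"
      unfolding set_lebesgue_integral_def
      by (subst integral_eq_nn_integral) (auto simp: ennreal_mult' ennreal_indicator intro!: arg_cong[where f=enn2real] nn_integral_cong split: split_indicator)
    also have "\<dots> = (\<integral>\<omega>\<in>C. h \<omega> \<partial>M)"
      unfolding set_lebesgue_integral_def eq[OF C] using h01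
      by (subst integral_eq_nn_integral) (auto simp: ennreal_mult' ennreal_indicator)
    finally show "(\<integral>\<omega>\<in>C. indicat_real E \<omega> \<partial>M) = (\<integral>\<omega>\<in>C. h \<omega> \<partial>M)" .
  qed (use h01 in \<open>auto intro!: integrable_const_bound[of _ 1]\<close>)
qed

text \<open>Serves stationarity, where a general event of the increment vector has no product
  formula: two events are compared through their traces on conditioning events.\<close>

lemma cprob_eqI:
  assumes F: "subalgebra M F" and [measurable]: "E \<in> sets M" "E' \<in> sets M"
    and eq: "\<And>C. C \<in> sets F \<Longrightarrow> emeasure M (C \<inter> E) = emeasure M (C \<inter> E')"
  shows "AE \<omega> in M. cprob M F E \<omega> = cprob M F E' \<omega>"
proof -
  interpret finite_measure_subalgebra M F by unfold_locales (rule F)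
  show ?thesis unfolding cprob_def
  proof (rule real_cond_exp_charact)
    fix C assume C: "C \<in> sets F"
    then have [measurable]: "C \<in> sets M" using F by (auto simp: subalgebra_def)
    have "(\<integral>\<omega>\<in>C. indicat_real E \<omega> \<partial>M) = measure M (C \<inter> E)"
      unfolding set_lebesgue_integral_def by (simp add: indicator_inter_arith[symmetric] Int_commute)
    also have "\<dots> = measure M (C \<inter> E')" using eq[OF C] by (simp add: measure_def)
    also have "\<dots> = (\<integral>\<omega>\<in>C. indicat_real E' \<omega> \<partial>M)"
      unfolding set_lebesgue_integral_def by (simp add: indicator_inter_arith[symmetric] Int_commute)
    also have "\<dots> = (\<integral>\<omega>\<in>C. real_cond_exp M F (indicat_real E') \<omega> \<partial>M)"
      using C by (intro real_cond_exp_intA integrable_const_bound[of _ 1]) auto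
    finally show "(\<integral>\<omega>\<in>C. indicat_real E \<omega> \<partial>M) = (\<integral>\<omega>\<in>C. real_cond_exp M F (indicat_real E') \<omega> \<partial>M)" .
  qed (auto intro!: real_cond_exp_int(1) integrable_const_bound[of _ 1])
qed

end

section \<open>Conditional law of one increment and of several successive increments\<close>

context poisson_martingale
begin

text \<open>For fixed \<open>A\<close>, both sides are the \<open>k\<close>-th coefficients of power
  series on \<open>(0, 1)\<close>, and these series are the two sides of
  \<open>generating_function_increment\<close>.\<close>

lemma prob_increment_eq:
  assumes st: "0 \<le> s" "s \<le> t" and A: "A \<in> sets (G s)"
  shows "(\<integral>\<omega>. indicat_real A \<omega> * indicat_real {\<omega>. N t \<omega> - N s \<omega> = k} \<omega> \<partial>M) =
    (\<integral>\<omega>. indicat_real A \<omega> * (((t - s) * L \<omega>) ^ k / fact k * exp (- ((t - s) * L \<omega>))) \<partial>M)"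
proof -
  define x where "x \<omega> = (t - s) * L \<omega>" for \<omega>
  have x0: "0 \<le> x \<omega>" for \<omega> using st L_nonneg by (simp add: x_def)
  have [measurable]: "x \<in> borel_measurable M" "A \<in> sets M"
    using A subalgebra[OF st(1)] by (auto simp: x_def[abs_def] subalgebra_def)
  have [measurable]: "N s \<in> measurable M (count_space UNIV)" "N t \<in> measurable M (count_space UNIV)"
    using st by (auto intro: N_measurable)
  define a where "a k = (\<integral>\<omega>. indicat_real A \<omega> * indicat_real {\<omega>. N t \<omega> - N s \<omega> = k} \<omega> \<partial>M)" for k
  define b where "b k = (\<integral>\<omega>. indicat_real A \<omega> * (x \<omega> ^ k / fact k * exp (- x \<omega>)) \<partial>M)" for k
  have "(\<lambda>k. (a k - b k) * z ^ k) sums 0" if z: "0 < z" "z < 1" for z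
  proof -
    have "(\<lambda>k. \<integral>\<omega>. indicat_real A \<omega> * indicat_real {\<omega>. N t \<omega> - N s \<omega> = k} \<omega> * z ^ k \<partial>M) sums
        (\<integral>\<omega>. indicat_real A \<omega> * z ^ (N t \<omega> - N s \<omega>) \<partial>M)"
    proof (rule sums_integral_bounded[where B=1])
      show "(\<lambda>k. indicat_real A \<omega> * indicat_real {\<omega>. N t \<omega> - N s \<omega> = k} \<omega> * z ^ k) sums (indicat_real A \<omega> * z ^ (N t \<omega> - N s \<omega>))" for \<omega>
      proof -
        have "(\<lambda>k. if k = N t \<omega> - N s \<omega> then indicat_real A \<omega> * z ^ k else 0) sums (indicat_real A \<omega> * z ^ (N t \<omega> - N s \<omega>))"
          by (rule sums_single)
        then show ?thesis by (rule sums_cong[THEN iffD1, rotated]) auto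
      qed
      show "indicat_real A \<omega> * z ^ (N t \<omega> - N s \<omega>) \<le> 1" for \<omega>
        using z by (auto intro!: power_le_one split: split_indicator)
    qed (use z in \<open>auto split: split_indicator\<close>)
    then have 1: "(\<lambda>k. a k * z ^ k) sums (\<integral>\<omega>. indicat_real A \<omega> * z ^ (N t \<omega> - N s \<omega>) \<partial>M)"
      by (simp add: a_def)
    have "(\<lambda>k. \<integral>\<omega>. indicat_real A \<omega> * (x \<omega> ^ k / fact k * exp (- x \<omega>)) * z ^ k \<partial>M) sums
        (\<integral>\<omega>. indicat_real A \<omega> * exp (- ((1 - z) * (t - s) * L \<omega>)) \<partial>M)"
    proof (rule sums_integral_bounded[where B=1])
      show "(\<lambda>k. indicat_real A \<omega> * (x \<omega> ^ k / fact k * exp (- x \<omega>)) * z ^ k) sums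
          (indicat_real A \<omega> * exp (- ((1 - z) * (t - s) * L \<omega>)))" for \<omega>
      proof -
        \<comment> \<open>The Poisson generating function:
          \<open>exp (- x) * exp (z * x) = exp (- (1 - z) * x)\<close>.\<close>
        have "(\<lambda>k. indicat_real A \<omega> * exp (- x \<omega>) * ((z * x \<omega>) ^ k /\<^sub>R fact k)) sums (indicat_real A \<omega> * exp (- x \<omega>) * exp (z * x \<omega>))"
          by (intro sums_mult exp_converges)
        also have "indicat_real A \<omega> * exp (- x \<omega>) * exp (z * x \<omega>) = indicat_real A \<omega> * exp (- ((1 - z) * (t - s) * L \<omega>))"
          by (simp add: x_def mult.assoc exp_add[symmetric] algebra_simps)
        finally show ?thesis
          by (rule sums_cong[THEN iffD1, rotated]) (simp add: power_mult_distrib field_simps)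
      qed
      show "indicat_real A \<omega> * exp (- ((1 - z) * (t - s) * L \<omega>)) \<le> 1" for \<omega>
        using z st L_nonneg by (auto intro!: mult_nonneg_nonneg split: split_indicator)
    qed (use z x0 in \<open>auto split: split_indicator\<close>)
    then have 2: "(\<lambda>k. b k * z ^ k) sums (\<integral>\<omega>. indicat_real A \<omega> * exp (- ((1 - z) * (t - s) * L \<omega>)) \<partial>M)"
      by (simp add: b_def)
    from sums_diff[OF 1 2] show ?thesis
      using generating_function_increment[OF st A, of z] z by (simp add: left_diff_distrib)
  qed
  then have "a k - b k = 0" by (rule powser_eq_0_imp_coeff_0)
  then show ?thesis by (simp add: a_def b_def x_def)
qed

text \<open>Point masses are summed over \<open>B\<close>; positivity of \<open>L\<close> identifies
  the sum as a Poisson probability. The weight \<open>Y\<close> makes the identity iterable, because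
  indicators of earlier increments are admissible weights.\<close>

lemma nn_integral_increment:
  assumes st: "0 \<le> s" "s < t" and Y: "Y \<in> borel_measurable (G s)" and pos: "AE \<omega> in M. 0 < L \<omega>"
  shows "(\<integral>\<^sup>+\<omega>. Y \<omega> * indicator {\<omega>. N t \<omega> - N s \<omega> \<in> B} \<omega> \<partial>M) =
    (\<integral>\<^sup>+\<omega>. Y \<omega> * ennreal (poisson_prob B ((t - s) * L \<omega>)) \<partial>M)"
proof (rule nn_integral_mult_subalgebra_eq[OF subalgebra[OF st(1)] _ _ _ Y])
  have [measurable]: "N s \<in> measurable M (count_space UNIV)" "N t \<in> measurable M (count_space UNIV)"
    using st by (auto intro: N_measurable)
  define x where "x \<omega> = (t - s) * L \<omega>" for \<omega>
  have x0: "0 \<le> x \<omega>" for \<omega> using st L_nonneg by (simp add: x_def)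
  have [measurable]: "x \<in> borel_measurable M" by (simp add: x_def[abs_def])
  show "indicator {\<omega>. N t \<omega> - N s \<omega> \<in> B} \<in> borel_measurable M" by measurable
  show "(\<lambda>\<omega>. ennreal (poisson_prob B ((t - s) * L \<omega>))) \<in> borel_measurable M" by measurable
  fix A assume A: "A \<in> sets (G s)"
  then have [measurable]: "A \<in> sets M" using subalgebra[OF st(1)] by (auto simp: subalgebra_def)
  have eq: "(\<integral>\<^sup>+\<omega>. indicator A \<omega> * indicator {\<omega>. N t \<omega> - N s \<omega> = k} \<omega> \<partial>M) =
    (\<integral>\<^sup>+\<omega>. indicator A \<omega> * ennreal (x \<omega> ^ k / fact k * exp (- x \<omega>)) \<partial>M)" for k
  proof -
    \<comment> \<open>A Poisson weight is a probability; rate \<open>0\<close> lies outside the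
      range of \<open>poisson_pmf\<close> and is computed by hand.\<close>
    have bnd: "x \<omega> ^ k / fact k * exp (- x \<omega>) \<le> 1" for \<omega>
    proof (cases "x \<omega> = 0")
      case False
      then have "0 < x \<omega>" using x0[of \<omega>] by simp
      then show ?thesis using pmf_le_1[of "poisson_pmf (x \<omega>)" k] by simp
    qed (cases k, auto)
    have "(\<integral>\<^sup>+\<omega>. indicator A \<omega> * indicator {\<omega>. N t \<omega> - N s \<omega> = k} \<omega> \<partial>M) =
      (\<integral>\<^sup>+\<omega>. ennreal (indicator A \<omega> * indicator {\<omega>. N t \<omega> - N s \<omega> = k} \<omega>) \<partial>M)"
      by (intro nn_integral_cong) (auto split: split_indicator)
    also have "\<dots> = ennreal (\<integral>\<omega>. indicator A \<omega> * indicator {\<omega>. N t \<omega> - N s \<omega> = k} \<omega> \<partial>M)"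
      by (intro nn_integral_eq_integral integrable_const_bound[of _ 1]) (auto split: split_indicator)
    also have "\<dots> = ennreal (\<integral>\<omega>. indicator A \<omega> * (x \<omega> ^ k / fact k * exp (- x \<omega>)) \<partial>M)"
      using prob_increment_eq[OF st(1) less_imp_le[OF st(2)] A] by (simp add: x_def)
    also have "\<dots> = (\<integral>\<^sup>+\<omega>. ennreal (indicator A \<omega> * (x \<omega> ^ k / fact k * exp (- x \<omega>))) \<partial>M)"
      using bnd x0 by (intro nn_integral_eq_integral[symmetric] integrable_const_bound[of _ 1])
        (auto split: split_indicator)
    also have "\<dots> = (\<integral>\<^sup>+\<omega>. indicator A \<omega> * ennreal (x \<omega> ^ k / fact k * exp (- x \<omega>)) \<partial>M)"
      by (intro nn_integral_cong) (auto split: split_indicator)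
    finally show ?thesis .
  qed
  have "(\<integral>\<^sup>+\<omega>\<in>A. indicator {\<omega>. N t \<omega> - N s \<omega> \<in> B} \<omega> \<partial>M) =
      (\<integral>\<^sup>+\<omega>. (\<Sum>k. indicator B k * (indicator A \<omega> * indicator {\<omega>. N t \<omega> - N s \<omega> = k} \<omega>)) \<partial>M)"
  proof (rule nn_integral_cong)
    fix \<omega>
    have "(\<Sum>k. indicator B k * (indicator A \<omega> * indicator {\<omega>. N t \<omega> - N s \<omega> = k} \<omega>)) =
      (\<Sum>k\<in>{N t \<omega> - N s \<omega>}. indicator B k * (indicator A \<omega> * indicator {\<omega>. N t \<omega> - N s \<omega> = k} \<omega>) :: ennreal)"
      by (intro suminf_finite) auto
    then show "indicator {\<omega>. N t \<omega> - N s \<omega> \<in> B} \<omega> * indicator A \<omega> =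
      (\<Sum>k. indicator B k * (indicator A \<omega> * indicator {\<omega>. N t \<omega> - N s \<omega> = k} \<omega>) :: ennreal)"
      by (auto split: split_indicator)
  qed
  also have "\<dots> = (\<Sum>k. indicator B k * (\<integral>\<^sup>+\<omega>. indicator A \<omega> * indicator {\<omega>. N t \<omega> - N s \<omega> = k} \<omega> \<partial>M))"
    by (subst nn_integral_suminf) (auto simp: nn_integral_cmult)
  also have "\<dots> = (\<integral>\<^sup>+\<omega>. (\<Sum>k. indicator B k * (indicator A \<omega> * ennreal (x \<omega> ^ k / fact k * exp (- x \<omega>)))) \<partial>M)"
    unfolding eq by (subst nn_integral_suminf) (auto simp: nn_integral_cmult)
  also have "\<dots> = (\<integral>\<^sup>+\<omega>\<in>A. ennreal (poisson_prob B (x \<omega>)) \<partial>M)"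
  proof (rule nn_integral_cong_AE)
    from pos show "AE \<omega> in M. (\<Sum>k. indicator B k * (indicator A \<omega> * ennreal (x \<omega> ^ k / fact k * exp (- x \<omega>)))) =
      ennreal (poisson_prob B (x \<omega>)) * indicator A \<omega>"
    proof eventually_elim
      case (elim \<omega>)
      then have "0 < x \<omega>" using st by (simp add: x_def)
      then show ?case by (auto simp: ennreal_poisson_prob split: split_indicator)
    qed
  qed
  finally show "(\<integral>\<^sup>+\<omega>\<in>A. indicator {\<omega>. N t \<omega> - N s \<omega> \<in> B} \<omega> \<partial>M) =
    (\<integral>\<^sup>+\<omega>\<in>A. ennreal (poisson_prob B ((t - s) * L \<omega>)) \<partial>M)" by (simp add: x_def)
qed

text \<open>The induction peels off the last increment. Its conditional probability \<open>q\<close>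
  depends on \<open>L\<close> only, hence is measurable at time \<open>0\<close> and moves into the
  weight; this is why \<open>g\<close> is arbitrary in the induction. The grid may start at any
  \<open>\<tau> 0 \<ge> 0\<close>, so that shifted grids are covered.\<close>

lemma nn_integral_prod_increments:
  assumes "0 \<le> \<tau> 0" "\<And>i. i < m \<Longrightarrow> \<tau> i < \<tau> (Suc i)" and g: "g \<in> borel_measurable (G 0)"
    and pos: "AE \<omega> in M. 0 < L \<omega>"
  shows "(\<integral>\<^sup>+\<omega>. g \<omega> * (\<Prod>j=1..m. indicator {\<omega>. N (\<tau> j) \<omega> - N (\<tau> (j - 1)) \<omega> \<in> B j} \<omega>) \<partial>M) =
    (\<integral>\<^sup>+\<omega>. g \<omega> * (\<Prod>j=1..m. ennreal (poisson_prob (B j) ((\<tau> j - \<tau> (j - 1)) * L \<omega>))) \<partial>M)"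
  using assms(1,2) g
proof (induction m arbitrary: g)
  case (Suc m)
  note step = Suc.prems(2)
  have \<tau>0: "0 \<le> \<tau> i" if "i \<le> m" for i
    using that
  proof (induction i)
    case (Suc i)
    then show ?case using step[of i] by simp
  qed (use Suc.prems in simp)
  have mono: "\<tau> i \<le> \<tau> m" if "i \<le> m" for i
    using that
  proof (induction rule: inc_induct)
    case (step i)
    then show ?case using Suc.prems(2)[of i] by simp
  qed simp
  let ?D = "\<lambda>j. {\<omega>. N (\<tau> j) \<omega> - N (\<tau> (j - 1)) \<omega> \<in> B j}"
  define q where "q \<omega> = ennreal (poisson_prob (B (Suc m)) ((\<tau> (Suc m) - \<tau> m) * L \<omega>))" for \<omega>
  define Y where "Y \<omega> = g \<omega> * (\<Prod>j=1..m. indicator (?D j) \<omega>)" for \<omega>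
  have "Y \<in> borel_measurable (G (\<tau> m))"
  proof -
    have [measurable]: "N (\<tau> i) \<in> measurable (G (\<tau> m)) (count_space UNIV)" if "i \<le> m" for i
      using measurable_G_mono[OF \<tau>0 mono adapted[OF \<tau>0]] that by auto
    have [measurable]: "g \<in> borel_measurable (G (\<tau> m))"
      using Suc.prems(3) \<tau>0[of m] by (intro measurable_G_mono[of 0 "\<tau> m"]) auto
    have "(\<lambda>\<omega>. \<Prod>j=1..m. indicator (?D j) \<omega> :: ennreal) \<in> borel_measurable (G (\<tau> m))"
      by (intro borel_measurable_prod_ennreal) (auto intro!: borel_measurable_indicator' )
    then show ?thesis unfolding Y_def by measurable
  qed
  then have "(\<integral>\<^sup>+\<omega>. Y \<omega> * indicator {\<omega>. N (\<tau> (Suc m)) \<omega> - N (\<tau> m) \<omega> \<in> B (Suc m)} \<omega> \<partial>M) = (\<integral>\<^sup>+\<omega>. Y \<omega> * q \<omega> \<partial>M)"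
    unfolding q_def using Suc.prems by (intro nn_integral_increment \<tau>0 pos) auto
  also have "\<dots> = (\<integral>\<^sup>+\<omega>. (g \<omega> * q \<omega>) * (\<Prod>j=1..m. indicator (?D j) \<omega>) \<partial>M)"
    by (simp add: Y_def ac_simps)
  also have "\<dots> = (\<integral>\<^sup>+\<omega>. (g \<omega> * q \<omega>) * (\<Prod>j=1..m. ennreal (poisson_prob (B j) ((\<tau> j - \<tau> (j - 1)) * L \<omega>))) \<partial>M)"
  proof (rule Suc.IH)
    show "(\<lambda>\<omega>. g \<omega> * q \<omega>) \<in> borel_measurable (G 0)"
      unfolding q_def using Suc.prems(3) L_measurable by measurable
  qed (use Suc.prems in auto)
  finally show ?case by (simp add: Y_def q_def ac_simps)
qed simp

end

subsection \<open>Mixed Poisson processes\<close>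

lemma time_grid_mono:
  assumes "time_grid m \<tau>" "i \<le> j" "j \<le> m"
  shows "\<tau> i \<le> \<tau> j"
  using assms(2,3)
proof (induction rule: inc_induct)
  case (step i)
  then have "\<tau> i < \<tau> (Suc i)" using assms(1) by (simp add: time_grid_def)
  with step show ?case by simp
qed simp

lemma time_grid_nonneg: "time_grid m \<tau> \<Longrightarrow> i \<le> m \<Longrightarrow> 0 \<le> \<tau> i"
  using time_grid_mono[of m \<tau> 0 i] by (simp add: time_grid_def)

lemma increment_eq_int_diff:
  assumes "counting_process M N" "\<omega> \<in> space M" "time_grid m \<tau>" "0 \<le> h" "j \<in> {1..m}"
  shows "increment N \<tau> h j \<omega> = int (N (\<tau> j + h) \<omega> - N (\<tau> (j - 1) + h) \<omega>)"
  using counting_process_mono[OF assms(1,2), of "\<tau> (j - 1) + h" "\<tau> j + h"]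
    time_grid_nonneg[OF assms(3), of "j - 1"] time_grid_mono[OF assms(3), of "j - 1" j] assms(4,5)
  by (auto simp: increment_def of_nat_diff)

lemma measurable_increment:
  assumes "counting_process M N" "time_grid m \<tau>" "0 \<le> h" "j \<in> {1..m}"
  shows "increment N \<tau> h j \<in> measurable M (count_space UNIV)"
proof -
  have [measurable]: "N (\<tau> j + h) \<in> measurable M (count_space UNIV)" "N (\<tau> (j - 1) + h) \<in> measurable M (count_space UNIV)"
    using assms time_grid_nonneg[OF assms(2), of j] time_grid_nonneg[OF assms(2), of "j - 1"]
    by (auto simp: counting_process_def)
  show ?thesis unfolding increment_def[abs_def] by measurable
qed

lemma (in finite_measure) emeasure_distr_density_indicator:
  assumes [measurable]: "f \<in> measurable M K" "C \<in> sets M" "A \<in> sets K"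
  shows "emeasure (distr (density M (indicator C)) K f) A = (\<integral>\<^sup>+\<omega>. indicator C \<omega> * indicator {\<omega> \<in> space M. f \<omega> \<in> A} \<omega> \<partial>M)"
  by (subst emeasure_distr, simp, simp, subst emeasure_density)
    (auto intro!: nn_integral_cong split: split_indicator)

context poisson_martingale
begin

text \<open>The shift \<open>h\<close> drops out because the rates depend only on the widths of the
  cells. The product form on the right yields conditional independence, and its freedom from
  \<open>h\<close> yields stationarity.\<close>

lemma nn_integral_grid_increments:
  assumes grid: "time_grid m \<tau>" "0 \<le> h" and C: "C \<in> sets (G 0)" and pos: "AE \<omega> in M. 0 < L \<omega>"
  shows "(\<integral>\<^sup>+\<omega>. indicator C \<omega> * indicator {\<omega> \<in> space M. \<forall>j\<in>{1..m}. increment N \<tau> h j \<omega> \<in> A j} \<omega> \<partial>M) =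
    (\<integral>\<^sup>+\<omega>. indicator C \<omega> * ennreal (\<Prod>j=1..m. poisson_prob (int -` A j) ((\<tau> j - \<tau> (j - 1)) * L \<omega>)) \<partial>M)"
proof -
  have "(\<integral>\<^sup>+\<omega>. indicator C \<omega> * indicator {\<omega> \<in> space M. \<forall>j\<in>{1..m}. increment N \<tau> h j \<omega> \<in> A j} \<omega> \<partial>M) =
    (\<integral>\<^sup>+\<omega>. indicator C \<omega> * (\<Prod>j=1..m. indicator {\<omega>. N (\<tau> j + h) \<omega> - N (\<tau> (j - 1) + h) \<omega> \<in> int -` A j} \<omega>) \<partial>M)"
  proof (intro nn_integral_cong arg_cong2[where f="(*)"] refl)
    fix \<omega> assume \<omega>: "\<omega> \<in> space M"
    have "(\<Prod>j=1..m. indicator {\<omega>. N (\<tau> j + h) \<omega> - N (\<tau> (j - 1) + h) \<omega> \<in> int -` A j} \<omega>) =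
      (\<Prod>j=1..m. if increment N \<tau> h j \<omega> \<in> A j then 1 else 0 :: ennreal)"
      by (intro prod.cong refl) (subst increment_eq_int_diff[OF counting \<omega> grid], auto)
    also have "\<dots> = indicator {\<omega> \<in> space M. \<forall>j\<in>{1..m}. increment N \<tau> h j \<omega> \<in> A j} \<omega>"
      using \<omega> by (auto simp: indicator_def prod_zero_iff intro!: prod.neutral)
    finally show "indicator {\<omega> \<in> space M. \<forall>j\<in>{1..m}. increment N \<tau> h j \<omega> \<in> A j} \<omega> =
      (\<Prod>j=1..m. indicator {\<omega>. N (\<tau> j + h) \<omega> - N (\<tau> (j - 1) + h) \<omega> \<in> int -` A j} \<omega> :: ennreal)" by simp
  qed
  also have "\<dots> = (\<integral>\<^sup>+\<omega>. indicator C \<omega> * (\<Prod>j=1..m. ennreal (poisson_prob (int -` A j) ((\<tau> j + h - (\<tau> (j - 1) + h)) * L \<omega>))) \<partial>M)"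
    using grid C pos
    by (intro nn_integral_prod_increments[where \<tau>="\<lambda>i. \<tau> i + h" and B="\<lambda>j. int -` A j"]) (auto simp: time_grid_def)
  finally show ?thesis by (simp add: prod_ennreal poisson_prob_nonneg)
qed

lemma mixed_poisson:
  assumes \<Theta>[measurable]: "\<Theta> \<in> borel_measurable M" and sub: "sets (sigma_rv M \<Theta>) \<subseteq> sets (G 0)"
    and \<Theta>_pos: "AE \<omega> in M. 0 < \<Theta> \<omega>" and L: "L = (\<lambda>\<omega>. max 0 (\<Theta> \<omega>))"
  shows "mixed_poisson M N \<Theta>"
proof -
  let ?F = "sigma_rv M \<Theta>"
  note F = subalgebra_sigma_rv[OF \<Theta>]
  have pos: "AE \<omega> in M. 0 < L \<omega>" using \<Theta>_pos by (auto simp: L)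
  have [measurable]: "L \<in> borel_measurable ?F"
    unfolding L using measurable_sigma_rv[of \<Theta> M] by measurable
  have sets_incr: "{\<omega> \<in> space M. \<forall>j\<in>{1..m}. increment N \<tau> h j \<omega> \<in> A j} \<in> sets M"
    if "time_grid m \<tau>" "0 \<le> h" for m \<tau> h A
  proof -
    have "{\<omega> \<in> space M. increment N \<tau> h j \<omega> \<in> A j} \<in> sets M" if "j \<in> {1..m}" for j
      using measurable_sets[OF measurable_increment[OF counting \<open>time_grid m \<tau>\<close> \<open>0 \<le> h\<close> that], of "A j"]
      by (simp add: vimage_def Int_def conj_commute)
    then show ?thesis by (intro sets.sets_Collect_finite_All) auto
  qed
  have cprob_incr: "AE \<omega> in M. cprob M ?F {\<omega> \<in> space M. \<forall>j\<in>{1..m}. increment N \<tau> 0 j \<omega> \<in> A j} \<omega> =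
      (\<Prod>j=1..m. poisson_prob (int -` A j) ((\<tau> j - \<tau> (j - 1)) * L \<omega>))"
    if grid: "time_grid m \<tau>" for m \<tau> A
  proof (rule cprob_charact[OF F])
    show "(\<integral>\<^sup>+\<omega>. indicator C \<omega> * indicator {\<omega> \<in> space M. \<forall>j\<in>{1..m}. increment N \<tau> 0 j \<omega> \<in> A j} \<omega> \<partial>M) =
      (\<integral>\<^sup>+\<omega>. indicator C \<omega> * ennreal (\<Prod>j=1..m. poisson_prob (int -` A j) ((\<tau> j - \<tau> (j - 1)) * L \<omega>)) \<partial>M)"
      if "C \<in> sets ?F" for C
      using that sub by (intro nn_integral_grid_increments grid pos) auto
  qed (use sets_incr[OF grid order_refl, of A] in \<open>auto intro!: prod_nonneg prod_le_1 poisson_prob_nonneg poisson_prob_le_1\<close>)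
  have "cond_indep_increments M N \<Theta>"
    unfolding cond_indep_increments_def cond_indep_vars_def cond_indep_sets_def
  proof (intro allI impI conjI ballI)
    fix m \<tau> j assume "time_grid m \<tau>" "j \<in> {1..m}"
    then show "increment N \<tau> 0 j \<in> measurable M (count_space UNIV)"
      by (intro measurable_increment[OF counting]) auto
    then show "{increment N \<tau> 0 j -` B \<inter> space M | B. B \<in> sets (count_space UNIV)} \<subseteq> sets M"
      by (auto intro: measurable_sets)
  next
    fix m \<tau> J E
    assume grid: "time_grid m \<tau>" and J: "J \<subseteq> {1..m}" "J \<noteq> {}" "finite J"
      and E: "\<forall>j\<in>J. E j \<in> {increment N \<tau> 0 j -` B \<inter> space M | B. B \<in> sets (count_space UNIV)}"
    then obtain B where B: "\<And>j. j \<in> J \<Longrightarrow> E j = increment N \<tau> 0 j -` B j \<inter> space M"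
      by simp metis
    define q where "q j \<omega> = poisson_prob (int -` B j) ((\<tau> j - \<tau> (j - 1)) * L \<omega>)" for j \<omega>
    have *: "AE \<omega> in M. cprob M ?F (\<Inter>j\<in>K. E j) \<omega> = (\<Prod>j\<in>K. q j \<omega>)"
      if K: "K \<subseteq> J" "K \<noteq> {}" for K
    proof -
      \<comment> \<open>Indices outside \<open>K\<close> are left unconstrained; their factor is
        \<open>poisson_prob UNIV\<close>, which is \<open>1\<close> because grid widths and
        \<open>L\<close> are positive.\<close>
      define A where "A j = (if j \<in> K then B j else UNIV)" for j
      have "(\<Inter>j\<in>K. E j) = {\<omega> \<in> space M. \<forall>j\<in>{1..m}. increment N \<tau> 0 j \<omega> \<in> A j}"
      proof -
        have "(\<Inter>j\<in>K. E j) = (\<Inter>j\<in>K. increment N \<tau> 0 j -` B j \<inter> space M)"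
          using K by (intro INF_cong refl B) auto
        also have "\<dots> = {\<omega> \<in> space M. \<forall>j\<in>K. increment N \<tau> 0 j \<omega> \<in> B j}"
          using K(2) by blast
        also have "\<dots> = {\<omega> \<in> space M. \<forall>j\<in>{1..m}. increment N \<tau> 0 j \<omega> \<in> A j}"
          using K(1) J(1) unfolding A_def by (intro Collect_cong conj_cong refl) (simp, blast)
        finally show ?thesis .
      qed
      with cprob_incr[OF grid, of A]
      have "AE \<omega> in M. cprob M ?F (\<Inter>j\<in>K. E j) \<omega> = (\<Prod>j=1..m. poisson_prob (int -` A j) ((\<tau> j - \<tau> (j - 1)) * L \<omega>))"
        by simp
      with pos show ?thesis
      proof eventually_elim
        case (elim \<omega>)
        note elim(2)
        also have "(\<Prod>j=1..m. poisson_prob (int -` A j) ((\<tau> j - \<tau> (j - 1)) * L \<omega>)) = (\<Prod>j\<in>K. q j \<omega>)"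
        proof (rule prod.mono_neutral_cong_right)
          show "\<forall>j\<in>{1..m} - K. poisson_prob (int -` A j) ((\<tau> j - \<tau> (j - 1)) * L \<omega>) = 1"
          proof
            fix j assume j: "j \<in> {1..m} - K"
            then have "\<tau> (j - 1) < \<tau> (Suc (j - 1))"
              using grid unfolding time_grid_def by (auto dest: spec[of _ "j - 1"])
            then show "poisson_prob (int -` A j) ((\<tau> j - \<tau> (j - 1)) * L \<omega>) = 1"
              using j elim by (simp add: A_def poisson_prob_UNIV)
          qed
        qed (use K J in \<open>auto simp: A_def q_def\<close>)
        finally show ?case .
      qed
    qed
    have "AE \<omega> in M. \<forall>j\<in>J. cprob M ?F (E j) \<omega> = q j \<omega>"
      using *[of "{j}" for j] J by (subst AE_finite_all) auto
    with *[OF subset_refl J(2)]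
    show "AE \<omega> in M. cprob M ?F (\<Inter>j\<in>J. E j) \<omega> = (\<Prod>j\<in>J. cprob M ?F (E j) \<omega>)"
      by eventually_elim simp
  qed
  moreover have "cond_stationary_increments M N \<Theta>"
    unfolding cond_stationary_increments_def
  proof (intro allI impI ballI)
    fix m \<tau> and h :: real and B
    assume grid: "time_grid m \<tau>" and h: "0 \<le> h"
      and B[measurable]: "B \<in> sets (\<Pi>\<^sub>M j\<in>{1..m}. count_space (UNIV :: int set))"
    let ?P = "\<Pi>\<^sub>M j\<in>{1..m}. count_space (UNIV :: int set)"
    define V where "V h \<omega> = (\<lambda>j\<in>{1..m}. increment N \<tau> h j \<omega>)" for h \<omega>
    have V[measurable]: "V h' \<in> measurable M ?P" if "0 \<le> h'" for h'
      unfolding V_def using measurable_increment[OF counting grid that] by (intro measurable_restrict) auto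
    have [measurable]: "V h \<in> measurable M ?P" "V 0 \<in> measurable M ?P" using V h by auto
    have "AE \<omega> in M. cprob M ?F {\<omega> \<in> space M. V h \<omega> \<in> B} \<omega> = cprob M ?F {\<omega> \<in> space M. V 0 \<omega> \<in> B} \<omega>"
    proof (rule cprob_eqI[OF F])
      fix C assume C: "C \<in> sets ?F"
      then have [measurable]: "C \<in> sets M" using F by (auto simp: subalgebra_def)
      let ?D = "\<lambda>h. distr (density M (indicator C)) ?P (V h)"
      have D: "emeasure (?D h') (Pi\<^sub>E {1..m} A) = (\<integral>\<^sup>+\<omega>. indicator C \<omega> * ennreal (\<Prod>j=1..m. poisson_prob (int -` A j) ((\<tau> j - \<tau> (j - 1)) * L \<omega>)) \<partial>M)"
        if h': "0 \<le> h'" for h' A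
      proof -
        have [measurable]: "Pi\<^sub>E {1..m} A \<in> sets ?P" by (intro sets_PiM_I_finite) auto
        have "emeasure (?D h') (Pi\<^sub>E {1..m} A) = (\<integral>\<^sup>+\<omega>. indicator C \<omega> * indicator {\<omega> \<in> space M. V h' \<omega> \<in> Pi\<^sub>E {1..m} A} \<omega> \<partial>M)"
          using V[OF h'] by (intro emeasure_distr_density_indicator) auto
        also have "{\<omega> \<in> space M. V h' \<omega> \<in> Pi\<^sub>E {1..m} A} = {\<omega> \<in> space M. \<forall>j\<in>{1..m}. increment N \<tau> h' j \<omega> \<in> A j}"
          by (auto simp: V_def PiE_iff)
        finally show ?thesis using C sub by (subst (asm) nn_integral_grid_increments[OF grid h' _ pos]) auto
      qed
      \<comment> \<open>The laws of the two increment vectors on \<open>C\<close> agree on boxes,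
        since the right side of \<open>D\<close> is the same for every shift; boxes determine a
        finite measure on a finite product.\<close>
      have "?D h = ?D 0"
      proof (rule measure_eqI_PiM_finite[where I="{1..m}" and M="\<lambda>_. count_space UNIV" and A="\<lambda>_. Pi\<^sub>E {1..m} (\<lambda>_. UNIV)"])
        show "emeasure (?D h) (Pi\<^sub>E {1..m} (\<lambda>_. UNIV)) \<noteq> \<infinity>"
        proof -
          have "emeasure (?D h) (Pi\<^sub>E {1..m} (\<lambda>_. UNIV)) =
              (\<integral>\<^sup>+\<omega>. indicator C \<omega> * indicator {\<omega> \<in> space M. V h \<omega> \<in> Pi\<^sub>E {1..m} (\<lambda>_. UNIV)} \<omega> \<partial>M)"
            using V[OF h] by (intro emeasure_distr_density_indicator) (auto intro!: sets_PiM_I_finite)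
          also have "\<dots> \<le> (\<integral>\<^sup>+\<omega>. 1 \<partial>M)"
            by (intro nn_integral_mono) (auto split: split_indicator)
          finally have "emeasure (?D h) (Pi\<^sub>E {1..m} (\<lambda>_. UNIV)) \<le> (\<integral>\<^sup>+\<omega>. 1 \<partial>M)" .
          then show ?thesis by (auto simp: emeasure_space_1 top_unique)
        qed
        show "emeasure (?D h) (Pi\<^sub>E {1..m} A) = emeasure (?D 0) (Pi\<^sub>E {1..m} A)" for A
          by (simp only: D[OF h] D[OF order_refl])
      qed (auto simp: space_PiM intro!: prod_algebraI_finite)
      then have "emeasure (?D h) B = emeasure (?D 0) B" by simp
      moreover have emB: "emeasure (?D h') B = emeasure M (C \<inter> {\<omega> \<in> space M. V h' \<omega> \<in> B})" if h': "0 \<le> h'" for h'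
      proof -
        have [measurable]: "{\<omega> \<in> space M. V h' \<omega> \<in> B} \<in> sets M"
          using measurable_sets[OF V[OF h'] B] by (simp add: vimage_def Int_def conj_commute)
        have "emeasure (?D h') B = (\<integral>\<^sup>+\<omega>. indicator C \<omega> * indicator {\<omega> \<in> space M. V h' \<omega> \<in> B} \<omega> \<partial>M)"
          using V[OF h'] B by (intro emeasure_distr_density_indicator) auto
        then show ?thesis by (simp add: indicator_inter_arith[symmetric])
      qed
      ultimately show "emeasure M (C \<inter> {\<omega> \<in> space M. V h \<omega> \<in> B}) = emeasure M (C \<inter> {\<omega> \<in> space M. V 0 \<omega> \<in> B})"
        unfolding emB[OF h, symmetric] emB[OF order_refl, symmetric] by simp
    qed auto
    then show "AE \<omega> in M. cprob M ?F {\<omega> \<in> space M. (\<lambda>j\<in>{1..m}. increment N \<tau> h j \<omega>) \<in> B} \<omega> =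
      cprob M ?F {\<omega> \<in> space M. (\<lambda>j\<in>{1..m}. increment N \<tau> 0 j \<omega>) \<in> B} \<omega>" by (simp add: V_def)
  qed
  moreover have "AE \<omega> in M. cprob M ?F {\<omega> \<in> space M. N t \<omega> \<in> B} \<omega> = measure_pmf.prob (poisson_pmf (t * \<Theta> \<omega>)) B"
    if t: "0 < t" for t B
  proof -
    \<comment> \<open>On this one-cell grid the only increment is \<open>N t - N 0\<close>, which is
      \<open>N t\<close>.\<close>
    define \<tau> where "\<tau> i = (if i = 0 then 0 else t)" for i :: nat
    have grid: "time_grid 1 \<tau>" using t by (simp add: time_grid_def \<tau>_def)
    have "{\<omega> \<in> space M. \<forall>j\<in>{1..1}. increment N \<tau> 0 j \<omega> \<in> int ` B} = {\<omega> \<in> space M. N t \<omega> \<in> B}"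
      using counting by (auto simp: increment_def \<tau>_def counting_process_def)
    with cprob_incr[OF grid, of "\<lambda>_. int ` B"]
    have "AE \<omega> in M. cprob M ?F {\<omega> \<in> space M. N t \<omega> \<in> B} \<omega> = poisson_prob B (t * L \<omega>)"
      by (simp add: \<tau>_def inj_vimage_image_eq)
    with \<Theta>_pos show ?thesis
      by eventually_elim (use t in \<open>simp add: L poisson_prob_def\<close>)
  qed
  ultimately show ?thesis using counting by (simp add: mixed_poisson_def)
qed

end

subsection \<open>Independence of the sizes from the counting process and the parameter\<close>

lemma space_sigma_process [simp]: "space (sigma_process \<Omega> I Z K) = \<Omega>"
  unfolding sigma_process_def by (rule space_measure_of) auto

lemma sets_sigma_process:
  "sets (sigma_process \<Omega> I Z K) = sigma_sets \<Omega> (\<Union>i\<in>I. {Z i -` B \<inter> \<Omega> | B. B \<in> sets K})"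
  unfolding sigma_process_def by (rule sets_measure_of) auto

lemma measurable_sigma_process:
  assumes "i \<in> I" "\<And>\<omega>. \<omega> \<in> \<Omega> \<Longrightarrow> Z i \<omega> \<in> space K"
  shows "Z i \<in> measurable (sigma_process \<Omega> I Z K) K"
  using assms by (intro measurableI) (auto simp: sets_sigma_process)

lemma sets_sigma_process_subset:
  assumes "space M = \<Omega>" "\<And>i. i \<in> I \<Longrightarrow> Z i \<in> measurable M K"
  shows "sets (sigma_process \<Omega> I Z K) \<subseteq> sets M"
  unfolding sets_sigma_process using assms
  by (intro sets.sigma_sets_subset[of _ M, simplified assms(1)]) (auto intro: measurable_sets)

lemma space_enlarged_filtration [simp]: "space (enlarged_filtration M S \<Theta> t) = space M"
  unfolding enlarged_filtration_def
  by (rule space_measure_of) (use sets.sets_into_space in \<open>fastforce simp: natural_filtration_def\<close>)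

lemma sets_enlarged_filtration:
  "sets (enlarged_filtration M S \<Theta> t) =
    sigma_sets (space M) (sets (natural_filtration M S t) \<union> sets (sigma_rv M \<Theta>))"
  unfolding enlarged_filtration_def
  by (rule sets_measure_of) (use sets.sets_into_space in \<open>fastforce simp: natural_filtration_def\<close>)

lemma space_natural_filtration [simp]: "space (natural_filtration M S t) = space M"
  by (simp add: natural_filtration_def)

lemma sets_natural_filtration_mono:
  "s \<le> t \<Longrightarrow> sets (natural_filtration M S s) \<subseteq> sets (natural_filtration M S t)"
  unfolding natural_filtration_def sets_sigma_process
  by (intro sigma_sets_mono' UN_mono) auto

lemma sets_enlarged_filtration_mono:
  "s \<le> t \<Longrightarrow> sets (enlarged_filtration M S \<Theta> s) \<subseteq> sets (enlarged_filtration M S \<Theta> t)"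
  unfolding sets_enlarged_filtration using sets_natural_filtration_mono[of s t M S]
  by (intro sigma_sets_mono') auto

lemma natural_subset_enlarged: "sets (natural_filtration M S t) \<subseteq> sets (enlarged_filtration M S \<Theta> t)"
  and sigma_rv_subset_enlarged: "sets (sigma_rv M \<Theta>) \<subseteq> sets (enlarged_filtration M S \<Theta> t)"
  unfolding sets_enlarged_filtration by auto

lemma measurable_sets_mono:
  assumes "f \<in> measurable F K" "sets F \<subseteq> sets G" "space F = space G"
  shows "f \<in> measurable G K"
  using assms by (auto simp: measurable_def)

text \<open>The sets whose trace on \<open>Q\<close> lies in \<open>K\<close> are closed under
  complements and countable unions. Thus a sigma-algebra can be compared with \<open>K\<close> on
  the part \<open>Q\<close> alone.\<close>

lemma sigma_sets_Int_closed:
  assumes "\<And>A. A \<in> \<A> \<Longrightarrow> A \<inter> Q \<in> sets K" and Q: "Q \<in> sets K" and "E \<in> sigma_sets (space K) \<A>"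
  shows "E \<inter> Q \<in> sets K"
  using assms(3)
proof induction
  case (Compl E)
  have "(space K - E) \<inter> Q = Q - E \<inter> Q" using sets.sets_into_space[OF Q] by auto
  then show ?case using Compl Q by auto
next
  case (Union E)
  have "\<Union> (range E) \<inter> Q = (\<Union>i. E i \<inter> Q)" by auto
  then show ?case using Union.IH by (simp only:) (intro sets.countable_UN, auto)
qed (use assms in auto)

text \<open>On \<open>D\<close> the variable \<open>Y\<close> keeps its law up to the factor
  \<open>prob D\<close>. The argument is about laws, so infinite integrals are covered.\<close>

lemma (in prob_space) nn_integral_mult_indicator_indep:
  assumes [measurable]: "Y \<in> borel_measurable M" "D \<in> sets M"
    and indep: "\<And>B. B \<in> sets borel \<Longrightarrow> prob (Y -` B \<inter> space M \<inter> D) = prob (Y -` B \<inter> space M) * prob D"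
  shows "(\<integral>\<^sup>+\<omega>. ennreal (Y \<omega>) * indicator D \<omega> \<partial>M) = (\<integral>\<^sup>+\<omega>. ennreal (Y \<omega>) \<partial>M) * emeasure M D"
proof -
  have eq: "distr (density M (indicator D)) borel Y = scale_measure (emeasure M D) (distr M borel Y)"
  proof (rule measure_eqI)
    fix B assume "B \<in> sets (distr (density M (indicator D)) borel Y)"
    then have B[measurable]: "B \<in> sets borel" by simp
    have "emeasure (distr (density M (indicator D)) borel Y) B = emeasure M (Y -` B \<inter> space M \<inter> D)"
      by (subst emeasure_distr, simp, simp, subst emeasure_density) (auto simp: indicator_inter_arith[symmetric] Int_commute)
    also have "\<dots> = emeasure M D * emeasure M (Y -` B \<inter> space M)"
      by (simp add: emeasure_eq_measure indep[OF B] ennreal_mult mult.commute)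
    finally show "emeasure (distr (density M (indicator D)) borel Y) B = emeasure (scale_measure (emeasure M D) (distr M borel Y)) B"
      by (simp add: emeasure_distr)
  qed simp
  have "(\<integral>\<^sup>+\<omega>. ennreal (Y \<omega>) * indicator D \<omega> \<partial>M) = (\<integral>\<^sup>+y. ennreal y \<partial>distr (density M (indicator D)) borel Y)"
    by (simp add: nn_integral_distr nn_integral_density mult.commute)
  also have "\<dots> = emeasure M D * (\<integral>\<^sup>+\<omega>. ennreal (Y \<omega>) \<partial>M)"
    unfolding eq by (simp add: nn_integral_scale_measure nn_integral_distr)
  finally show ?thesis by (simp add: mult.commute)
qed

section \<open>The risk process with its parameter\<close>

locale risk_setting = prob_space M for M :: "'a measure" +
  fixes N :: "real \<Rightarrow> 'a \<Rightarrow> nat" and X :: "nat \<Rightarrow> 'a \<Rightarrow> real" and \<Theta> :: "'a \<Rightarrow> real"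
  assumes risk: "risk_process M N X"
    and \<Theta>_measurable [measurable]: "\<Theta> \<in> borel_measurable M"
    and \<Theta>_pos: "AE \<omega> in M. 0 < \<Theta> \<omega>"
    and cond_indep: "cond_indep_set M (sigma_rv M \<Theta>) (sets (sigma_seq M (interarrival N))) (sets (sigma_seq M X))"
    and indep: "indep_set (sets (sigma_rv M \<Theta>)) (sets (sigma_seq M X))"
    and X_integrable: "integrable M (X 1)"
    and \<Theta>_integrable: "integrable M \<Theta>"
begin

abbreviation S where "S \<equiv> aggregate N X"
abbreviation F where "F \<equiv> enlarged_filtration M S \<Theta>"

definition \<mu> where "\<mu> = expectation (X 1)"

lemma counting: "counting_process M N"
  using risk by (simp add: risk_process_def)

lemma N_measurable [measurable]: "0 \<le> t \<Longrightarrow> N t \<in> measurable M (count_space UNIV)"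
  using counting by (simp add: counting_process_def)

lemma N_mono: "\<omega> \<in> space M \<Longrightarrow> 0 \<le> s \<Longrightarrow> s \<le> t \<Longrightarrow> N s \<omega> \<le> N t \<omega>"
  by (rule counting_process_mono[OF counting])

lemma X_measurable [measurable]: "1 \<le> k \<Longrightarrow> X k \<in> borel_measurable M"
  and X_pos: "1 \<le> k \<Longrightarrow> \<omega> \<in> space M \<Longrightarrow> 0 < X k \<omega>"
  using risk by (auto simp: risk_process_def size_process_def)

lemma X_distr: "1 \<le> k \<Longrightarrow> distr M borel (X k) = distr M borel (X 1)"
  using risk unfolding risk_process_def iid_def by blast

lemma nn_integral_X:
  assumes "1 \<le> k"
  shows "(\<integral>\<^sup>+\<omega>. ennreal (X k \<omega>) \<partial>M) = ennreal \<mu>"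
proof -
  have "(\<integral>\<^sup>+\<omega>. ennreal (X k \<omega>) \<partial>M) = (\<integral>\<^sup>+x. ennreal x \<partial>distr M borel (X k))"
    using assms by (simp add: nn_integral_distr)
  also have "\<dots> = (\<integral>\<^sup>+\<omega>. ennreal (X 1 \<omega>) \<partial>M)"
    unfolding X_distr[OF assms] by (simp add: nn_integral_distr)
  also have "\<dots> = ennreal \<mu>"
    unfolding \<mu>_def using X_pos[of 1] by (intro nn_integral_eq_integral X_integrable) (auto intro: less_imp_le)
  finally show ?thesis .
qed

text \<open>Allows \<open>\<mu>\<close> to be cancelled when passing from \<open>S\<close> back to
  \<open>N\<close>.\<close>

lemma \<mu>_pos: "0 < \<mu>"
proof -
  have "0 \<le> \<mu>" unfolding \<mu>_def using X_pos[of 1] by (intro integral_nonneg_AE) (auto intro: less_imp_le)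
  moreover have "\<mu> \<noteq> 0"
  proof
    assume "\<mu> = 0"
    then have "AE \<omega> in M. X 1 \<omega> = 0"
      unfolding \<mu>_def using X_pos[of 1] integral_nonneg_eq_0_iff_AE[OF X_integrable] by (auto intro: less_imp_le)
    moreover have "AE \<omega> in M. X 1 \<omega> \<noteq> 0" using X_pos[of 1] by (intro AE_I2) force
    ultimately have "AE \<omega> in M. False" by eventually_elim simp
    then show False by simp
  qed
  ultimately show ?thesis by simp
qed

lemma sets_sigma_seq_X: "sets (sigma_seq M X) \<subseteq> sets M"
  unfolding sigma_seq_def by (rule sets_sigma_process_subset) auto

lemma sets_sigma_seq_W: "sets (sigma_seq M (interarrival N)) \<subseteq> sets M"
proof -
  have "\<forall>i\<in>UNIV. case_bool (sets (sigma_seq M (interarrival N))) (sets (sigma_seq M X)) i \<subseteq> sets M"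
    using cond_indep unfolding cond_indep_set_def cond_indep_sets_def by (rule conjunct1)
  from bspec[OF this, of True] show ?thesis by simp
qed

lemma sets_sigma_\<Theta>: "sets (sigma_rv M \<Theta>) \<subseteq> sets M"
  using subalgebra_sigma_rv[OF \<Theta>_measurable] by (simp add: subalgebra_def)

text \<open>\<open>n \<le> N t\<close> holds exactly when the first \<open>n\<close> interarrival
  times add up to at most \<open>t\<close>. Conditional independence, which is assumed for the
  interarrival times, thereby covers \<open>N\<close>.\<close>

lemma sets_sigma_counting: "sets (sigma_counting M N) \<subseteq> sets (sigma_seq M (interarrival N))"
  unfolding sigma_counting_def
proof (rule sets_sigma_process_subset)
  let ?W = "sigma_seq M (interarrival N)"
  show space: "space ?W = space M" by (simp add: sigma_seq_def)
  fix t :: real assume t: "t \<in> {0..}"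
  have [measurable]: "interarrival N k \<in> borel_measurable ?W" if "1 \<le> k" for k
    unfolding sigma_seq_def using that by (intro measurable_sigma_process) auto
  have "{\<omega> \<in> space M. n \<le> N t \<omega>} \<in> sets ?W" for n
  proof -
    have "(\<lambda>\<omega>. \<Sum>k=1..n. interarrival N k \<omega>) \<in> borel_measurable ?W" by (intro borel_measurable_sum) auto
    then have "{\<omega> \<in> space ?W. (\<Sum>k=1..n. interarrival N k \<omega>) \<le> t} \<in> sets ?W" by measurable
    also have "{\<omega> \<in> space ?W. (\<Sum>k=1..n. interarrival N k \<omega>) \<le> t} = {\<omega> \<in> space M. n \<le> N t \<omega>}"
      unfolding space using t
      by (intro Collect_cong conj_cong refl)
        (simp only: arrival_eq_sum_interarrival[OF counting, symmetric] arrival_le_iff[OF counting] atLeast_iff)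
    finally show ?thesis .
  qed
  note ge = this
  show "N t \<in> measurable ?W (count_space UNIV)"
  proof (subst measurable_count_space_eq2_countable, intro conjI ballI)
    fix n
    have "N t -` {n} \<inter> space ?W = {\<omega> \<in> space M. n \<le> N t \<omega>} - {\<omega> \<in> space M. Suc n \<le> N t \<omega>}"
      by (auto simp: space)
    then show "N t -` {n} \<inter> space ?W \<in> sets ?W" using ge by auto
  qed auto
qed

text \<open>Given \<Theta>, the probability of \<open>A \<inter> B\<close> factors, and that of
  \<open>B\<close> is the constant \<open>prob B\<close> because \<open>X\<close> is independent of
  \<Theta>. Integrating over \<open>C\<close> leaves the factor \<open>prob B\<close>
  outside.\<close>

lemma prob_counting_\<Theta>_X:
  assumes A: "A \<in> sets (sigma_counting M N)" and C: "C \<in> sets (sigma_rv M \<Theta>)" and B: "B \<in> sets (sigma_seq M X)"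
  shows "prob (A \<inter> C \<inter> B) = prob (A \<inter> C) * prob B"
proof -
  let ?F = "sigma_rv M \<Theta>"
  have AW: "A \<in> sets (sigma_seq M (interarrival N))" using A sets_sigma_counting by auto
  have [measurable]: "A \<in> sets M" "C \<in> sets M" "B \<in> sets M"
    using AW C B sets_sigma_seq_W sets_sigma_seq_X sets_sigma_\<Theta> by auto
  interpret finite_measure_subalgebra M ?F
    by unfold_locales (rule subalgebra_sigma_rv[OF \<Theta>_measurable])
  have int: "integrable M (indicat_real E)" if "E \<in> sets M" for E
    using that by (auto intro!: integrable_const_bound[of _ 1])
  have cprob_int: "(\<integral>\<omega>\<in>C'. cprob M ?F E \<omega> \<partial>M) = prob (E \<inter> C')" if "C' \<in> sets ?F" "E \<in> sets M" for E C'
  proof -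
    have [measurable]: "C' \<in> sets M" "E \<in> sets M" using that sets_sigma_\<Theta> by auto
    have "(\<integral>\<omega>\<in>C'. cprob M ?F E \<omega> \<partial>M) = (\<integral>\<omega>\<in>C'. indicat_real E \<omega> \<partial>M)"
      unfolding cprob_def using that int by (intro real_cond_exp_intA[symmetric]) auto
    then show ?thesis by (simp add: set_lebesgue_integral_def indicator_inter_arith[symmetric] Int_commute)
  qed
  have B1: "AE \<omega> in M. cprob M ?F B \<omega> = prob B"
    unfolding cprob_def
  proof (rule real_cond_exp_charact)
    fix C' assume C': "C' \<in> sets ?F"
    then have [measurable]: "C' \<in> sets M" using sets_sigma_\<Theta> by auto
    have "(\<integral>\<omega>\<in>C'. indicat_real B \<omega> \<partial>M) = prob (C' \<inter> B)"
      by (simp add: set_lebesgue_integral_def indicator_inter_arith[symmetric])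
    also have "\<dots> = (\<integral>\<omega>\<in>C'. prob B \<partial>M)"
      using indep_setD[OF indep C' B] by (simp add: set_lebesgue_integral_def)
    finally show "(\<integral>\<omega>\<in>C'. indicat_real B \<omega> \<partial>M) = (\<integral>\<omega>\<in>C'. prob B \<partial>M)" .
  qed (auto intro: int)
  have "AE \<omega> in M. cprob M ?F (A \<inter> B) \<omega> = cprob M ?F A \<omega> * cprob M ?F B \<omega>"
  proof -
    have "\<forall>E. (\<forall>j\<in>UNIV. E j \<in> (case j of True \<Rightarrow> sets (sigma_seq M (interarrival N)) | False \<Rightarrow> sets (sigma_seq M X))) \<longrightarrow>
        (AE \<omega> in M. cprob M ?F (\<Inter>j\<in>UNIV. E j) \<omega> = (\<Prod>j\<in>UNIV. cprob M ?F (E j) \<omega>))"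
      using cond_indep unfolding cond_indep_set_def cond_indep_sets_def by simp
    from this[THEN spec, of "case_bool A B"] show ?thesis
      using AW B by (simp add: UNIV_bool ac_simps split: bool.split)
  qed
  with B1 have AE: "AE \<omega> in M. cprob M ?F (A \<inter> B) \<omega> = prob B * cprob M ?F A \<omega>"
    by eventually_elim simp
  have "prob (A \<inter> C \<inter> B) = (\<integral>\<omega>\<in>C. cprob M ?F (A \<inter> B) \<omega> \<partial>M)"
    using C by (subst cprob_int) (auto intro!: arg_cong[where f=prob])
  also have "\<dots> = (\<integral>\<omega>\<in>C. prob B * cprob M ?F A \<omega> \<partial>M)"
    unfolding set_lebesgue_integral_def using AE
    by (intro integral_cong_AE) (auto simp: cprob_def)
  also have "\<dots> = prob B * prob (A \<inter> C)"
    using C by (simp add: cprob_int)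
  finally show ?thesis by simp
qed

end

subsection \<open>Wald's identity on the filtration\<close>

context risk_setting
begin

lemma space_sigma_counting [simp]: "space (sigma_counting M N) = space M"
  by (simp add: sigma_counting_def)

lemma N_measurable_sigma_counting: "0 \<le> t \<Longrightarrow> N t \<in> measurable (sigma_counting M N) (count_space UNIV)"
  unfolding sigma_counting_def by (rule measurable_sigma_process) auto

lemma sets_sigma_counting_M: "sets (sigma_counting M N) \<subseteq> sets M"
  using sets_sigma_counting sets_sigma_seq_W by blast

text \<open>Index \<open>0\<close> carries the pair \<open>(N, \<Theta>)\<close>, index \<open>i \<ge> 1\<close> the size \<open>X i\<close>.\<close>

definition source :: "nat \<Rightarrow> 'a set set" where
  "source i = (if i = 0 then {A \<inter> C | A C. A \<in> sets (sigma_counting M N) \<and> C \<in> sets (sigma_rv M \<Theta>)}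
     else {X i -` B \<inter> space M | B. B \<in> sets borel})"

text \<open>The size \<open>X k\<close> itself is left out. In particular \<open>history 1\<close>
  is generated by \<open>N\<close> and \<Theta> alone, and every \<open>history k\<close> with
  \<open>k \<ge> 1\<close> contains all of \<open>N\<close>, its future included.\<close>

definition history :: "nat \<Rightarrow> 'a measure" where
  "history k = sigma (space M) (\<Union>i<k. source i)"

lemma source_subset: "source i \<subseteq> sets M"
proof (cases "i = 0")
  case True
  then show ?thesis using sets_sigma_counting_M sets_sigma_\<Theta> by (auto simp: source_def)
next
  case False
  then have "X i \<in> borel_measurable M" by simp
  then show ?thesis using False by (auto simp: source_def intro: measurable_sets)
qed

lemma Int_stable_source: "Int_stable (source i)"
proof (rule Int_stableI)
  fix a b assume ab: "a \<in> source i" "b \<in> source i"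
  show "a \<inter> b \<in> source i"
  proof (cases "i = 0")
    case True
    with ab obtain A C A' C' where "a = A \<inter> C" "b = A' \<inter> C'"
      and "A \<inter> A' \<in> sets (sigma_counting M N)" "C \<inter> C' \<in> sets (sigma_rv M \<Theta>)"
      by (auto simp: source_def)
    moreover have "A \<inter> C \<inter> (A' \<inter> C') = (A \<inter> A') \<inter> (C \<inter> C')" by auto
    ultimately show ?thesis using True by (auto simp: source_def)
  next
    case False
    with ab obtain B B' where "a = X i -` B \<inter> space M" "b = X i -` B' \<inter> space M" "B \<inter> B' \<in> sets borel"
      by (auto simp: source_def)
    moreover have "X i -` B \<inter> space M \<inter> (X i -` B' \<inter> space M) = X i -` (B \<inter> B') \<inter> space M" by auto
    ultimately have "a \<inter> b \<in> {X i -` B \<inter> space M | B. B \<in> sets borel}" by (intro CollectI exI[of _ "B \<inter> B'"]) simp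
    then show ?thesis using False by (simp add: source_def)
  qed
qed

text \<open>The sizes are mutually independent; index \<open>0\<close> is adjoined by treating the
  intersection of the remaining events as one event of \<open>X\<close>.\<close>

lemma indep_sets_source: "indep_sets source UNIV"
proof (rule indep_setsI)
  fix A J assume J: "J \<noteq> {}" "finite J" and A: "\<forall>j\<in>J. A j \<in> source j"
  have X_indep: "indep_sets (\<lambda>i. {X i -` B \<inter> space M | B. B \<in> sets borel}) {1..}"
    using risk by (simp add: risk_process_def iid_def indep_vars_def2)
  define K where "K = J - {0}"
  have K: "finite K" "K \<subseteq> {1..}" "0 \<notin> K" "\<And>j. j \<in> K \<Longrightarrow> A j \<in> source j"
    using J A by (auto simp: K_def)
  have AX: "A j \<in> sets (sigma_seq M X)" if j: "j \<in> K" for j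
  proof -
    have "A j \<in> {X j -` B \<inter> space M | B. B \<in> sets borel}" "j \<in> {1..}"
      using K(4)[OF j] K(2) j by (auto simp: source_def split: if_splits)
    then show ?thesis unfolding sigma_seq_def sets_sigma_process by (intro sigma_sets.Basic UN_I)
  qed
  have prob_K: "prob (\<Inter>j\<in>K. A j) = (\<Prod>j\<in>K. prob (A j))" if "K \<noteq> {}"
  proof (rule indep_setsD[OF X_indep K(2) that K(1)])
    show "\<forall>j\<in>K. A j \<in> {X j -` B \<inter> space M | B. B \<in> sets borel}"
    proof
      fix j assume "j \<in> K"
      with K(3) K(4)[of j] show "A j \<in> {X j -` B \<inter> space M | B. B \<in> sets borel}"
        by (cases "j = 0") (simp_all add: source_def)
    qed
  qed
  show "prob (\<Inter>j\<in>J. A j) = (\<Prod>j\<in>J. prob (A j))"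
  proof (cases "0 \<in> J")
    case True
    then have J_eq: "J = insert 0 K" by (auto simp: K_def)
    obtain B C where BC: "A 0 = B \<inter> C" "B \<in> sets (sigma_counting M N)" "C \<in> sets (sigma_rv M \<Theta>)"
      using A True by (fastforce simp: source_def)
    show ?thesis
    proof (cases "K = {}")
      case False
      then have "(\<Inter>j\<in>K. A j) \<in> sets (sigma_seq M X)"
        using K(1) AX by (intro sets.finite_INT)
      then have "prob (A 0 \<inter> (\<Inter>j\<in>K. A j)) = prob (A 0) * prob (\<Inter>j\<in>K. A j)"
        unfolding BC(1) by (intro prob_counting_\<Theta>_X BC)
      then show ?thesis
        unfolding J_eq using K by (simp add: prob_K[OF False])
    qed (simp add: J_eq)
  next
    case False
    then have "K = J" by (auto simp: K_def)
    with prob_K J show ?thesis by simp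
  qed
qed (rule source_subset)

lemma space_history [simp]: "space (history k) = space M"
  unfolding history_def using source_subset sets.sets_into_space by (intro space_measure_of) blast

lemma sets_history: "sets (history k) = sigma_sets (space M) (\<Union>i<k. source i)"
  unfolding history_def using source_subset sets.sets_into_space by (intro sets_measure_of) blast

lemma sets_history_subset: "sets (history k) \<subseteq> sets M"
  unfolding sets_history using source_subset by (intro sets.sigma_sets_subset) blast

text \<open>\<open>{k}\<close> and \<open>{..<k}\<close> are disjoint blocks of an independent
  family, so the sigma-algebras they generate are independent.\<close>

lemma nn_integral_X_history:
  assumes k: "1 \<le> k" and D: "D \<in> sets (history k)"
  shows "(\<integral>\<^sup>+\<omega>. ennreal (X k \<omega>) * indicator D \<omega> \<partial>M) = ennreal \<mu> * emeasure M D"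
proof -
  have DM: "D \<in> sets M" using D sets_history_subset by auto
  let ?I = "case_bool {k} {..<k}"
  have "indep_sets (\<lambda>j. sigma_sets (space M) (\<Union>i\<in>?I j. source i)) UNIV"
    by (rule indep_sets_collect_sigma)
      (auto intro: indep_sets_mono_index[OF _ indep_sets_source] Int_stable_source
        simp: disjoint_family_on_def split: bool.splits)
  note indep = this
  have ind: "prob (a \<inter> D) = prob a * prob D" if "a \<in> source k" for a
  proof -
    have "prob (\<Inter>j\<in>UNIV. case_bool a D j) = (\<Prod>j\<in>UNIV. prob (case_bool a D j))"
      by (rule indep_setsD[OF indep]) (use that D in \<open>auto simp: sets_history split: bool.split\<close>)
    then show ?thesis by (simp add: UNIV_bool ac_simps)
  qed
  have "(\<integral>\<^sup>+\<omega>. ennreal (X k \<omega>) * indicator D \<omega> \<partial>M) = (\<integral>\<^sup>+\<omega>. ennreal (X k \<omega>) \<partial>M) * emeasure M D"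
    using k DM by (intro nn_integral_mult_indicator_indep ind) (auto simp: source_def)
  then show ?thesis using k by (simp add: nn_integral_X)
qed

lemma history_sources:
  assumes k: "1 \<le> k"
  shows "sets (sigma_counting M N) \<subseteq> sets (history k)" "sets (sigma_rv M \<Theta>) \<subseteq> sets (history k)"
    and X_measurable_history: "\<And>j. 1 \<le> j \<Longrightarrow> j < k \<Longrightarrow> X j \<in> borel_measurable (history k)"
proof -
  have 0: "A \<inter> C \<in> sets (history k)" if "A \<in> sets (sigma_counting M N)" "C \<in> sets (sigma_rv M \<Theta>)" for A C
    using that k unfolding sets_history by (intro sigma_sets.Basic UN_I[of 0]) (auto simp: source_def)
  show "sets (sigma_counting M N) \<subseteq> sets (history k)"
  proof
    fix A assume A: "A \<in> sets (sigma_counting M N)"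
    then have "A \<inter> space M = A" using sets.sets_into_space[OF A] by auto
    with 0[OF A, of "space M"] show "A \<in> sets (history k)"
      using sets.top[of "sigma_rv M \<Theta>"] by simp
  qed
  show "sets (sigma_rv M \<Theta>) \<subseteq> sets (history k)"
  proof
    fix C assume C: "C \<in> sets (sigma_rv M \<Theta>)"
    then have "space M \<inter> C = C" using sets.sets_into_space[OF C] by auto
    with 0[OF _ C, of "space M"] show "C \<in> sets (history k)"
      using sets.top[of "sigma_counting M N"] by simp
  qed
  fix j assume j: "1 \<le> j" "j < k"
  show "X j \<in> borel_measurable (history k)"
  proof (rule measurableI)
    fix B :: "real set" assume "B \<in> sets borel"
    then show "X j -` B \<inter> space (history k) \<in> sets (history k)"
      using j by (simp add: sets_history, intro sigma_sets.Basic UN_I[of j]) (auto simp: source_def)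
  qed auto
qed

lemma N_measurable_history: "1 \<le> k \<Longrightarrow> 0 \<le> t \<Longrightarrow> N t \<in> measurable (history k) (count_space UNIV)"
  using measurable_sets_mono[OF N_measurable_sigma_counting history_sources(1)] by simp

text \<open>Before the \<open>k\<close>-th claim, the filtration sees only \<open>\<Theta>\<close>, \<open>N\<close> and the first \<open>k - 1\<close> sizes.\<close>

lemma enlarged_filtration_Int_history:
  assumes k: "1 \<le> k" and s: "0 \<le> s" and E: "E \<in> sets (F s)"
  shows "E \<inter> {\<omega> \<in> space M. N s \<omega> < k} \<in> sets (history k)"
proof -
  let ?Q = "{\<omega> \<in> space M. N s \<omega> < k}"
  have [measurable]: "N t \<in> measurable (history k) (count_space UNIV)" if "0 \<le> t" for t
    using k that by (rule N_measurable_history)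
  have Q: "?Q \<in> sets (history k)"
    using s measurable_sets[of "N s" "history k" "count_space UNIV" "{..<k}"]
    by (auto simp: vimage_def Int_def conj_commute)
  have nat: "A \<inter> ?Q \<in> sets (history k)" if A: "A \<in> sets (natural_filtration M S s)" for A
  proof (rule sigma_sets_Int_closed[OF _ Q])
    show "A \<in> sigma_sets (space (history k)) (\<Union>u\<in>{0..s}. {S u -` B \<inter> space M | B. B \<in> sets borel})"
      using A by (simp add: natural_filtration_def sets_sigma_process)
    fix A' assume "A' \<in> (\<Union>u\<in>{0..s}. {S u -` B \<inter> space M | B. B \<in> sets borel})"
    then obtain u B where u: "0 \<le> u" "u \<le> s" and B[measurable]: "B \<in> sets borel" and A': "A' = S u -` B \<inter> space M"
      by auto
    \<comment> \<open>Where \<open>N s < k\<close>, at most \<open>k - 1\<close> sizes occur in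
      \<open>S u\<close>, so this fixed-length sum agrees with it and is measurable for the
      history.\<close>
    define S' where "S' \<omega> = (\<Sum>j\<in>{1..<k}. if j \<le> N u \<omega> then X j \<omega> else 0)" for \<omega>
    have [measurable]: "N u \<in> measurable (history k) (count_space UNIV)"
      using k u by (intro N_measurable_history)
    have "{\<omega> \<in> space (history k). j \<le> N u \<omega>} \<in> sets (history k)" for j
      by measurable
    then have [measurable]: "S' \<in> borel_measurable (history k)"
      unfolding S'_def using X_measurable_history[OF k] u by (intro borel_measurable_sum measurable_If) auto
    have "S' \<omega> = S u \<omega>" if "\<omega> \<in> ?Q" for \<omega>
    proof -
      have "{1..N u \<omega>} = {j\<in>{1..<k}. j \<le> N u \<omega>}" using that N_mono[of \<omega> u s] u by auto
      then show ?thesis unfolding S'_def aggregate_def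
        by (simp only:) (rule sum.inter_filter[symmetric], simp)
    qed
    then have "A' \<inter> ?Q = (S' -` B \<inter> space (history k)) \<inter> ?Q" by (auto simp: A')
    then show "A' \<inter> ?Q \<in> sets (history k)"
      using Q by (simp only:) (intro sets.Int measurable_sets[of S' _ borel], auto)
  qed
  show ?thesis
  proof (rule sigma_sets_Int_closed[OF _ Q])
    show "E \<in> sigma_sets (space (history k)) (sets (natural_filtration M S s) \<union> sets (sigma_rv M \<Theta>))"
      using E by (simp add: sets_enlarged_filtration)
  qed (use nat Q history_sources(2)[OF k] in auto)
qed

lemma aggregate_measurable: "0 \<le> t \<Longrightarrow> S t \<in> borel_measurable (natural_filtration M S t)"
  unfolding natural_filtration_def by (rule measurable_sigma_process) auto

lemma aggregate_measurable_M [measurable]: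
  assumes "0 \<le> t"
  shows "S t \<in> borel_measurable M"
proof -
  have [measurable]: "N t \<in> measurable M (count_space UNIV)" using assms by simp
  have "(\<lambda>\<omega>. \<Sum>k=1..n. X k \<omega>) \<in> borel_measurable M" for n
    by (intro borel_measurable_sum) auto
  then show ?thesis unfolding aggregate_def[abs_def]
    by (intro measurable_compose_countable[where f="\<lambda>n \<omega>. \<Sum>k=1..n. X k \<omega>" and g="N t"]) auto
qed

lemma sets_enlarged_filtration_M: "0 \<le> t \<Longrightarrow> sets (F t) \<subseteq> sets M"
proof -
  assume "0 \<le> t"
  have "sets (natural_filtration M S t) \<subseteq> sets M"
    unfolding natural_filtration_def by (intro sets_sigma_process_subset) auto
  then show ?thesis unfolding sets_enlarged_filtration
    using sets_sigma_\<Theta> by (intro sets.sigma_sets_subset) auto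
qed

text \<open>Claim \<open>k + 1\<close> falls between \<open>s\<close> and \<open>t\<close> exactly
  when \<open>N s < k + 1 \<le> N t\<close>. Together with \<open>E\<close> this is an event of
  \<open>history (k + 1)\<close>, since the history knows the future of \<open>N\<close>; so each
  such size is independent of its event and contributes a factor \<open>\<mu>\<close>. Both sides
  may be infinite.\<close>

lemma nn_integral_aggregate_increment:
  assumes st: "0 \<le> s" "s \<le> t" and E: "E \<in> sets (F s)"
  shows "(\<integral>\<^sup>+\<omega>\<in>E. ennreal (S t \<omega> - S s \<omega>) \<partial>M) = ennreal \<mu> * (\<integral>\<^sup>+\<omega>\<in>E. ennreal (real (N t \<omega>) - real (N s \<omega>)) \<partial>M)"
proof -
  define D where "D k = E \<inter> {\<omega> \<in> space M. N s \<omega> < Suc k} \<inter> {\<omega> \<in> space M. Suc k \<le> N t \<omega>}" for k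
  have D_history: "D k \<in> sets (history (Suc k))" for k
  proof -
    have "N t \<in> measurable (history (Suc k)) (count_space UNIV)" using st by (intro N_measurable_history) auto
    from measurable_sets[OF this, of "{Suc k..}"] show ?thesis
      unfolding D_def using st by (intro sets.Int enlarged_filtration_Int_history E)
        (auto simp: vimage_def Int_def conj_commute)
  qed
  then have [measurable]: "D k \<in> sets M" for k using sets_history_subset by auto
  \<comment> \<open>Used twice: the sizes as \<open>f\<close> give the increment of
    \<open>S\<close>, the constant \<open>1\<close> gives that of \<open>N\<close>.\<close>
  have pointwise: "(\<Sum>k. ennreal (f (Suc k)) * indicator (D k) \<omega>) = ennreal (\<Sum>k=N s \<omega> + 1..N t \<omega>. f k) * indicator E \<omega>"
    if \<omega>: "\<omega> \<in> space M" and f: "\<And>k. 1 \<le> k \<Longrightarrow> 0 \<le> f k" for f :: "nat \<Rightarrow> real" and \<omega>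
  proof -
    have "(\<Sum>k. ennreal (f (Suc k)) * indicator (D k) \<omega>) = (\<Sum>k\<in>{N s \<omega>..<N t \<omega>}. ennreal (f (Suc k)) * indicator (D k) \<omega>)"
      by (rule suminf_finite) (auto simp: D_def indicator_def)
    also have "\<dots> = (\<Sum>k\<in>{N s \<omega>..<N t \<omega>}. ennreal (f (Suc k))) * indicator E \<omega>"
      unfolding sum_distrib_right using \<omega> by (intro sum.cong) (auto simp: D_def indicator_def)
    also have "(\<Sum>k\<in>{N s \<omega>..<N t \<omega>}. ennreal (f (Suc k))) = ennreal (\<Sum>k\<in>{N s \<omega>..<N t \<omega>}. f (Suc k))"
      using f by (intro sum_ennreal) auto
    also have "(\<Sum>k\<in>{N s \<omega>..<N t \<omega>}. f (Suc k)) = (\<Sum>k=N s \<omega> + 1..N t \<omega>. f k)"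
      by (rule sum.reindex_bij_witness[where i="\<lambda>k. k - 1" and j=Suc]) auto
    finally show ?thesis .
  qed
  have "(\<integral>\<^sup>+\<omega>\<in>E. ennreal (S t \<omega> - S s \<omega>) \<partial>M) = (\<integral>\<^sup>+\<omega>. (\<Sum>k. ennreal (X (Suc k) \<omega>) * indicator (D k) \<omega>) \<partial>M)"
  proof (rule nn_integral_cong)
    fix \<omega> assume \<omega>: "\<omega> \<in> space M"
    have "S t \<omega> - S s \<omega> = (\<Sum>k=N s \<omega> + 1..N t \<omega>. X k \<omega>)"
    proof -
      have "{1..N t \<omega>} = {1..N s \<omega>} \<union> {N s \<omega> + 1..N t \<omega>}" using N_mono[OF \<omega> st] by auto
      then show ?thesis unfolding aggregate_def by (simp add: sum.union_disjoint)
    qed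
    then show "ennreal (S t \<omega> - S s \<omega>) * indicator E \<omega> = (\<Sum>k. ennreal (X (Suc k) \<omega>) * indicator (D k) \<omega>)"
      using \<omega> X_pos[of _ \<omega>] by (subst pointwise) (auto intro: less_imp_le)
  qed
  also have "\<dots> = (\<Sum>k. ennreal \<mu> * emeasure M (D k))"
    by (subst nn_integral_suminf) (auto simp: nn_integral_X_history[OF _ D_history])
  also have "\<dots> = ennreal \<mu> * (\<integral>\<^sup>+\<omega>. (\<Sum>k. ennreal 1 * indicator (D k) \<omega>) \<partial>M)"
    by (subst nn_integral_suminf) auto
  also have "(\<integral>\<^sup>+\<omega>. (\<Sum>k. ennreal 1 * indicator (D k) \<omega>) \<partial>M) = (\<integral>\<^sup>+\<omega>\<in>E. ennreal (real (N t \<omega>) - real (N s \<omega>)) \<partial>M)"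
    using N_mono[OF _ st] by (intro nn_integral_cong, subst pointwise) (auto simp: of_nat_diff)
  finally show ?thesis .
qed

section \<open>Recovering the counting process from the aggregate process\<close>

lemma aggregate_less_iff:
  assumes \<omega>: "\<omega> \<in> space M" and rs: "0 \<le> r" "r \<le> u"
  shows "S r \<omega> < S u \<omega> \<longleftrightarrow> N r \<omega> < N u \<omega>"
proof (cases "N r \<omega> = N u \<omega>")
  case False
  then have lt: "N r \<omega> < N u \<omega>" using N_mono[OF \<omega> rs] by simp
  have "(\<Sum>k=1..N r \<omega>. X k \<omega>) < (\<Sum>k=1..N u \<omega>. X k \<omega>)"
    using lt X_pos[OF _ \<omega>]
    by (intro sum_strict_mono2[where b="N u \<omega>"]) (auto intro: less_imp_le)
  then show ?thesis using lt by (simp add: aggregate_def)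
qed (simp add: aggregate_def)

text \<open>\<open>N\<close> is recovered from \<open>S\<close>: as the sizes are positive, \<open>S\<close> increases exactly when \<open>N\<close> does.\<close>

lemma N_ge_natural_filtration:
  assumes "0 \<le> u"
  shows "{\<omega> \<in> space M. n \<le> N u \<omega>} \<in> sets (natural_filtration M S u)"
  using assms
proof (induction n arbitrary: u)
  case 0
  then show ?case using sets.top[of "natural_filtration M S u"] by simp
next
  case (Suc n)
  show ?case
  proof (cases "u = 0")
    case True
    then have "{\<omega> \<in> space M. Suc n \<le> N u \<omega>} = {}" using counting by (auto simp: counting_process_def)
    then show ?thesis by (simp only: sets.empty_sets)
  next
    case False
    then have u: "0 < u" using Suc.prems by simp
    \<comment> \<open>Rational fractions of \<open>u\<close> keep the union countable and the times
      \<open>u * q\<close> within \<open>[0, u]\<close>.\<close>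
    define Q where "Q = \<rat> \<inter> {0..1::real}"
    have r: "0 \<le> u * q" "u * q \<le> u" if "q \<in> Q" for q
      using that u by (auto simp: Q_def mult_le_cancel_left1)
    \<comment> \<open>Level \<open>n + 1\<close> is reached by \<open>u\<close> exactly when level
      \<open>n\<close> was reached by some \<open>u * q\<close> after which \<open>S\<close> still
      grew. The witness lies between arrivals \<open>n\<close> and \<open>n + 1\<close>.\<close>
    have "{\<omega> \<in> space M. Suc n \<le> N u \<omega>} =
      (\<Union>q\<in>Q. {\<omega> \<in> space M. n \<le> N (u * q) \<omega>} \<inter> {\<omega> \<in> space M. S (u * q) \<omega> < S u \<omega>})" (is "?L = ?R")
    proof (intro equalityI subsetI)
      fix \<omega> assume "\<omega> \<in> ?L"
      then have \<omega>: "\<omega> \<in> space M" "Suc n \<le> N u \<omega>" by auto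
      let ?T = "\<lambda>n. arrival N n \<omega>"
      have T: "0 \<le> ?T n" "?T n < ?T (Suc n)" "?T (Suc n) \<le> u"
        using arrival_nonneg[OF counting \<omega>(1)] arrival_less_Suc[OF counting \<omega>(1)]
          arrival_le_iff[OF counting \<omega>(1)] \<omega>(2) u by auto
      then have "?T n / u < ?T (Suc n) / u" using u by (simp add: divide_strict_right_mono)
      then obtain q where q: "q \<in> \<rat>" "?T n / u < q" "q < ?T (Suc n) / u"
        using Rats_dense_in_real by blast
      have "0 \<le> ?T n / u" "?T (Suc n) / u \<le> 1" using T u by auto
      then have qQ: "q \<in> Q" using q by (auto simp: Q_def)
      have "?T n \<le> u * q" "\<not> ?T (Suc n) \<le> u * q"
        using q(2,3) u by (auto simp: field_simps)
      then have "n \<le> N (u * q) \<omega>" "\<not> Suc n \<le> N (u * q) \<omega>"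
        using arrival_le_iff[OF counting \<omega>(1) r(1)[OF qQ]] by auto
      then show "\<omega> \<in> ?R"
        using qQ \<omega> aggregate_less_iff[OF \<omega>(1) r[OF qQ]] by (intro UN_I[of q]) auto
    next
      fix \<omega> assume "\<omega> \<in> ?R"
      then show "\<omega> \<in> ?L" using aggregate_less_iff r by fastforce
    qed
    also have "\<dots> \<in> sets (natural_filtration M S u)"
    proof (intro sets.countable_UN'' sets.Int)
      show "countable Q" unfolding Q_def using countable_rat by (rule countable_subset[rotated]) auto
      fix q assume q: "q \<in> Q"
      show "{\<omega> \<in> space M. n \<le> N (u * q) \<omega>} \<in> sets (natural_filtration M S u)"
        using Suc.IH[OF r(1)[OF q]] sets_natural_filtration_mono[OF r(2)[OF q]] by blast
      have [measurable]: "S (u * q) \<in> borel_measurable (natural_filtration M S u)" "S u \<in> borel_measurable (natural_filtration M S u)"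
        unfolding natural_filtration_def using r[OF q] u by (auto intro!: measurable_sigma_process)
      have "{\<omega> \<in> space (natural_filtration M S u). S (u * q) \<omega> < S u \<omega>} \<in> sets (natural_filtration M S u)"
        by measurable
      then show "{\<omega> \<in> space M. S (u * q) \<omega> < S u \<omega>} \<in> sets (natural_filtration M S u)" by simp
    qed
    finally show ?thesis .
  qed
qed

lemma N_adapted:
  assumes "0 \<le> u"
  shows "N u \<in> measurable (natural_filtration M S u) (count_space UNIV)"
proof (subst measurable_count_space_eq2_countable, intro conjI ballI)
  fix n
  have "N u -` {n} \<inter> space (natural_filtration M S u) = {\<omega> \<in> space M. n \<le> N u \<omega>} - {\<omega> \<in> space M. Suc n \<le> N u \<omega>}"
    by auto
  then show "N u -` {n} \<inter> space (natural_filtration M S u) \<in> sets (natural_filtration M S u)"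
    using N_ge_natural_filtration[OF assms] by auto
qed auto

end

subsection \<open>From the martingale property to the mixed Poisson property\<close>

context risk_setting
begin

lemma \<Theta>_measurable_F: "\<Theta> \<in> borel_measurable (F t)"
  by (rule measurable_sets_mono[OF measurable_sigma_rv sigma_rv_subset_enlarged]) simp

lemma aggregate_measurable_F: "0 \<le> t \<Longrightarrow> S t \<in> borel_measurable (F t)"
  by (rule measurable_sets_mono[OF aggregate_measurable natural_subset_enlarged]) auto

lemma aggregate_mono: "\<omega> \<in> space M \<Longrightarrow> 0 \<le> s \<Longrightarrow> s \<le> t \<Longrightarrow> S s \<omega> \<le> S t \<omega>"
  using aggregate_less_iff[of \<omega> s t] N_mono[of \<omega> s t] by (cases "N s \<omega> = N t \<omega>") (auto simp: aggregate_def)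

lemma aggregate_0: "\<omega> \<in> space M \<Longrightarrow> S 0 \<omega> = 0"
  using counting by (simp add: aggregate_def counting_process_def)

lemma N_0: "\<omega> \<in> space M \<Longrightarrow> N 0 \<omega> = 0"
  using counting by (simp add: counting_process_def)

lemma martingale_imp_mixed_poisson:
  assumes mart: "martingale M F (\<lambda>t \<omega>. S t \<omega> - t * \<Theta> \<omega> * \<mu>)"
  shows "mixed_poisson M N \<Theta>"
proof -
  have int_S: "integrable M (S t)" if "0 \<le> t" for t
  proof -
    have "integrable M (\<lambda>\<omega>. (S t \<omega> - t * \<Theta> \<omega> * \<mu>) + t * \<Theta> \<omega> * \<mu>)"
      using mart that \<Theta>_integrable unfolding martingale_def
      by (intro Bochner_Integration.integrable_add) auto
    then show ?thesis by simp
  qed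
  have int_E: "integrable M (\<lambda>\<omega>. indicat_real E \<omega> * f \<omega>)" if "E \<in> sets M" "integrable M f" for E and f :: "'a \<Rightarrow> real"
    using integrable_mult_indicator[OF that] by simp
  have diff: "(\<integral>\<omega>\<in>E. (S t \<omega> - S s \<omega>) \<partial>M) = \<mu> * (\<integral>\<omega>\<in>E. ((t - s) * \<Theta> \<omega>) \<partial>M)"
    if st: "0 \<le> s" "s \<le> t" and E: "E \<in> sets (F s)" for s t E
  proof -
    have EM: "E \<in> sets M" using sets_enlarged_filtration_M[OF st(1)] E by auto
    have Z: "(\<integral>\<omega>\<in>E. (S s \<omega> - s * \<Theta> \<omega> * \<mu>) \<partial>M) = (\<integral>\<omega>\<in>E. (S t \<omega> - t * \<Theta> \<omega> * \<mu>) \<partial>M)"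
      using mart st E by (auto simp: martingale_def)
    have Z_eq: "(\<integral>\<omega>\<in>E. (S u \<omega> - u * \<Theta> \<omega> * \<mu>) \<partial>M) = (\<integral>\<omega>\<in>E. S u \<omega> \<partial>M) - u * \<mu> * (\<integral>\<omega>\<in>E. \<Theta> \<omega> \<partial>M)"
      if "0 \<le> u" for u
    proof -
      have "(\<integral>\<omega>\<in>E. (S u \<omega> - u * \<Theta> \<omega> * \<mu>) \<partial>M) = (\<integral>\<omega>. indicat_real E \<omega> * S u \<omega> - u * \<mu> * (indicat_real E \<omega> * \<Theta> \<omega>) \<partial>M)"
        unfolding set_lebesgue_integral_def by (intro Bochner_Integration.integral_cong) (auto simp: algebra_simps)
      also have "\<dots> = (\<integral>\<omega>. indicat_real E \<omega> * S u \<omega> \<partial>M) - (\<integral>\<omega>. u * \<mu> * (indicat_real E \<omega> * \<Theta> \<omega>) \<partial>M)"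
        by (intro Bochner_Integration.integral_diff integrable_mult_right int_E EM int_S that \<Theta>_integrable)
      finally show ?thesis by (simp add: set_lebesgue_integral_def)
    qed
    have S_diff: "(\<integral>\<omega>\<in>E. (S t \<omega> - S s \<omega>) \<partial>M) = (\<integral>\<omega>\<in>E. S t \<omega> \<partial>M) - (\<integral>\<omega>\<in>E. S s \<omega> \<partial>M)"
      using EM int_S st by (intro set_integral_diff) (auto simp: set_integrable_def intro: int_E)
    have "(\<integral>\<omega>\<in>E. ((t - s) * \<Theta> \<omega>) \<partial>M) = (t - s) * (\<integral>\<omega>\<in>E. \<Theta> \<omega> \<partial>M)" by simp
    then show ?thesis
      using Z unfolding Z_eq[OF st(1)] Z_eq[OF order_trans[OF st]] S_diff by (simp only:) (simp add: algebra_simps)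
  qed
  have N_incr: "ennreal \<mu> * (\<integral>\<^sup>+\<omega>\<in>E. ennreal (real (N t \<omega>) - real (N s \<omega>)) \<partial>M) = ennreal (\<mu> * (\<integral>\<omega>\<in>E. ((t - s) * \<Theta> \<omega>) \<partial>M))"
    if st: "0 \<le> s" "s \<le> t" and E: "E \<in> sets (F s)" for s t E
  proof -
    have [measurable]: "E \<in> sets M" using sets_enlarged_filtration_M[OF st(1)] E by auto
    have "(\<integral>\<^sup>+\<omega>\<in>E. ennreal (S t \<omega> - S s \<omega>) \<partial>M) = (\<integral>\<^sup>+\<omega>. ennreal (indicat_real E \<omega> * (S t \<omega> - S s \<omega>)) \<partial>M)"
      by (intro nn_integral_cong) (auto split: split_indicator)
    also have "\<dots> = ennreal (\<integral>\<omega>. indicat_real E \<omega> * (S t \<omega> - S s \<omega>) \<partial>M)"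
      using st aggregate_mono by (intro nn_integral_eq_integral int_E Bochner_Integration.integrable_diff int_S) auto
    also have "\<dots> = ennreal (\<mu> * (\<integral>\<omega>\<in>E. ((t - s) * \<Theta> \<omega>) \<partial>M))"
      using diff[OF st E] by (simp add: set_lebesgue_integral_def)
    finally show ?thesis using nn_integral_aggregate_increment[OF st E] by simp
  qed
  \<comment> \<open>Wald's identity on the whole space from time \<open>0\<close> has a finite right
    side, and \<open>\<mu> > 0\<close> transfers finiteness to the mean of
    \<open>N t\<close>.\<close>
  have int_N: "integrable M (\<lambda>\<omega>. real (N t \<omega>))" if t: "0 \<le> t" for t
  proof (rule integrableI_nonneg)
    show "(\<lambda>\<omega>. real (N t \<omega>)) \<in> borel_measurable M"
      by (rule measurable_compose[OF N_measurable[OF t]]) simp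
    have "ennreal \<mu> * (\<integral>\<^sup>+\<omega>. ennreal (real (N t \<omega>)) \<partial>M) = ennreal \<mu> * (\<integral>\<^sup>+\<omega>\<in>space M. ennreal (real (N t \<omega>) - real (N 0 \<omega>)) \<partial>M)"
      by (intro arg_cong2[where f="(*)"] nn_integral_cong refl) (simp add: N_0)
    also have "\<dots> < \<infinity>"
      using sets.top[of "F 0"] by (subst N_incr[OF order_refl t]) auto
    finally show "(\<integral>\<^sup>+\<omega>. ennreal (real (N t \<omega>)) \<partial>M) < \<infinity>"
      using \<mu>_pos by (auto simp: ennreal_mult_less_top)
  qed simp
  \<comment> \<open>The rate of the locale is nonnegative everywhere while \<Theta> is positive only
    almost surely; taking the positive part changes no integral.\<close>
  interpret poisson_martingale M N F "\<lambda>\<omega>. max 0 (\<Theta> \<omega>)"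
  proof
    fix s t :: real and E assume st: "0 \<le> s" "s \<le> t" and E: "E \<in> sets (F s)"
    have [measurable]: "E \<in> sets M" using sets_enlarged_filtration_M[OF st(1)] E by auto
    have [measurable]: "N s \<in> measurable M (count_space UNIV)" "N t \<in> measurable M (count_space UNIV)" using st by auto
    have int: "integrable M (\<lambda>\<omega>. indicat_real E \<omega> * (real (N t \<omega>) - real (N s \<omega>)))"
      using st by (intro int_E Bochner_Integration.integrable_diff int_N) auto
    have "ennreal \<mu> * ennreal (\<integral>\<omega>\<in>E. (real (N t \<omega>) - real (N s \<omega>)) \<partial>M) =
      ennreal \<mu> * (\<integral>\<^sup>+\<omega>. ennreal (indicat_real E \<omega> * (real (N t \<omega>) - real (N s \<omega>))) \<partial>M)"
      using N_mono[OF _ st] by (subst nn_integral_eq_integral[OF int]) (auto simp: set_lebesgue_integral_def)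
    also have "\<dots> = ennreal \<mu> * (\<integral>\<^sup>+\<omega>\<in>E. ennreal (real (N t \<omega>) - real (N s \<omega>)) \<partial>M)"
      by (intro arg_cong2[where f="(*)"] nn_integral_cong refl) (auto split: split_indicator)
    also note N_incr[OF st E]
    also have "\<mu> * (\<integral>\<omega>\<in>E. ((t - s) * \<Theta> \<omega>) \<partial>M) = \<mu> * (\<integral>\<omega>\<in>E. ((t - s) * max 0 (\<Theta> \<omega>)) \<partial>M)"
      unfolding set_lebesgue_integral_def using \<Theta>_pos
      by (intro arg_cong2[where f="(*)"] integral_cong_AE refl) (auto elim!: eventually_mono)
    finally have "ennreal (\<mu> * (\<integral>\<omega>\<in>E. (real (N t \<omega>) - real (N s \<omega>)) \<partial>M)) = ennreal (\<mu> * (\<integral>\<omega>\<in>E. ((t - s) * max 0 (\<Theta> \<omega>)) \<partial>M))"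
      using \<mu>_pos by (simp add: ennreal_mult')
    \<comment> \<open>\<open>ennreal\<close> truncates negative numbers, so it can be removed only
      between nonnegative ones.\<close>
    moreover have "0 \<le> (\<integral>\<omega>\<in>E. (real (N t \<omega>) - real (N s \<omega>)) \<partial>M)" "0 \<le> (\<integral>\<omega>\<in>E. ((t - s) * max 0 (\<Theta> \<omega>)) \<partial>M)"
      unfolding set_lebesgue_integral_def using N_mono[OF _ st] st by (auto intro!: integral_nonneg_AE)
    ultimately show "(\<integral>\<omega>\<in>E. (real (N t \<omega>) - real (N s \<omega>)) \<partial>M) = (\<integral>\<omega>\<in>E. ((t - s) * max 0 (\<Theta> \<omega>)) \<partial>M)"
      using \<mu>_pos by (subst (asm) ennreal_inj) auto
  next
    fix t :: real assume t: "0 \<le> t"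
    show "Conditional_Expectation.subalgebra M (F t)"
      unfolding subalgebra_def using sets_enlarged_filtration_M[OF t] by simp
    show "N t \<in> measurable (F t) (count_space UNIV)"
      by (rule measurable_sets_mono[OF N_adapted[OF t] natural_subset_enlarged]) simp
  next
    show "(\<lambda>\<omega>. max 0 (\<Theta> \<omega>)) \<in> borel_measurable (F 0)"
      using \<Theta>_measurable_F[of 0] by measurable
  next
    fix s t :: real assume "s \<le> t"
    then show "sets (F s) \<subseteq> sets (F t)" by (rule sets_enlarged_filtration_mono)
  qed (use counting int_N \<Theta>_integrable in auto)
  show ?thesis
    by (rule mixed_poisson[OF \<Theta>_measurable sigma_rv_subset_enlarged \<Theta>_pos refl])
qed

end

subsection \<open>From the mixed Poisson property to the martingale property\<close>

lemma (in prob_space) nn_integral_mult_cprob: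
  assumes F: "subalgebra M F" and [measurable]: "E \<in> sets M" and Y: "Y \<in> borel_measurable F"
  shows "(\<integral>\<^sup>+\<omega>. Y \<omega> * indicator E \<omega> \<partial>M) = (\<integral>\<^sup>+\<omega>. Y \<omega> * ennreal (cprob M F E \<omega>) \<partial>M)"
proof (rule nn_integral_mult_subalgebra_eq[OF F _ _ _ Y])
  interpret finite_measure_subalgebra M F by unfold_locales (rule F)
  show [measurable]: "(\<lambda>\<omega>. ennreal (cprob M F E \<omega>)) \<in> borel_measurable M" unfolding cprob_def by simp
  fix C assume C: "C \<in> sets F"
  then have [measurable]: "C \<in> sets M" using F by (auto simp: subalgebra_def)
  have int: "integrable M (indicat_real E)" by (auto intro!: integrable_const_bound[of _ 1])
  have pos: "AE \<omega> in M. 0 \<le> cprob M F E \<omega>"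
    unfolding cprob_def by (rule real_cond_exp_pos) auto
  have "(\<integral>\<^sup>+\<omega>\<in>C. indicator E \<omega> \<partial>M) = ennreal (\<integral>\<omega>\<in>C. indicat_real E \<omega> \<partial>M)"
    by (simp add: set_lebesgue_integral_def indicator_inter_arith[symmetric] emeasure_eq_measure Int_commute)
  also have "\<dots> = ennreal (\<integral>\<omega>\<in>C. cprob M F E \<omega> \<partial>M)"
    unfolding cprob_def using C int by (subst real_cond_exp_intA) auto
  also have "\<dots> = (\<integral>\<^sup>+\<omega>. ennreal (indicator C \<omega> * cprob M F E \<omega>) \<partial>M)"
  proof -
    have "integrable M (\<lambda>\<omega>. indicator C \<omega> * cprob M F E \<omega>)"
      using integrable_mult_indicator[OF \<open>C \<in> sets M\<close> real_cond_exp_int(1)[OF int]] by (simp add: cprob_def)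
    then show ?thesis unfolding set_lebesgue_integral_def using pos
      by (subst nn_integral_eq_integral) (auto split: split_indicator)
  qed
  also have "\<dots> = (\<integral>\<^sup>+\<omega>\<in>C. ennreal (cprob M F E \<omega>) \<partial>M)"
    by (intro nn_integral_cong) (auto split: split_indicator)
  finally show "(\<integral>\<^sup>+\<omega>\<in>C. indicator E \<omega> \<partial>M) = (\<integral>\<^sup>+\<omega>\<in>C. ennreal (cprob M F E \<omega>) \<partial>M)" .
qed auto

lemma (in prob_space) cprob_self:
  assumes F: "subalgebra M F" and E: "E \<in> sets F"
  shows "AE \<omega> in M. cprob M F E \<omega> = indicator E \<omega>"
proof -
  interpret finite_measure_subalgebra M F by unfold_locales (rule F)
  have [measurable]: "E \<in> sets M" using F E by (auto simp: subalgebra_def)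
  show ?thesis unfolding cprob_def using E
    by (intro real_cond_exp_F_meas) (auto intro!: integrable_const_bound[of _ 1])
qed

text \<open>The mixed Poisson property speaks about probabilities of events; layers turn a mean into
  such probabilities.\<close>

lemma nn_integral_nat_layers:
  fixes D :: "'a \<Rightarrow> nat"
  assumes [measurable]: "D \<in> measurable M (count_space UNIV)" "Y \<in> borel_measurable M"
  shows "(\<integral>\<^sup>+\<omega>. Y \<omega> * of_nat (D \<omega>) \<partial>M) = (\<Sum>k. of_nat k * (\<integral>\<^sup>+\<omega>. Y \<omega> * indicator {\<omega> \<in> space M. D \<omega> = k} \<omega> \<partial>M))"
proof -
  have "(\<integral>\<^sup>+\<omega>. Y \<omega> * of_nat (D \<omega>) \<partial>M) = (\<integral>\<^sup>+\<omega>. (\<Sum>k. of_nat k * (Y \<omega> * indicator {\<omega> \<in> space M. D \<omega> = k} \<omega>)) \<partial>M)"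
  proof (rule nn_integral_cong)
    fix \<omega> assume \<omega>: "\<omega> \<in> space M"
    have "(\<Sum>k. of_nat k * (Y \<omega> * indicator {\<omega> \<in> space M. D \<omega> = k} \<omega>)) =
        (\<Sum>k\<in>{D \<omega>}. of_nat k * (Y \<omega> * indicator {\<omega> \<in> space M. D \<omega> = k} \<omega>))"
      by (rule suminf_finite) auto
    then show "Y \<omega> * of_nat (D \<omega>) = (\<Sum>k. of_nat k * (Y \<omega> * indicator {\<omega> \<in> space M. D \<omega> = k} \<omega>))"
      using \<omega> by (simp add: mult.commute)
  qed
  also have "\<dots> = (\<Sum>k. of_nat k * (\<integral>\<^sup>+\<omega>. Y \<omega> * indicator {\<omega> \<in> space M. D \<omega> = k} \<omega> \<partial>M))"
    by (subst nn_integral_suminf) (auto simp: nn_integral_cmult)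
  finally show ?thesis .
qed

lemma poisson_pmf_mean:
  assumes "0 < x"
  shows "(\<Sum>k. of_nat k * ennreal (pmf (poisson_pmf x) k)) = ennreal x"
proof -
  have "(\<lambda>k. x * exp (- x) * (x ^ k /\<^sub>R fact k)) sums (x * exp (- x) * exp x)"
    by (intro sums_mult exp_converges)
  then have "(\<lambda>k. x * exp (- x) * (x ^ k /\<^sub>R fact k)) sums x"
    by (simp only: mult.assoc exp_add[symmetric]) simp
  \<comment> \<open>Index shift: \<open>k * x^k / k!\<close> equals
    \<open>x * x^(k-1) / (k-1)!\<close>, and the term at \<open>k = 0\<close> vanishes.\<close>
  also have "(\<lambda>k. x * exp (- x) * (x ^ k /\<^sub>R fact k)) = (\<lambda>k. real (Suc k) * pmf (poisson_pmf x) (Suc k))"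
    using assms by (auto simp: fun_eq_iff field_simps simp del: of_nat_Suc)
  finally have "(\<lambda>k. real k * pmf (poisson_pmf x) k) sums x"
    by (subst (asm) sums_Suc_iff) simp
  then have "(\<Sum>k. ennreal (real k * pmf (poisson_pmf x) k)) = ennreal x"
    by (intro suminf_ennreal_eq) auto
  then show ?thesis by (simp add: ennreal_mult' ennreal_of_nat_eq_real_of_nat)
qed

section \<open>Conditional mean of an increment on finite-dimensional events of the past\<close>

context risk_setting
begin

text \<open>Since \<open>N\<close> has countably many values, prescribing exact values at finitely
  many times is enough to generate its past, and such an event translates directly into
  increments.\<close>

definition cylinder :: "real set \<Rightarrow> (real \<Rightarrow> nat) \<Rightarrow> 'a set" where
  "cylinder J \<kappa> = {\<omega> \<in> space M. \<forall>u\<in>J. N u \<omega> = \<kappa> u}"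

lemma cylinder_sets:
  assumes J: "finite J" "J \<subseteq> {0..s}"
  shows "cylinder J \<kappa> \<in> sets (sigma_counting M N)"
proof -
  have "{\<omega> \<in> space M. N u \<omega> = \<kappa> u} \<in> sets (sigma_counting M N)" if "u \<in> J" for u
    using measurable_sets[OF N_measurable_sigma_counting[of u], of "{\<kappa> u}"] that J
    by (auto simp: vimage_def Int_def conj_commute)
  then have "{\<omega> \<in> space (sigma_counting M N). \<forall>u\<in>J. N u \<omega> = \<kappa> u} \<in> sets (sigma_counting M N)"
    using J by (intro sets.sets_Collect_finite_All) auto
  then show ?thesis by (simp add: cylinder_def)
qed

context
  assumes mixed: "mixed_poisson M N \<Theta>"
begin

lemma nn_integral_N:
  assumes t: "0 \<le> t" and Y: "Y \<in> borel_measurable (sigma_rv M \<Theta>)"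
  shows "(\<integral>\<^sup>+\<omega>. Y \<omega> * of_nat (N t \<omega>) \<partial>M) = (\<integral>\<^sup>+\<omega>. Y \<omega> * ennreal (t * \<Theta> \<omega>) \<partial>M)"
proof (cases "t = 0")
  case True
  then have "(\<integral>\<^sup>+\<omega>. Y \<omega> * of_nat (N t \<omega>) \<partial>M) = (\<integral>\<^sup>+\<omega>. 0 \<partial>M)"
    by (intro nn_integral_cong) (simp add: N_0)
  then show ?thesis using True by simp
next
  case False
  let ?F = "sigma_rv M \<Theta>"
  note F = subalgebra_sigma_rv[OF \<Theta>_measurable]
  have [measurable]: "Y \<in> borel_measurable M" by (rule measurable_from_subalg[OF F Y])
  have [measurable]: "N t \<in> measurable M (count_space UNIV)" using t by simp
  have t: "0 < t" using False t by simp
  have AE: "AE \<omega> in M. \<forall>k. cprob M ?F {\<omega> \<in> space M. N t \<omega> = k} \<omega> = pmf (poisson_pmf (t * \<Theta> \<omega>)) k"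
  proof (subst AE_all_countable, intro allI)
    fix k
    have "AE \<omega> in M. cprob M ?F {\<omega> \<in> space M. N t \<omega> \<in> {k}} \<omega> = measure_pmf.prob (poisson_pmf (t * \<Theta> \<omega>)) {k}"
      using mixed t unfolding mixed_poisson_def by blast
    then show "AE \<omega> in M. cprob M ?F {\<omega> \<in> space M. N t \<omega> = k} \<omega> = pmf (poisson_pmf (t * \<Theta> \<omega>)) k"
      by (simp add: pmf.rep_eq)
  qed
  have [measurable]: "cprob M ?F E \<in> borel_measurable M" for E by (simp add: cprob_def)
  have "(\<integral>\<^sup>+\<omega>. Y \<omega> * of_nat (N t \<omega>) \<partial>M) = (\<Sum>k. of_nat k * (\<integral>\<^sup>+\<omega>. Y \<omega> * ennreal (cprob M ?F {\<omega> \<in> space M. N t \<omega> = k} \<omega>) \<partial>M))"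
    by (subst nn_integral_nat_layers) (auto simp: nn_integral_mult_cprob[OF F _ Y])
  also have "\<dots> = (\<integral>\<^sup>+\<omega>. (\<Sum>k. of_nat k * (Y \<omega> * ennreal (cprob M ?F {\<omega> \<in> space M. N t \<omega> = k} \<omega>))) \<partial>M)"
    by (subst nn_integral_suminf) (auto simp: nn_integral_cmult)
  also have "\<dots> = (\<integral>\<^sup>+\<omega>. Y \<omega> * ennreal (t * \<Theta> \<omega>) \<partial>M)"
  proof (rule nn_integral_cong_AE)
    from AE \<Theta>_pos
    show "AE \<omega> in M. (\<Sum>k. of_nat k * (Y \<omega> * ennreal (cprob M ?F {\<omega> \<in> space M. N t \<omega> = k} \<omega>))) = Y \<omega> * ennreal (t * \<Theta> \<omega>)"
    proof eventually_elim
      case (elim \<omega>)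
      have "(\<Sum>k. of_nat k * (Y \<omega> * ennreal (cprob M ?F {\<omega> \<in> space M. N t \<omega> = k} \<omega>))) =
        (\<Sum>k. Y \<omega> * (of_nat k * ennreal (pmf (poisson_pmf (t * \<Theta> \<omega>)) k)))"
        using elim(1) by (simp add: mult.left_commute)
      then show ?case using poisson_pmf_mean[of "t * \<Theta> \<omega>"] elim(2) t by simp
    qed
  qed
  finally show ?thesis .
qed

text \<open>The means at times \<open>t\<close> and \<open>s\<close> are subtracted. Cancellation in
  \<open>ennreal\<close> requires the term at \<open>s\<close> to be finite, which
  \<open>Y \<le> 1\<close> and integrability of \<Theta> ensure.\<close>

lemma nn_integral_N_diff:
  assumes st: "0 \<le> s" "s \<le> t" and Y: "Y \<in> borel_measurable (sigma_rv M \<Theta>)" and Y1: "\<And>\<omega>. Y \<omega> \<le> 1"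
  shows "(\<integral>\<^sup>+\<omega>. Y \<omega> * of_nat (N t \<omega> - N s \<omega>) \<partial>M) = (\<integral>\<^sup>+\<omega>. Y \<omega> * ennreal ((t - s) * \<Theta> \<omega>) \<partial>M)"
proof -
  have [measurable]: "Y \<in> borel_measurable M"
    by (rule measurable_from_subalg[OF subalgebra_sigma_rv[OF \<Theta>_measurable] Y])
  have [measurable]: "N t \<in> measurable M (count_space UNIV)" "N s \<in> measurable M (count_space UNIV)" using st by auto
  have "(\<integral>\<^sup>+\<omega>. Y \<omega> * of_nat (N t \<omega> - N s \<omega>) \<partial>M) + (\<integral>\<^sup>+\<omega>. Y \<omega> * of_nat (N s \<omega>) \<partial>M) =
    (\<integral>\<^sup>+\<omega>. Y \<omega> * of_nat (N t \<omega> - N s \<omega>) + Y \<omega> * of_nat (N s \<omega>) \<partial>M)"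
    by (rule nn_integral_add[symmetric]) auto
  also have "\<dots> = (\<integral>\<^sup>+\<omega>. Y \<omega> * of_nat (N t \<omega>) \<partial>M)"
    using N_mono[OF _ st] by (intro nn_integral_cong) (simp flip: distrib_left of_nat_add)
  also have "\<dots> = (\<integral>\<^sup>+\<omega>. Y \<omega> * ennreal (t * \<Theta> \<omega>) \<partial>M)"
    using st Y by (intro nn_integral_N) auto
  also have "\<dots> = (\<integral>\<^sup>+\<omega>. Y \<omega> * ennreal ((t - s) * \<Theta> \<omega>) + Y \<omega> * ennreal (s * \<Theta> \<omega>) \<partial>M)"
    using \<Theta>_pos st
    by (intro nn_integral_cong_AE, elim eventually_mono)
      (simp flip: distrib_left ennreal_plus, simp add: algebra_simps)
  also have "\<dots> = (\<integral>\<^sup>+\<omega>. Y \<omega> * ennreal ((t - s) * \<Theta> \<omega>) \<partial>M) + (\<integral>\<^sup>+\<omega>. Y \<omega> * ennreal (s * \<Theta> \<omega>) \<partial>M)"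
    by (rule nn_integral_add) auto
  also have "(\<integral>\<^sup>+\<omega>. Y \<omega> * ennreal (s * \<Theta> \<omega>) \<partial>M) = (\<integral>\<^sup>+\<omega>. Y \<omega> * of_nat (N s \<omega>) \<partial>M)"
    using st Y by (intro nn_integral_N[symmetric]) auto
  finally have eq: "(\<integral>\<^sup>+\<omega>. Y \<omega> * of_nat (N t \<omega> - N s \<omega>) \<partial>M) + (\<integral>\<^sup>+\<omega>. Y \<omega> * of_nat (N s \<omega>) \<partial>M) =
    (\<integral>\<^sup>+\<omega>. Y \<omega> * ennreal ((t - s) * \<Theta> \<omega>) \<partial>M) + (\<integral>\<^sup>+\<omega>. Y \<omega> * of_nat (N s \<omega>) \<partial>M)" .
  have "(\<integral>\<^sup>+\<omega>. Y \<omega> * of_nat (N s \<omega>) \<partial>M) = (\<integral>\<^sup>+\<omega>. Y \<omega> * ennreal (s * \<Theta> \<omega>) \<partial>M)"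
    using st Y by (intro nn_integral_N) auto
  also have "\<dots> \<le> (\<integral>\<^sup>+\<omega>. 1 * ennreal (norm (s * \<Theta> \<omega>)) \<partial>M)"
    using Y1 by (intro nn_integral_mono mult_mono) (auto intro: ennreal_leI)
  also have "\<dots> < \<infinity>"
    using integrable_mult_right[OF \<Theta>_integrable, of s] by (simp only: integrable_iff_bounded mult_1_left)
  finally show ?thesis using eq by (auto simp: add.commute ennreal_add_left_cancel)
qed

text \<open>As \<open>0\<close> and \<open>s\<close> are among the prescribed times and
  \<open>N 0 = 0\<close>, fixing the values is the same as fixing the increments up to
  \<open>s\<close>. Conditional independence then applies on the grid extended by
  \<open>t\<close>.\<close>

lemma cprob_cylinder_increment:
  assumes st: "0 \<le> s" "s < t" and J: "finite J" "{0, s} \<subseteq> J" "J \<subseteq> {0..s}"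
  shows "AE \<omega> in M. cprob M (sigma_rv M \<Theta>) (cylinder J \<kappa> \<inter> {\<omega> \<in> space M. N t \<omega> - N s \<omega> = k}) \<omega> =
    cprob M (sigma_rv M \<Theta>) (cylinder J \<kappa>) \<omega> * cprob M (sigma_rv M \<Theta>) {\<omega> \<in> space M. N t \<omega> - N s \<omega> = k} \<omega>"
proof (cases "\<kappa> 0 = 0")
  case False
  then have "cylinder J \<kappa> = {}" using J by (auto simp: cylinder_def N_0 intro!: bexI[of _ 0])
  then show ?thesis
    using cprob_self[OF subalgebra_sigma_rv[OF \<Theta>_measurable] sets.empty_sets]
    by (auto elim!: eventually_mono)
next
  case True
  let ?F = "sigma_rv M \<Theta>"
  let ?D = "{\<omega> \<in> space M. N t \<omega> - N s \<omega> = k}"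
  define l where "l = sorted_list_of_set J"
  have l: "set l = J" "sorted_wrt (<) l" using J by (auto simp: l_def)
  define m where "m = length l - 1"
  have len: "length l = Suc m" using J l(1) unfolding m_def by (cases l) auto
  \<comment> \<open>The sorted times of \<open>J\<close>, ending with \<open>\<tau> m = s\<close>,
    followed by \<open>t\<close> as the time with index \<open>m + 1\<close>.\<close>
  define \<tau> where "\<tau> i = (if i \<le> m then l ! i else t)" for i
  have \<tau>_J: "J = \<tau> ` {..m}"
    using l(1) len by (auto simp: \<tau>_def set_conv_nth less_Suc_eq_le image_iff)
  have \<tau>_less: "\<tau> i < \<tau> j" if "i < j" "j \<le> m" for i j
    using that sorted_wrt_nth_less[OF l(2), of i j] len by (simp add: \<tau>_def)
  have \<tau>_le: "\<tau> i \<le> \<tau> j" if "i \<le> j" "j \<le> m" for i j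
    using that \<tau>_less[of i j] by (cases "i = j") auto
  have \<tau>_0: "\<tau> 0 = 0"
  proof -
    obtain i where "i \<le> m" "\<tau> i = 0" using J(2) \<tau>_J by (auto simp: image_iff)
    moreover have "0 \<le> \<tau> 0" using J(3) \<tau>_J by auto
    ultimately show ?thesis using \<tau>_le[of 0 i] by simp
  qed
  have \<tau>_m: "\<tau> m = s"
  proof -
    obtain i where "i \<le> m" "\<tau> i = s" using J(2) \<tau>_J by (auto simp: image_iff)
    moreover have "\<tau> m \<le> s" using J(3) \<tau>_J by auto
    ultimately show ?thesis using \<tau>_le[of i m] by simp
  qed
  have grid: "time_grid (Suc m) \<tau>"
    unfolding time_grid_def
  proof (intro conjI allI impI \<tau>_0)
    fix i assume "i < Suc m"
    then show "\<tau> i < \<tau> (Suc i)"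
      using \<tau>_less[of i "Suc i"] \<tau>_m st by (cases "i = m") (auto simp: \<tau>_def)
  qed
  define B where "B j = (if j = Suc m then {int k} else {int (\<kappa> (\<tau> j)) - int (\<kappa> (\<tau> (j - 1)))})" for j
  define E where "E j = increment N \<tau> 0 j -` B j \<inter> space M" for j
  have cond: "AE \<omega> in M. cprob M ?F (\<Inter>j\<in>K. E j) \<omega> = (\<Prod>j\<in>K. cprob M ?F (E j) \<omega>)"
    if "K \<subseteq> {1..Suc m}" "K \<noteq> {}" for K
  proof -
    have "cond_indep_vars M ?F (count_space UNIV) (increment N \<tau> 0) {1..Suc m}"
      using mixed grid unfolding mixed_poisson_def cond_indep_increments_def by blast
    moreover have "finite K" using that by (auto intro: finite_subset)
    moreover have "\<forall>j\<in>K. E j \<in> {increment N \<tau> 0 j -` B \<inter> space M | B. B \<in> sets (count_space UNIV)}"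
      by (auto simp: E_def)
    ultimately show ?thesis using that unfolding cond_indep_vars_def cond_indep_sets_def by blast
  qed
  have E_D: "E (Suc m) = ?D"
  proof -
    have "increment N \<tau> 0 (Suc m) \<omega> = int (N t \<omega> - N s \<omega>)" if "\<omega> \<in> space M" for \<omega>
      using increment_eq_int_diff[OF counting that grid order_refl, of "Suc m"] \<tau>_m by (simp add: \<tau>_def)
    then show ?thesis by (auto simp: E_def B_def)
  qed
  have cyl: "\<omega> \<in> cylinder J \<kappa> \<longleftrightarrow> (\<forall>j\<in>{1..m}. \<omega> \<in> E j)" if \<omega>: "\<omega> \<in> space M" for \<omega>
  proof
    assume "\<omega> \<in> cylinder J \<kappa>"
    then have "N (\<tau> i) \<omega> = \<kappa> (\<tau> i)" if "i \<le> m" for i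
      using that \<tau>_J by (auto simp: cylinder_def)
    then show "\<forall>j\<in>{1..m}. \<omega> \<in> E j" using \<omega> by (auto simp: E_def B_def increment_def)
  next
    assume E: "\<forall>j\<in>{1..m}. \<omega> \<in> E j"
    have "N (\<tau> i) \<omega> = \<kappa> (\<tau> i)" if "i \<le> m" for i
      using that
    proof (induction i)
      case 0
      then show ?case using \<omega> True by (simp add: \<tau>_0 N_0)
    next
      case (Suc i)
      then have "\<omega> \<in> E (Suc i)" using E by auto
      with Suc show ?case by (auto simp: E_def B_def increment_def)
    qed
    then show "\<omega> \<in> cylinder J \<kappa>" using \<omega> \<tau>_J by (auto simp: cylinder_def)
  qed
  show ?thesis
  proof (cases "m = 0")
    \<comment> \<open>Here \<open>J = {0}\<close> and \<open>s = 0\<close>: the cylinder is the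
      whole space, corresponding to an empty index set, which the definition of conditional
      independence excludes.\<close>
    case True
    then have "cylinder J \<kappa> = space M" using cyl by (auto simp: cylinder_def)
    moreover have "AE \<omega> in M. cprob M ?F (space M) \<omega> = 1"
      using cprob_self[OF subalgebra_sigma_rv[OF \<Theta>_measurable] sets.top] AE_space[of M]
      by eventually_elim simp
    moreover have "space M \<inter> ?D = ?D" by auto
    ultimately show ?thesis by (auto elim!: eventually_mono)
  next
    case False
    have 1: "cylinder J \<kappa> = (\<Inter>j\<in>{1..m}. E j)"
    proof (intro equalityI subsetI)
      fix \<omega> assume "\<omega> \<in> cylinder J \<kappa>"
      then show "\<omega> \<in> (\<Inter>j\<in>{1..m}. E j)" using cyl[of \<omega>] by (auto simp: cylinder_def)
    next
      fix \<omega> assume \<omega>: "\<omega> \<in> (\<Inter>j\<in>{1..m}. E j)"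
      then have "\<omega> \<in> E 1" using False by auto
      then show "\<omega> \<in> cylinder J \<kappa>" using cyl[of \<omega>] \<omega> by (auto simp: E_def)
    qed
    have 2: "{1..Suc m} = insert (Suc m) {1..m}" by auto
    have "(\<Inter>j\<in>{1..Suc m}. E j) = cylinder J \<kappa> \<inter> ?D"
      unfolding 2 1 E_D[symmetric] by (simp add: Int_commute)
    with cond[of "{1..Suc m}"]
    have "AE \<omega> in M. cprob M ?F (cylinder J \<kappa> \<inter> ?D) \<omega> = (\<Prod>j=1..Suc m. cprob M ?F (E j) \<omega>)" by simp
    moreover have "AE \<omega> in M. cprob M ?F (cylinder J \<kappa>) \<omega> = (\<Prod>j=1..m. cprob M ?F (E j) \<omega>)"
      using cond[of "{1..m}"] False by (simp add: 1)
    ultimately show ?thesis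
      by eventually_elim (simp add: E_D)
  qed
qed

text \<open>On each layer of the increment, conditional independence replaces the indicator of the
  cylinder by its conditional probability. The weight is then a function of \<Theta>, the mean of
  the increment can be inserted, and the indicator is put back.\<close>

lemma nn_integral_cylinder_increment:
  assumes st: "0 \<le> s" "s < t" and J: "finite J" "{0, s} \<subseteq> J" "J \<subseteq> {0..s}" and C: "C \<in> sets (sigma_rv M \<Theta>)"
  shows "(\<integral>\<^sup>+\<omega>\<in>cylinder J \<kappa> \<inter> C. of_nat (N t \<omega> - N s \<omega>) \<partial>M) = (\<integral>\<^sup>+\<omega>\<in>cylinder J \<kappa> \<inter> C. ennreal ((t - s) * \<Theta> \<omega>) \<partial>M)"
proof -
  let ?F = "sigma_rv M \<Theta>"
  have [measurable]: "\<Theta> \<in> borel_measurable ?F" by (rule measurable_sigma_rv)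
  let ?A = "cylinder J \<kappa>"
  let ?D = "\<lambda>k. {\<omega> \<in> space M. N t \<omega> - N s \<omega> = k}"
  note F = subalgebra_sigma_rv[OF \<Theta>_measurable]
  have [measurable]: "N t \<in> measurable M (count_space UNIV)" "N s \<in> measurable M (count_space UNIV)" using st by auto
  have [measurable]: "C \<in> sets M" "?A \<in> sets M" "C \<in> sets ?F"
    using C sets_sigma_\<Theta> cylinder_sets[OF J(1,3)] sets_sigma_counting_M by auto
  \<comment> \<open>The conditional probability lies in \<open>[0, 1]\<close> only almost
    everywhere; clamping gives the pointwise bound demanded by
    \<open>nn_integral_N_diff\<close>.\<close>
  define h where "h \<omega> = max 0 (min 1 (cprob M ?F ?A \<omega>))" for \<omega>
  have [measurable]: "cprob M ?F ?A \<in> borel_measurable ?F" "cprob M ?F E \<in> borel_measurable M" for E by (simp_all add: cprob_def)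
  have hF[measurable]: "h \<in> borel_measurable ?F" unfolding h_def[abs_def] by measurable
  have [measurable]: "h \<in> borel_measurable M" by (rule measurable_from_subalg[OF F hF])
  have h_AE: "AE \<omega> in M. cprob M ?F ?A \<omega> = h \<omega>"
  proof -
    interpret finite_measure_subalgebra M ?F by unfold_locales (rule F)
    have "AE \<omega> in M. real_cond_exp M ?F (indicat_real ?A) \<omega> \<ge> 0"
      by (rule real_cond_exp_pos) auto
    moreover have "AE \<omega> in M. real_cond_exp M ?F (indicat_real ?A) \<omega> \<le> 1"
      by (rule real_cond_exp_le_c) (auto intro!: integrable_const_bound[of _ 1] split: split_indicator)
    ultimately show ?thesis by eventually_elim (simp add: h_def cprob_def)
  qed
  have layer: "(\<integral>\<^sup>+\<omega>. (indicator C \<omega> * indicator ?A \<omega>) * indicator (?D k) \<omega> \<partial>M) = (\<integral>\<^sup>+\<omega>. (indicator C \<omega> * ennreal (h \<omega>)) * indicator (?D k) \<omega> \<partial>M)" for k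
  proof -
    have [measurable]: "?D k \<in> sets M" by measurable
    have "(\<integral>\<^sup>+\<omega>. (indicator C \<omega> * indicator ?A \<omega>) * indicator (?D k) \<omega> \<partial>M) = (\<integral>\<^sup>+\<omega>. indicator C \<omega> * indicator (?A \<inter> ?D k) \<omega> \<partial>M)"
      by (simp add: indicator_inter_arith mult.assoc)
    also have "\<dots> = (\<integral>\<^sup>+\<omega>. indicator C \<omega> * ennreal (cprob M ?F (?A \<inter> ?D k) \<omega>) \<partial>M)"
      by (intro nn_integral_mult_cprob F) auto
    also have "\<dots> = (\<integral>\<^sup>+\<omega>. (indicator C \<omega> * ennreal (h \<omega>)) * ennreal (cprob M ?F (?D k) \<omega>) \<partial>M)"
      using h_AE cprob_cylinder_increment[OF st J, of \<kappa> k]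
      by (intro nn_integral_cong_AE, eventually_elim) (simp add: ennreal_mult' h_def mult.assoc)
    also have "\<dots> = (\<integral>\<^sup>+\<omega>. (indicator C \<omega> * ennreal (h \<omega>)) * indicator (?D k) \<omega> \<partial>M)"
      by (intro nn_integral_mult_cprob[symmetric] F) auto
    finally show ?thesis .
  qed
  have "(\<integral>\<^sup>+\<omega>\<in>?A \<inter> C. of_nat (N t \<omega> - N s \<omega>) \<partial>M) = (\<integral>\<^sup>+\<omega>. (indicator C \<omega> * indicator ?A \<omega>) * of_nat (N t \<omega> - N s \<omega>) \<partial>M)"
    by (simp add: indicator_inter_arith ac_simps)
  also have "\<dots> = (\<integral>\<^sup>+\<omega>. (indicator C \<omega> * ennreal (h \<omega>)) * of_nat (N t \<omega> - N s \<omega>) \<partial>M)"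
    by (subst (1 2) nn_integral_nat_layers) (simp_all add: layer)
  also have "\<dots> = (\<integral>\<^sup>+\<omega>. (indicator C \<omega> * ennreal (h \<omega>)) * ennreal ((t - s) * \<Theta> \<omega>) \<partial>M)"
    using st by (intro nn_integral_N_diff) (auto simp: h_def min_def max_def split: split_indicator)
  also have "\<dots> = (\<integral>\<^sup>+\<omega>. (indicator C \<omega> * ennreal ((t - s) * \<Theta> \<omega>)) * ennreal (cprob M ?F ?A \<omega>) \<partial>M)"
    using h_AE by (intro nn_integral_cong_AE, elim eventually_mono) (simp add: ac_simps)
  also have "\<dots> = (\<integral>\<^sup>+\<omega>. (indicator C \<omega> * ennreal ((t - s) * \<Theta> \<omega>)) * indicator ?A \<omega> \<partial>M)"
    by (intro nn_integral_mult_cprob[symmetric] F) auto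
  also have "\<dots> = (\<integral>\<^sup>+\<omega>\<in>?A \<inter> C. ennreal ((t - s) * \<Theta> \<omega>) \<partial>M)"
    by (simp add: indicator_inter_arith ac_simps)
  finally show ?thesis .
qed

end

end

section \<open>From cylinders to all events of the filtration\<close>

context risk_setting
begin

text \<open>Independence of \<open>X\<close> from the pair \<open>(N, \<Theta>)\<close> in
  integrated form, since \<open>history 1\<close> is generated by that pair.\<close>

lemma nn_integral_history_X:
  assumes Y: "Y \<in> borel_measurable (history 1)" and B: "B \<in> sets (sigma_seq M X)"
  shows "(\<integral>\<^sup>+\<omega>. ennreal (Y \<omega>) * indicator B \<omega> \<partial>M) = (\<integral>\<^sup>+\<omega>. ennreal (Y \<omega>) \<partial>M) * emeasure M B"
proof (rule nn_integral_mult_indicator_indep)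
  have "indep_set (source 0) (sets (sigma_seq M X))"
  proof (rule indep_setI)
    show "prob (a \<inter> b) = prob a * prob b" if "a \<in> source 0" "b \<in> sets (sigma_seq M X)" for a b
      using that prob_counting_\<Theta>_X by (auto simp: source_def)
  qed (use source_subset sets_sigma_seq_X in auto)
  then have "indep_set (sigma_sets (space M) (source 0)) (sigma_sets (space M) (sets (sigma_seq M X)))"
    by (rule indep_set_sigma_sets[OF _ Int_stable_source sets.Int_stable])
  moreover have "sigma_sets (space M) (source 0) = sets (history 1)" by (simp add: sets_history lessThan_Suc)
  moreover have "sigma_sets (space M) (sets (sigma_seq M X)) = sets (sigma_seq M X)"
    using sets.sigma_sets_eq[of "sigma_seq M X"] by (simp add: sigma_seq_def)
  ultimately have indep: "indep_set (sets (history 1)) (sets (sigma_seq M X))" by simp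
  show "prob (Y -` U \<inter> space M \<inter> B) = prob (Y -` U \<inter> space M) * prob B" if "U \<in> sets borel" for U
    using measurable_sets[OF Y that] by (intro indep_setD[OF indep _ B]) simp
  show "Y \<in> borel_measurable M" by (rule measurable_sets_mono[OF Y sets_history_subset]) simp
  show "B \<in> sets M" using B sets_sigma_seq_X by auto
qed

text \<open>\<open>B\<close> ranges over events of the whole sequence of sizes, because the number
  of sizes seen by time \<open>s\<close> is random. The generated sigma-algebra is larger than the
  filtration, but the extra information is independent of \<open>(N, \<Theta>)\<close>. The times
  \<open>0\<close> and \<open>s\<close> are forced into \<open>J\<close> to meet the conditions of
  \<open>cprob_cylinder_increment\<close>.\<close>

definition rectangles :: "real \<Rightarrow> 'a set set" where
  "rectangles s = {cylinder J \<kappa> \<inter> C \<inter> B | J \<kappa> C B. finite J \<and> {0, s} \<subseteq> J \<and> J \<subseteq> {0..s} \<and>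
     C \<in> sets (sigma_rv M \<Theta>) \<and> B \<in> sets (sigma_seq M X)}"

lemma rectanglesI:
  "finite J \<Longrightarrow> {0, s} \<subseteq> J \<Longrightarrow> J \<subseteq> {0..s} \<Longrightarrow> C \<in> sets (sigma_rv M \<Theta>) \<Longrightarrow> B \<in> sets (sigma_seq M X) \<Longrightarrow>
    cylinder J \<kappa> \<inter> C \<inter> B \<in> rectangles s"
  unfolding rectangles_def by blast

lemma rectanglesE:
  assumes "a \<in> rectangles s"
  obtains J \<kappa> C B where "a = cylinder J \<kappa> \<inter> C \<inter> B" "finite J" "{0, s} \<subseteq> J" "J \<subseteq> {0..s}"
    "C \<in> sets (sigma_rv M \<Theta>)" "B \<in> sets (sigma_seq M X)"
  using assms unfolding rectangles_def by blast

lemma rectangles_subset: "rectangles s \<subseteq> sets M"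
proof
  fix a assume "a \<in> rectangles s"
  then obtain J \<kappa> C B where a: "a = cylinder J \<kappa> \<inter> C \<inter> B" and J: "finite J" "J \<subseteq> {0..s}"
    and "C \<in> sets (sigma_rv M \<Theta>)" "B \<in> sets (sigma_seq M X)"
    by (rule rectanglesE)
  then have "C \<in> sets M" "B \<in> sets M" "cylinder J \<kappa> \<in> sets M"
    using cylinder_sets[OF J] sets_sigma_counting_M sets_sigma_\<Theta> sets_sigma_seq_X by auto
  then show "a \<in> sets M" unfolding a by (intro sets.Int)
qed

lemma space_sigma_seq [simp]: "space (sigma_seq M Z) = space M"
  by (simp add: sigma_seq_def)

lemma cylinder_in_rectangles:
  assumes "finite J" "{0, s} \<subseteq> J" "J \<subseteq> {0..s}"
  shows "cylinder J \<kappa> \<in> rectangles s"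
proof -
  have "cylinder J \<kappa> \<inter> space M \<inter> space M = cylinder J \<kappa>" by (auto simp: cylinder_def)
  with rectanglesI[OF assms, of "space M" "space M" \<kappa>] show ?thesis
    using sets.top[of "sigma_rv M \<Theta>"] sets.top[of "sigma_seq M X"] by simp
qed

lemma Int_stable_rectangles:
  assumes s: "0 \<le> s"
  shows "Int_stable (rectangles s)"
proof (rule Int_stableI)
  fix a b assume ab: "a \<in> rectangles s" "b \<in> rectangles s"
  from ab(1) obtain J \<kappa> C B where
    a: "a = cylinder J \<kappa> \<inter> C \<inter> B" "finite J" "{0, s} \<subseteq> J" "J \<subseteq> {0..s}" "C \<in> sets (sigma_rv M \<Theta>)" "B \<in> sets (sigma_seq M X)"
    by (rule rectanglesE)
  from ab(2) obtain J' \<kappa>' C' B' where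
    b: "b = cylinder J' \<kappa>' \<inter> C' \<inter> B'" "finite J'" "{0, s} \<subseteq> J'" "J' \<subseteq> {0..s}" "C' \<in> sets (sigma_rv M \<Theta>)" "B' \<in> sets (sigma_seq M X)"
    by (rule rectanglesE)
  show "a \<inter> b \<in> rectangles s"
  proof (cases "\<forall>u\<in>J \<inter> J'. \<kappa> u = \<kappa>' u")
    case True
    define \<rho> where "\<rho> u = (if u \<in> J then \<kappa> u else \<kappa>' u)" for u
    have "\<rho> u = \<kappa> u" if "u \<in> J" for u using that by (simp add: \<rho>_def)
    moreover have "\<rho> u = \<kappa>' u" if "u \<in> J'" for u using that True by (simp add: \<rho>_def)
    ultimately have "cylinder J \<kappa> \<inter> cylinder J' \<kappa>' = cylinder (J \<union> J') \<rho>"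
      unfolding cylinder_def by auto
    then have "a \<inter> b = cylinder (J \<union> J') \<rho> \<inter> (C \<inter> C') \<inter> (B \<inter> B')"
      unfolding a(1) b(1) by blast
    also have "\<dots> \<in> rectangles s"
      using a(2-4) b(2-4) by (intro rectanglesI sets.Int a(5,6) b(5,6)) auto
    finally show ?thesis .
  next
    case False
    then obtain u where "u \<in> J" "u \<in> J'" "\<kappa> u \<noteq> \<kappa>' u" by blast
    then have "cylinder J \<kappa> \<inter> cylinder J' \<kappa>' = {}" unfolding cylinder_def by force
    then have "a \<inter> b = {}" unfolding a(1) b(1) by blast
    \<comment> \<open>Prescribing \<open>N 0 = 1\<close> is contradictory, which makes the empty set
      a cylinder.\<close>
    also have "{} = cylinder {0, s} (\<lambda>_. 1)" by (auto simp: cylinder_def N_0)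
    also have "\<dots> \<in> rectangles s" using s by (intro cylinder_in_rectangles) auto
    finally show ?thesis .
  qed
qed

lemma sets_enlarged_filtration_rectangles:
  assumes s: "0 \<le> s"
  shows "sets (F s) \<subseteq> sigma_sets (space M) (rectangles s)"
proof -
  let ?R = "sigma (space M) (rectangles s)"
  have Pow: "rectangles s \<subseteq> Pow (space M)" using rectangles_subset sets.sets_into_space by blast
  have sets_R: "sets ?R = sigma_sets (space M) (rectangles s)" and [simp]: "space ?R = space M"
    using Pow by (auto intro: sets_measure_of space_measure_of)
  have N_meas: "N u \<in> measurable ?R (count_space UNIV)" if u: "0 \<le> u" "u \<le> s" for u
  proof (subst measurable_count_space_eq2_countable, intro conjI ballI)
    fix n :: nat
    \<comment> \<open>A cylinder must also fix the values at \<open>0\<close> and \<open>s\<close>;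
      the value at \<open>s\<close> is exhausted by the union over \<open>i\<close>. Testing
      \<open>v = u\<close> first covers coincidences of \<open>u\<close> with \<open>0\<close> or
      \<open>s\<close>.\<close>
    define \<kappa> where "\<kappa> i v = (if v = u then n else if v = s then i else 0)" for i v
    have "N u -` {n} \<inter> space ?R = (\<Union>i. cylinder {0, u, s} (\<kappa> i))"
    proof (intro equalityI subsetI)
      fix \<omega> assume "\<omega> \<in> N u -` {n} \<inter> space ?R"
      then have "\<omega> \<in> cylinder {0, u, s} (\<kappa> (N s \<omega>))" by (auto simp: cylinder_def \<kappa>_def N_0)
      then show "\<omega> \<in> (\<Union>i. cylinder {0, u, s} (\<kappa> i))" by blast
    qed (auto simp: cylinder_def \<kappa>_def)
    also have "\<dots> \<in> sets ?R"
      unfolding sets_R using u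
      by (intro sigma_sets.Union sigma_sets.Basic cylinder_in_rectangles) auto
    finally show "N u -` {n} \<inter> space ?R \<in> sets ?R" .
  qed auto
  have Union_cyl: "(\<Union>i. cylinder {0, s} (\<lambda>v. if v = 0 then 0 else i)) = space M"
    by (auto simp: cylinder_def N_0)
  have rect: "C \<inter> B \<in> sets ?R" if "C \<in> sets (sigma_rv M \<Theta>)" "B \<in> sets (sigma_seq M X)" for C B
  proof -
    have "C \<inter> B = (\<Union>i. cylinder {0, s} (\<lambda>v. if v = 0 then 0 else i)) \<inter> C \<inter> B"
      unfolding Union_cyl using sets.sets_into_space[OF that(1)] by auto
    also have "\<dots> = (\<Union>i. cylinder {0, s} (\<lambda>v. if v = 0 then 0 else i) \<inter> C \<inter> B)" by auto
    also have "\<dots> \<in> sets ?R"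
      unfolding sets_R using s that by (intro sigma_sets.Union sigma_sets.Basic rectanglesI) auto
    finally show ?thesis .
  qed
  have \<Theta>_sub: "sets (sigma_rv M \<Theta>) \<subseteq> sets ?R"
  proof
    fix C assume C: "C \<in> sets (sigma_rv M \<Theta>)"
    have "C \<inter> space M = C" using sets.sets_into_space[OF C] by auto
    then show "C \<in> sets ?R" using rect[OF C, of "space M"] sets.top[of "sigma_seq M X"] by simp
  qed
  have X_sub: "sets (sigma_seq M X) \<subseteq> sets ?R"
  proof
    fix B assume B: "B \<in> sets (sigma_seq M X)"
    have "space M \<inter> B = B" using sets.sets_into_space[OF B] by auto
    then show "B \<in> sets ?R" using rect[OF _ B, of "space M"] sets.top[of "sigma_rv M \<Theta>"] by simp
  qed
  have X_meas: "X k \<in> borel_measurable ?R" if "1 \<le> k" for k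
    by (rule measurable_sets_mono[OF _ X_sub])
      (use that in \<open>auto simp: sigma_seq_def intro!: measurable_sigma_process\<close>)
  have S_meas: "S u \<in> borel_measurable ?R" if u: "0 \<le> u" "u \<le> s" for u
    unfolding aggregate_def[abs_def]
  proof (rule measurable_compose_countable[where f="\<lambda>n \<omega>. \<Sum>k=1..n. X k \<omega>" and g="N u"])
    show "(\<lambda>\<omega>. \<Sum>k=1..n. X k \<omega>) \<in> borel_measurable ?R" for n
      using X_meas by (intro borel_measurable_sum) auto
  qed (rule N_meas[OF u])
  have "sets (natural_filtration M S s) \<subseteq> sets ?R"
    unfolding natural_filtration_def using S_meas by (intro sets_sigma_process_subset) auto
  with \<Theta>_sub have "sets (natural_filtration M S s) \<union> sets (sigma_rv M \<Theta>) \<subseteq> sets ?R" by simp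
  from sets.sigma_sets_subset[OF this] show ?thesis
    by (simp add: sets_enlarged_filtration sets_R)
qed

context
  assumes mixed: "mixed_poisson M N \<Theta>"
begin

lemma nn_integral_N_increment_filtration:
  assumes st: "0 \<le> s" "s \<le> t" and E: "E \<in> sets (F s)"
  shows "(\<integral>\<^sup>+\<omega>\<in>E. of_nat (N t \<omega> - N s \<omega>) \<partial>M) = (\<integral>\<^sup>+\<omega>\<in>E. ennreal ((t - s) * \<Theta> \<omega>) \<partial>M)"
proof (cases "s = t")
  case False
  with st have lt: "s < t" by simp
  have [measurable]: "N t \<in> measurable M (count_space UNIV)" "N s \<in> measurable M (count_space UNIV)" using st by auto
  let ?f = "\<lambda>\<omega>. of_nat (N t \<omega> - N s \<omega>) :: ennreal"
  let ?g = "\<lambda>\<omega>. ennreal ((t - s) * \<Theta> \<omega>)"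
  have rect: "(\<integral>\<^sup>+\<omega>\<in>a. ?f \<omega> \<partial>M) = (\<integral>\<^sup>+\<omega>\<in>a. ?g \<omega> \<partial>M)" if "a \<in> rectangles s" for a
  proof -
    from that obtain J \<kappa> C B where a: "a = cylinder J \<kappa> \<inter> C \<inter> B" and J: "finite J" "{0, s} \<subseteq> J" "J \<subseteq> {0..s}"
      and C: "C \<in> sets (sigma_rv M \<Theta>)" and B: "B \<in> sets (sigma_seq M X)"
      by (rule rectanglesE)
    let ?H = "history 1"
    have [measurable]: "N t \<in> measurable ?H (count_space UNIV)" "N s \<in> measurable ?H (count_space UNIV)"
      using st by (auto intro: N_measurable_history)
    have [measurable]: "cylinder J \<kappa> \<in> sets ?H" "C \<in> sets ?H"
      using history_sources(1,2)[of 1] C cylinder_sets[OF J(1,3)] by auto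
    have [measurable]: "\<Theta> \<in> borel_measurable ?H"
      by (rule measurable_sets_mono[OF measurable_sigma_rv history_sources(2)]) auto
    have "(\<integral>\<^sup>+\<omega>\<in>a. ?f \<omega> \<partial>M) = (\<integral>\<^sup>+\<omega>. ennreal (indicator (cylinder J \<kappa> \<inter> C) \<omega> * real (N t \<omega> - N s \<omega>)) * indicator B \<omega> \<partial>M)"
      unfolding a by (intro nn_integral_cong) (auto simp: ennreal_of_nat_eq_real_of_nat split: split_indicator)
    also have "\<dots> = (\<integral>\<^sup>+\<omega>. ennreal (indicator (cylinder J \<kappa> \<inter> C) \<omega> * real (N t \<omega> - N s \<omega>)) \<partial>M) * emeasure M B"
      by (intro nn_integral_history_X B) measurable
    also have "(\<integral>\<^sup>+\<omega>. ennreal (indicator (cylinder J \<kappa> \<inter> C) \<omega> * real (N t \<omega> - N s \<omega>)) \<partial>M) = (\<integral>\<^sup>+\<omega>\<in>cylinder J \<kappa> \<inter> C. ?f \<omega> \<partial>M)"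
      by (intro nn_integral_cong) (auto simp: ennreal_of_nat_eq_real_of_nat split: split_indicator)
    also have "\<dots> = (\<integral>\<^sup>+\<omega>\<in>cylinder J \<kappa> \<inter> C. ?g \<omega> \<partial>M)"
      by (rule nn_integral_cylinder_increment[OF mixed st(1) lt J C])
    also have "\<dots> = (\<integral>\<^sup>+\<omega>. ennreal (indicator (cylinder J \<kappa> \<inter> C) \<omega> * ((t - s) * \<Theta> \<omega>)) \<partial>M)"
      by (intro nn_integral_cong) (auto split: split_indicator)
    also have "\<dots> * emeasure M B = (\<integral>\<^sup>+\<omega>. ennreal (indicator (cylinder J \<kappa> \<inter> C) \<omega> * ((t - s) * \<Theta> \<omega>)) * indicator B \<omega> \<partial>M)"
      by (intro nn_integral_history_X[symmetric] B) measurable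
    also have "\<dots> = (\<integral>\<^sup>+\<omega>\<in>a. ?g \<omega> \<partial>M)"
      unfolding a by (intro nn_integral_cong) (auto split: split_indicator)
    finally show ?thesis .
  qed
  let ?R = "sigma (space M) (rectangles s)"
  have Pow: "rectangles s \<subseteq> Pow (space M)" using rectangles_subset sets.sets_into_space by blast
  have sets_R: "sets ?R = sigma_sets (space M) (rectangles s)" and space_R: "space ?R = space M"
    using Pow by (auto intro: sets_measure_of space_measure_of)
  have R_M: "sets ?R \<subseteq> sets M" unfolding sets_R using rectangles_subset by (rule sets.sigma_sets_subset)
  have sub: "Conditional_Expectation.subalgebra (density M h) ?R" for h :: "'a \<Rightarrow> ennreal"
    using R_M space_R by (simp add: subalgebra_def)
  have em: "emeasure (restr_to_subalg (density M h) ?R) a = (\<integral>\<^sup>+\<omega>\<in>a. h \<omega> \<partial>M)"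
    if "a \<in> sets ?R" "h \<in> borel_measurable M" for a h
    using that R_M by (subst emeasure_restr_to_subalg[OF sub]) (auto simp: emeasure_density)
  \<comment> \<open>Both sides of the claim, as functions of the event, are measures on the
    generated sigma-algebra; they agree on an intersection-stable generator.\<close>
  have "restr_to_subalg (density M ?f) ?R = restr_to_subalg (density M ?g) ?R"
  proof (rule measure_eqI_generator_eq[OF Int_stable_rectangles[OF st(1)] Pow])
    show "sets (restr_to_subalg (density M ?f) ?R) = sigma_sets (space M) (rectangles s)"
      "sets (restr_to_subalg (density M ?g) ?R) = sigma_sets (space M) (rectangles s)"
      by (simp_all add: sets_restr_to_subalg[OF sub] sets_R)
    fix a assume "a \<in> rectangles s"
    then show "emeasure (restr_to_subalg (density M ?f) ?R) a = emeasure (restr_to_subalg (density M ?g) ?R) a"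
      by (subst (1 2) em) (auto simp: sets_R rect)
  next
    \<comment> \<open>A countable cover by the values of \<open>N s\<close>; the mass of each piece
      is finite because \<Theta> is integrable.\<close>
    let ?A = "\<lambda>i. cylinder {0, s} (\<lambda>v. if v = 0 then 0 else i)"
    show A: "range ?A \<subseteq> rectangles s" using st by (auto intro!: cylinder_in_rectangles)
    show "(\<Union>i. ?A i) = space M" by (auto simp: cylinder_def N_0)
    fix i
    have Ai: "?A i \<in> rectangles s" using A by auto
    have "emeasure (restr_to_subalg (density M ?f) ?R) (?A i) = (\<integral>\<^sup>+\<omega>\<in>?A i. ?g \<omega> \<partial>M)"
      using Ai by (subst em) (auto simp: sets_R rect)
    also have "\<dots> \<le> (\<integral>\<^sup>+\<omega>. ennreal (norm ((t - s) * \<Theta> \<omega>)) \<partial>M)"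
      by (intro nn_integral_mono) (auto intro: ennreal_leI split: split_indicator)
    also have "\<dots> < \<infinity>"
      using integrable_mult_right[OF \<Theta>_integrable, of "t - s"] by (simp only: integrable_iff_bounded)
    finally show "emeasure (restr_to_subalg (density M ?f) ?R) (?A i) \<noteq> \<infinity>" by simp
  qed
  moreover have "E \<in> sets ?R" using E sets_enlarged_filtration_rectangles[OF st(1)] by (auto simp: sets_R)
  ultimately show ?thesis using em[of E ?f] em[of E ?g] by simp
qed simp

lemma martingale_aggregate: "martingale M F (\<lambda>t \<omega>. S t \<omega> - t * \<Theta> \<omega> * \<mu>)"
proof -
  have incr: "(\<integral>\<^sup>+\<omega>\<in>E. ennreal (S t \<omega> - S s \<omega>) \<partial>M) = (\<integral>\<^sup>+\<omega>\<in>E. ennreal ((t - s) * \<mu> * \<Theta> \<omega>) \<partial>M)"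
    if st: "0 \<le> s" "s \<le> t" and E: "E \<in> sets (F s)" for s t E
  proof -
    have [measurable]: "E \<in> sets M" using sets_enlarged_filtration_M[OF st(1)] E by auto
    have "(\<integral>\<^sup>+\<omega>\<in>E. ennreal (S t \<omega> - S s \<omega>) \<partial>M) = ennreal \<mu> * (\<integral>\<^sup>+\<omega>\<in>E. of_nat (N t \<omega> - N s \<omega>) \<partial>M)"
      unfolding nn_integral_aggregate_increment[OF st E] using N_mono[OF _ st]
      by (intro arg_cong2[where f="(*)"] nn_integral_cong refl) (simp add: ennreal_of_nat_eq_real_of_nat of_nat_diff)
    also have "\<dots> = (\<integral>\<^sup>+\<omega>. ennreal \<mu> * (ennreal ((t - s) * \<Theta> \<omega>) * indicator E \<omega>) \<partial>M)"
      unfolding nn_integral_N_increment_filtration[OF st E] by (intro nn_integral_cmult[symmetric]) measurable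
    also have "\<dots> = (\<integral>\<^sup>+\<omega>\<in>E. ennreal ((t - s) * \<mu> * \<Theta> \<omega>) \<partial>M)"
      using \<mu>_pos by (intro nn_integral_cong) (simp add: ennreal_mult'[symmetric] ac_simps split: split_indicator)
    finally show ?thesis .
  qed
  \<comment> \<open>Integrability comes from the nonnegative identity with the whole space as event;
    \<open>S t\<close> itself is the increment from time \<open>0\<close>.\<close>
  have int_incr: "integrable M (\<lambda>\<omega>. S t \<omega> - S s \<omega>)" if st: "0 \<le> s" "s \<le> t" for s t
  proof (rule integrableI_nonneg)
    show "(\<lambda>\<omega>. S t \<omega> - S s \<omega>) \<in> borel_measurable M" using st by (intro borel_measurable_diff aggregate_measurable_M) auto
    show "AE \<omega> in M. 0 \<le> S t \<omega> - S s \<omega>" using aggregate_mono[OF _ st] by simp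
    have "(\<integral>\<^sup>+\<omega>. ennreal (S t \<omega> - S s \<omega>) \<partial>M) = (\<integral>\<^sup>+\<omega>\<in>space M. ennreal (S t \<omega> - S s \<omega>) \<partial>M)"
      by (intro nn_integral_cong) simp
    also have "\<dots> = (\<integral>\<^sup>+\<omega>\<in>space M. ennreal ((t - s) * \<mu> * \<Theta> \<omega>) \<partial>M)"
      using sets.top[of "F s"] by (intro incr st) simp
    also have "\<dots> \<le> (\<integral>\<^sup>+\<omega>. ennreal (norm ((t - s) * \<mu> * \<Theta> \<omega>)) \<partial>M)"
      by (intro nn_integral_mono) (auto intro: ennreal_leI)
    also have "\<dots> < \<infinity>"
      using integrable_mult_right[OF \<Theta>_integrable, of "(t - s) * \<mu>"] by (simp only: integrable_iff_bounded)
    finally show "(\<integral>\<^sup>+\<omega>. ennreal (S t \<omega> - S s \<omega>) \<partial>M) < \<infinity>" .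
  qed
  have int_Z: "integrable M (\<lambda>\<omega>. S t \<omega> - t * \<Theta> \<omega> * \<mu>)" if t: "0 \<le> t" for t
  proof -
    have "integrable M (S t)"
      using int_incr[OF order_refl t] by (rule Bochner_Integration.integrable_cong[THEN iffD1, rotated -1]) (simp_all add: aggregate_0)
    then show ?thesis using \<Theta>_integrable by simp
  qed
  show ?thesis unfolding martingale_def
  proof (intro conjI allI impI ballI int_Z)
    fix t :: real assume t: "0 \<le> t"
    show "(\<lambda>\<omega>. S t \<omega> - t * \<Theta> \<omega> * \<mu>) \<in> borel_measurable (F t)"
      using aggregate_measurable_F[OF t] \<Theta>_measurable_F[of t] by measurable
  next
    fix s t :: real and E assume st: "0 \<le> s" "s \<le> t" and E: "E \<in> sets (F s)"
    have [measurable]: "E \<in> sets M" using sets_enlarged_filtration_M[OF st(1)] E by auto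
    have int\<Theta>: "integrable M (\<lambda>\<omega>. (t - s) * \<mu> * \<Theta> \<omega>)" using \<Theta>_integrable by simp
    have intE: "integrable M (\<lambda>\<omega>. indicat_real E \<omega> * f \<omega>)" if "integrable M f" for f :: "'a \<Rightarrow> real"
      using integrable_mult_indicator[OF \<open>E \<in> sets M\<close> that] by simp
    have "ennreal (\<integral>\<omega>\<in>E. (S t \<omega> - S s \<omega>) \<partial>M) = (\<integral>\<^sup>+\<omega>. ennreal (indicat_real E \<omega> * (S t \<omega> - S s \<omega>)) \<partial>M)"
      using aggregate_mono[OF _ st] unfolding set_lebesgue_integral_def real_scaleR_def
      by (subst nn_integral_eq_integral[OF intE[OF int_incr[OF st]]]) auto
    also have "\<dots> = (\<integral>\<^sup>+\<omega>\<in>E. ennreal (S t \<omega> - S s \<omega>) \<partial>M)"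
      by (intro nn_integral_cong) (auto split: split_indicator)
    also note incr[OF st E]
    also have "(\<integral>\<^sup>+\<omega>\<in>E. ennreal ((t - s) * \<mu> * \<Theta> \<omega>) \<partial>M) = (\<integral>\<^sup>+\<omega>. ennreal (indicat_real E \<omega> * ((t - s) * \<mu> * \<Theta> \<omega>)) \<partial>M)"
      by (intro nn_integral_cong) (auto split: split_indicator)
    also have "\<dots> = ennreal (\<integral>\<omega>\<in>E. ((t - s) * \<mu> * \<Theta> \<omega>) \<partial>M)"
      using \<Theta>_pos \<mu>_pos st unfolding set_lebesgue_integral_def real_scaleR_def
      by (subst nn_integral_eq_integral[OF intE[OF int\<Theta>]]) (auto elim!: eventually_mono)
    finally have "ennreal (\<integral>\<omega>\<in>E. (S t \<omega> - S s \<omega>) \<partial>M) = ennreal (\<integral>\<omega>\<in>E. ((t - s) * \<mu> * \<Theta> \<omega>) \<partial>M)" .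
    moreover have "0 \<le> (\<integral>\<omega>\<in>E. (S t \<omega> - S s \<omega>) \<partial>M)" "0 \<le> (\<integral>\<omega>\<in>E. ((t - s) * \<mu> * \<Theta> \<omega>) \<partial>M)"
      unfolding set_lebesgue_integral_def using aggregate_mono[OF _ st] \<Theta>_pos \<mu>_pos st
      by (auto intro!: integral_nonneg_AE elim!: eventually_mono)
    ultimately have eq: "(\<integral>\<omega>\<in>E. (S t \<omega> - S s \<omega>) \<partial>M) = (\<integral>\<omega>\<in>E. ((t - s) * \<mu> * \<Theta> \<omega>) \<partial>M)"
      by (subst (asm) ennreal_inj)
    have "(\<integral>\<omega>\<in>E. (S t \<omega> - t * \<Theta> \<omega> * \<mu>) \<partial>M) - (\<integral>\<omega>\<in>E. (S s \<omega> - s * \<Theta> \<omega> * \<mu>) \<partial>M) =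
      (\<integral>\<omega>\<in>E. ((S t \<omega> - t * \<Theta> \<omega> * \<mu>) - (S s \<omega> - s * \<Theta> \<omega> * \<mu>)) \<partial>M)"
      using st by (intro set_integral_diff(2)[symmetric]) (auto simp: set_integrable_def intro!: intE int_Z)
    also have "\<dots> = (\<integral>\<omega>\<in>E. ((S t \<omega> - S s \<omega>) - (t - s) * \<mu> * \<Theta> \<omega>) \<partial>M)"
      by (rule arg_cong[where f="set_lebesgue_integral M E"]) (simp add: fun_eq_iff algebra_simps)
    also have "\<dots> = (\<integral>\<omega>\<in>E. (S t \<omega> - S s \<omega>) \<partial>M) - (\<integral>\<omega>\<in>E. ((t - s) * \<mu> * \<Theta> \<omega>) \<partial>M)"
      unfolding set_integrable_def
      by (intro set_integral_diff(2)) (simp_all only: set_integrable_def real_scaleR_def intE[OF int_incr[OF st]] intE[OF int\<Theta>])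
    also have "\<dots> = 0" using eq by simp
    finally show "(\<integral>\<omega>\<in>E. (S s \<omega> - s * \<Theta> \<omega> * \<mu>) \<partial>M) = (\<integral>\<omega>\<in>E. (S t \<omega> - t * \<Theta> \<omega> * \<mu>) \<partial>M)" by simp
  qed
qed

end

end

theorem theorem3p5:
  fixes M :: "'a measure"
    and N :: "real \<Rightarrow> 'a \<Rightarrow> nat"
    and X :: "nat \<Rightarrow> 'a \<Rightarrow> real"
    and S :: "real \<Rightarrow> 'a \<Rightarrow> real"
    and W :: "nat \<Rightarrow> 'a \<Rightarrow> real"
    and \<Theta> :: "'a \<Rightarrow> real"
  assumes "prob_space M"
    and "risk_process M N X"
    and S_def: "S = aggregate N X"
    and W_def: "W = interarrival N"
    and "\<Theta> \<in> borel_measurable M"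
    and "measure (distr M borel \<Theta>) {0<..} = 1"
    and "sets M = sets (enlarged_filtration_inf M S \<Theta>)"
    and "\<exists>R. regular_cond_prob M \<Theta> R \<and> consistent_with M \<Theta> R"
    and a1: "cond_indep_set M (sigma_rv M \<Theta>) (sets (sigma_seq M W)) (sets (sigma_seq M X))"
    and a2: "prob_space.indep_set M (sets (sigma_rv M \<Theta>)) (sets (sigma_seq M X))"
    and "integrable M (X 1)"
    and "integrable M \<Theta>"
  shows "compound_mixed_poisson M N X S \<Theta> (distr M borel (X 1)) \<longleftrightarrow>
    martingale M (enlarged_filtration M S \<Theta>)
      (\<lambda>t \<omega>. S t \<omega> - t * \<Theta> \<omega> * prob_space.expectation M (X 1))"
proof -
  interpret prob_space M by fact
  have "AE \<omega> in M. 0 < \<Theta> \<omega>"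
  proof -
    have "prob {\<omega> \<in> space M. \<Theta> \<omega> \<in> {0<..}} = 1"
      using assms(5,6) by (simp add: measure_distr vimage_def Int_def conj_commute)
    then show ?thesis using assms(5) by (subst (asm) prob_Collect_eq_1) auto
  qed
  then interpret risk: risk_setting M N X \<Theta>
    using assms by unfold_locales (simp_all add: W_def)
  \<comment> \<open>The clauses on the risk process, on \<open>S\<close> and on the law of the sizes
    hold here by hypothesis or by reflexivity, so only the mixed Poisson clause remains.\<close>
  have "compound_mixed_poisson M N X S \<Theta> (distr M borel (X 1)) \<longleftrightarrow> mixed_poisson M N \<Theta>"
    using assms(2) by (simp add: compound_mixed_poisson_def S_def)
  also have "\<dots> \<longleftrightarrow> martingale M (enlarged_filtration M S \<Theta>) (\<lambda>t \<omega>. S t \<omega> - t * \<Theta> \<omega> * expectation (X 1))"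
    using risk.martingale_imp_mixed_poisson risk.martingale_aggregate by (auto simp: S_def risk.\<mu>_def)
  finally show ?thesis .
qed

end
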